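(* Let $(A,B)$ be a pair of real random variables and let $\alpha>0$. Suppose that (1) $A\ge 0$ a.s. and the conditional law of $\log A$ given $A>0$ is non-arithmetic; (2) $\mathbb{E}A^{\alpha}=1$ and $\rho:=\mathbb{E}[A^{\alpha}\log A]<\infty$; (3) the function $L(x):=x^{\alpha}\mathbb{P}(B>x)$ is slowly varying, $\mathbb{E}B_+^{\alpha}=\infty$, and $\mathbb{E}B_-^{\alpha-\varepsilon}<\infty$ for all $\varepsilon\in(0,\alpha)$; (4) $\mathbb{E}[A^{\eta}B_+^{\alpha-\eta}]<\infty$ for some $\eta\in(0,\alpha)\cap(0,1]$. Let $R$ be the (unique in law) solution of $R\stackrel{d}{=}AR+B$ with $R$ and $(A,B)$ independent. Then, as $x\to\infty$, $$x^{\alpha}\,\mathbb{P}(R>x)\sim\frac1\rho\int_0^x\frac{L(t)}{t}\,dt .$$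
   Context: $a_+=\max\{a,0\}$ and $a_-=\max\{-a,0\}$. $f(x)\sim g(x)$ means $\lim_{x\to\infty}f(x)/g(x)=1$. A measurable $L:(0,\infty)\to(0,\infty)$ is slowly varying if $L(\lambda x)/L(x)\to1$ as $x\to\infty$ for every $\lambda>0$. A law on $\mathbb{R}$ is arithmetic if it is supported in $d\mathbb{Z}$ for some $d>0$, and non-arithmetic otherwise. The convention $0^\alpha\log 0=0$ is used. The assumptions guarantee $\mathbb{E}\log|A|<0$ and $\mathbb{E}\log^+|B|<\infty$, under which a solution $R$ of $R\stackrel{d}{=}AR+B$ ($R$ independent of $(A,B)$) exists and is unique in law. *)

theory Defs
  imports "HOL-Probability.Probability" "HOL-Library.Landau_Symbols"
begin

definition slowly_varying :: "(real \<Rightarrow> real) \<Rightarrow> bool" where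
  "slowly_varying L \<longleftrightarrow>
     L \<in> borel_measurable (restrict_space borel {0<..}) \<and>
     (\<forall>x>0. L x > 0) \<and>
     (\<forall>c>0. ((\<lambda>x. L (c * x) / L x) \<longlongrightarrow> 1) at_top)"

definition arithmetic_law :: "real measure \<Rightarrow> bool" where
  "arithmetic_law \<mu> \<longleftrightarrow> (\<exists>d>0. AE x in \<mu>. \<exists>k::int. x = d * of_int k)"

definition cond_log_law :: "'a measure \<Rightarrow> ('a \<Rightarrow> real) \<Rightarrow> real measure" where
  "cond_log_law M A =
     distr (uniform_measure M {w \<in> space M. A w > 0}) borel (\<lambda>w. ln (A w))"

text \<open>Independence of two random variables with values in possibly different types, as
  independence of the generated sigma-algebras; the library's \<open>indep_var\<close> requires both
  to take values in the same type.\<close>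

definition indep_rv :: "'a measure \<Rightarrow> 'b measure \<Rightarrow> ('a \<Rightarrow> 'b) \<Rightarrow> 'c measure \<Rightarrow> ('a \<Rightarrow> 'c) \<Rightarrow> bool" where
  "indep_rv M N X N' Y \<longleftrightarrow>
     X \<in> measurable M N \<and> Y \<in> measurable M N' \<and>
     prob_space.indep_set M
       (sets (vimage_algebra (space M) X N)) (sets (vimage_algebra (space M) Y N'))"

definition perpetuity_solution ::
    "'a measure \<Rightarrow> ('a \<Rightarrow> real) \<Rightarrow> ('a \<Rightarrow> real) \<Rightarrow> ('a \<Rightarrow> real) \<Rightarrow> bool" where
  "perpetuity_solution M A B R \<longleftrightarrow>
     indep_rv M borel R (borel \<Otimes>\<^sub>M borel) (\<lambda>w. (A w, B w)) \<and>
     distr M borel R = distr M borel (\<lambda>w. A w * R w + B w)"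

end

theory Submission
  imports Defs
begin

text \<open>Put \<open>r u = exp (\<alpha> * u) * P(R > exp u)\<close> and \<open>l u = exp (\<alpha> * u) * P(B > exp u)\<close>. Under the
  tilted law \<open>A powr \<alpha> dP\<close> the variable \<open>ln A\<close> has mean \<open>\<rho> > 0\<close>, and the fixed point equation becomes
  \<open>r = step r + l\<close> up to errors, where \<open>step\<close> averages over one increment of the tilted random walk.

  Instead of a renewal theorem the proof uses explicit potentials. For \<open>barrier t = min 1 (exp (\<beta> * t))\<close>
  the function \<open>kern = barrier - step barrier\<close> is nonnegative with integral \<open>\<rho>\<close>, and
  \<open>g = conv l barrier\<close> solves \<open>g = step g + conv l kern\<close>. Slow variation gives
  \<open>conv l kern \<approx> \<rho> * l\<close> and \<open>g \<approx> cum\<close>, the integral of \<open>l\<close>. Since \<open>step\<close> contracts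
  \<open>exp (\<beta> * u)\<close>, a maximum principle yields \<open>r \<le> (1 + \<epsilon>) / \<rho> * cum + const\<close>; the identity
  \<open>conv r kern = conv (r - step r) barrier \<approx> g\<close> then forces the matching lower bound.\<close>

section \<open>Convolution and a random walk with positive drift\<close>

text \<open>With the indicator of a half-line in place of \<open>barrier\<close>, \<open>g\<close>
  would be \<open>cum\<close> itself, but the walk may step downwards, so \<open>step\<close> does
  not lower that indicator. Cutting the superharmonic \<open>exp (\<beta> * t)\<close> off at the
  harmonic constant 1 repairs this at a cost of o(\<open>cum\<close>). The rate is
  \<open>\<beta> = \<alpha> / 2\<close>: \<open>step\<close> then multiplies
  \<open>exp (\<beta> * u)\<close> by E \<open>A powr (\<alpha> / 2)\<close> < 1, and Markov's
  inequality for a moment of \<open>R\<close> of order \<alpha>/2 gives the growth bound from which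
  the maximum principle starts. Two obstacles shape the rest. An integrable error need not be
  dominated pointwise by its convolution with \<open>kern\<close>, so the upper bound compares
  averages over short windows, and monotonicity of tails undoes the averaging. And the loss caused
  by the negative part of \<open>B\<close> is not shown to be integrable; its estimate needs an
  upper bound for the tail of \<open>R\<close>, so the upper half has to be finished before the
  lower half. Functions take values in \<open>ennreal\<close>, so Tonelli applies freely and only
  cancellations require finiteness.\<close>

lemma nn_integral_shift:
  fixes f :: "real \<Rightarrow> ennreal"
  assumes [measurable]: "f \<in> borel_measurable borel"
  shows "(\<integral>\<^sup>+s. f (s + c) \<partial>lborel) = (\<integral>\<^sup>+s. f s \<partial>lborel)"
  using nn_integral_real_affine[of f 1 c] by (simp add: add.commute)

lemma nn_integral_reflect:
  fixes f :: "real \<Rightarrow> ennreal"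
  assumes [measurable]: "f \<in> borel_measurable borel"
  shows "(\<integral>\<^sup>+s. f (c - s) \<partial>lborel) = (\<integral>\<^sup>+s. f s \<partial>lborel)"
  using nn_integral_real_affine[of f "-1" c] by simp

lemma nn_integral_exp_atLeast:
  fixes c v :: real
  assumes "c > 0"
  shows "(\<integral>\<^sup>+s. ennreal (exp (- c * s)) * indicator {v..} s \<partial>lborel) = ennreal (exp (- c * v) / c)"
proof -
  have "(\<integral>\<^sup>+s. ennreal (exp (- c * s)) * indicator {v..} s \<partial>lborel) = ennreal (0 - (- exp (- c * v) / c))"
  proof (rule nn_integral_FTC_atLeast)
    show "((\<lambda>s. - exp (- c * s) / c) \<longlongrightarrow> 0) at_top"
      using assms by real_asymp
    show "DERIV (\<lambda>s. - exp (- c * s) / c) x :> exp (- c * x)" for x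
      using assms by (auto intro!: derivative_eq_intros)
  qed auto
  then show ?thesis by simp
qed

lemma nn_integral_exp_atMost:
  fixes c v :: real
  assumes "c > 0"
  shows "(\<integral>\<^sup>+s. ennreal (exp (c * s)) * indicator {..v} s \<partial>lborel) = ennreal (exp (c * v) / c)"
proof -
  have "(\<integral>\<^sup>+s. ennreal (exp (c * s)) * indicator {..v} s \<partial>lborel)
      = (\<integral>\<^sup>+s. ennreal (exp (c * (0 - s))) * indicator {..v} (0 - s) \<partial>lborel)"
    by (rule nn_integral_reflect[symmetric]) measurable
  also have "\<dots> = (\<integral>\<^sup>+s. ennreal (exp (- c * s)) * indicator {-v..} s \<partial>lborel)"
    by (intro nn_integral_cong) (auto split: split_indicator)
  finally show ?thesis
    using nn_integral_exp_atLeast[OF assms, of "-v"] by simp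
qed

definition conv :: "(real \<Rightarrow> ennreal) \<Rightarrow> (real \<Rightarrow> ennreal) \<Rightarrow> real \<Rightarrow> ennreal" where
  "conv f g u = (\<integral>\<^sup>+s. f s * g (u - s) \<partial>lborel)"

lemma measurable_conv [measurable]:
  assumes [measurable]: "f \<in> borel_measurable borel" "g \<in> borel_measurable borel"
  shows "conv f g \<in> borel_measurable borel"
  unfolding conv_def by measurable

lemma conv_commute:
  assumes [measurable]: "f \<in> borel_measurable borel" "g \<in> borel_measurable borel"
  shows "conv f g u = conv g f u"
proof -
  have "(\<integral>\<^sup>+s. g (u - s) * f (u - (u - s)) \<partial>lborel) = (\<integral>\<^sup>+s. g s * f (u - s) \<partial>lborel)"
    by (rule nn_integral_reflect[where f = "\<lambda>s. g s * f (u - s)"]) measurable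
  then show ?thesis by (simp add: conv_def mult.commute)
qed

lemma conv_add:
  assumes [measurable]: "f \<in> borel_measurable borel" "f' \<in> borel_measurable borel" "g \<in> borel_measurable borel"
  shows "conv (\<lambda>s. f s + f' s) g u = conv f g u + conv f' g u"
  by (simp add: conv_def distrib_right nn_integral_add)

lemma conv_add_right:
  assumes [measurable]: "f \<in> borel_measurable borel" "g \<in> borel_measurable borel" "g' \<in> borel_measurable borel"
  shows "conv f (\<lambda>s. g s + g' s) u = conv f g u + conv f g' u"
  by (simp add: conv_def distrib_left nn_integral_add)

lemma conv_cmult:
  assumes [measurable]: "f \<in> borel_measurable borel" "g \<in> borel_measurable borel"
  shows "conv (\<lambda>s. c * f s) g u = c * conv f g u"
  by (simp add: conv_def mult.assoc nn_integral_cmult)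

lemma conv_mono: "(\<And>s. f s \<le> f' s) \<Longrightarrow> conv f g u \<le> conv f' g u"
  unfolding conv_def by (intro nn_integral_mono mult_right_mono) auto

section \<open>Averaging operator of a walk with positive drift, and its maximum principle\<close>

locale drift_walk = prob_space \<mu> for \<mu> :: "real measure" +
  fixes \<rho> \<beta> \<theta> :: real
  assumes sets_mu [measurable_cong]: "sets \<mu> = sets borel"
    and int_mu: "integrable \<mu> (\<lambda>x. x)"
    and mean: "(\<integral>x. x \<partial>\<mu>) = \<rho>"
    and beta_pos: "\<beta> > 0"
    and theta: "(\<integral>\<^sup>+x. ennreal (exp (- \<beta> * x)) \<partial>\<mu>) = ennreal \<theta>" "0 \<le> \<theta>" "\<theta> < 1"
begin

definition step :: "(real \<Rightarrow> ennreal) \<Rightarrow> real \<Rightarrow> ennreal" where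
  "step f u = (\<integral>\<^sup>+x. f (u - x) \<partial>\<mu>)"

lemma measurable_step [measurable]:
  assumes [measurable]: "f \<in> borel_measurable borel"
  shows "step f \<in> borel_measurable borel"
  unfolding step_def by measurable

lemma step_mono: "(\<And>s. f s \<le> g s) \<Longrightarrow> step f u \<le> step g u"
  unfolding step_def by (intro nn_integral_mono) auto

lemma step_add:
  assumes [measurable]: "f \<in> borel_measurable borel" "g \<in> borel_measurable borel"
  shows "step (\<lambda>s. f s + g s) u = step f u + step g u"
  unfolding step_def by (intro nn_integral_add) measurable

lemma step_exp:
  assumes "K \<ge> 0"
  shows "step (\<lambda>s. ennreal (K * exp (\<beta> * s))) u = ennreal (\<theta> * K * exp (\<beta> * u))"
proof -
  have "step (\<lambda>s. ennreal (K * exp (\<beta> * s))) u = (\<integral>\<^sup>+x. ennreal (K * exp (\<beta> * u)) * ennreal (exp (- \<beta> * x)) \<partial>\<mu>)"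
    unfolding step_def
  proof (intro nn_integral_cong)
    fix x
    have "exp (\<beta> * (u - x)) = exp (\<beta> * u) * exp (- \<beta> * x)"
      by (simp add: algebra_simps flip: exp_add)
    then show "ennreal (K * exp (\<beta> * (u - x))) = ennreal (K * exp (\<beta> * u)) * ennreal (exp (- \<beta> * x))"
      using assms by (simp add: mult.assoc ennreal_mult)
  qed
  also have "\<dots> = ennreal (K * exp (\<beta> * u)) * ennreal \<theta>"
    by (subst nn_integral_cmult) (use theta in auto)
  finally show ?thesis
    using assms theta by (simp add: algebra_simps flip: ennreal_mult)
qed

text \<open>Formally \<open>r - g\<close> is subharmonic and at most
  \<open>K * exp (\<beta> * u)\<close>, and every application of \<open>step\<close> gains a factor
  \<open>\<theta> < 1\<close>. The excess is carried as an added term because subtraction in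
  \<open>ennreal\<close> truncates.\<close>

lemma comparison:
  fixes r g h :: "real \<Rightarrow> ennreal"
  assumes [measurable]: "g \<in> borel_measurable borel"
    and r: "\<And>u. r u \<le> step r u + h u"
    and g: "\<And>u. step g u + h u \<le> g u"
    and K: "K \<ge> 0" "\<And>u. r u \<le> ennreal (K * exp (\<beta> * u))"
  shows "r u \<le> g u"
proof -
  have bound: "r u \<le> g u + ennreal (\<theta> ^ n * K * exp (\<beta> * u))" for n u
  proof (induction n arbitrary: u)
    case 0
    then show ?case using K(2)[of u] by (simp add: add_increasing)
  next
    case (Suc n)
    have "r u \<le> step r u + h u" by (rule r)
    also have "step r u \<le> step (\<lambda>u. g u + ennreal (\<theta> ^ n * K * exp (\<beta> * u))) u"
      by (intro step_mono Suc)
    also have "\<dots> = step g u + step (\<lambda>u. ennreal (\<theta> ^ n * K * exp (\<beta> * u))) u"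
      by (intro step_add) measurable
    also have "step (\<lambda>u. ennreal (\<theta> ^ n * K * exp (\<beta> * u))) u = ennreal (\<theta> * (\<theta> ^ n * K) * exp (\<beta> * u))"
      using theta K by (intro step_exp) auto
    also have "step g u + ennreal (\<theta> * (\<theta> ^ n * K) * exp (\<beta> * u)) + h u
        = (step g u + h u) + ennreal (\<theta> * (\<theta> ^ n * K) * exp (\<beta> * u))"
      by (simp add: ac_simps)
    also have "\<dots> \<le> g u + ennreal (\<theta> * (\<theta> ^ n * K) * exp (\<beta> * u))"
      by (intro add_right_mono g)
    finally show ?case by (simp add: mult.assoc)
  qed
  have "(\<lambda>n. \<theta> ^ n * K * exp (\<beta> * u)) \<longlonglongrightarrow> 0 * K * exp (\<beta> * u)"
    using theta by (intro tendsto_intros LIMSEQ_power_zero) auto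
  then have "(\<lambda>n. g u + ennreal (\<theta> ^ n * K * exp (\<beta> * u))) \<longlonglongrightarrow> g u + ennreal 0"
    by (intro tendsto_intros tendsto_ennrealI) auto
  then show ?thesis
    using bound by (intro LIMSEQ_le_const[where X = "\<lambda>n. g u + ennreal (\<theta> ^ n * K * exp (\<beta> * u))"]) auto
qed

section \<open>Barrier, kernel and drift\<close>

definition barrier :: "real \<Rightarrow> ennreal" where
  "barrier t = ennreal (min 1 (exp (\<beta> * t)))"

lemma measurable_barrier [measurable]: "barrier \<in> borel_measurable borel"
  unfolding barrier_def by measurable

lemma barrier_le_1: "barrier t \<le> 1"
  by (simp add: barrier_def ennreal_le_1)

lemma barrier_le_exp: "barrier t \<le> ennreal (exp (\<beta> * t))"
  by (simp add: barrier_def ennreal_leI)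

lemma barrier_mono: "s \<le> t \<Longrightarrow> barrier s \<le> barrier t"
  using beta_pos unfolding barrier_def by (intro ennreal_leI min.mono) auto

lemma barrier_shift: 
  assumes "t \<ge> 0"
  shows "barrier (s + t) \<le> ennreal (exp (\<beta> * t)) * barrier s"
proof -
  have "1 \<le> exp (\<beta> * t)" using assms beta_pos by simp
  then have "min 1 (exp (\<beta> * (s + t))) \<le> min (exp (\<beta> * t)) (exp (\<beta> * t) * exp (\<beta> * s))"
    by (intro min.mono) (auto simp: distrib_left exp_add)
  also have "\<dots> = exp (\<beta> * t) * min 1 (exp (\<beta> * s))"
    by (simp add: min_mult_distrib_left)
  finally have "min 1 (exp (\<beta> * (s + t))) \<le> exp (\<beta> * t) * min 1 (exp (\<beta> * s))" .
  then show ?thesis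
    by (auto simp: barrier_def simp flip: ennreal_mult intro!: ennreal_leI)
qed

lemma barrier_nonneg_arg: "t \<ge> 0 \<Longrightarrow> barrier t = 1"
  using beta_pos by (simp add: barrier_def)

lemma barrier_nonpos_arg: "t \<le> 0 \<Longrightarrow> barrier t = ennreal (exp (\<beta> * t))"
  using beta_pos by (simp add: barrier_def min_absorb2 mult_nonneg_nonpos)

lemma step_barrier_le_exp: "step barrier t \<le> ennreal (\<theta> * exp (\<beta> * t))"
proof -
  have "step barrier t \<le> step (\<lambda>s. ennreal (1 * exp (\<beta> * s))) t"
    using barrier_le_exp by (intro step_mono) auto
  then show ?thesis by (subst (asm) step_exp) auto
qed

lemma step_barrier_le: "step barrier t \<le> barrier t"
proof (cases "t \<ge> 0")
  case True
  have "step barrier t \<le> step (\<lambda>_. 1) t" by (intro step_mono barrier_le_1)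
  also have "\<dots> = 1" by (simp add: step_def emeasure_space_1)
  finally show ?thesis using True by (simp add: barrier_nonneg_arg)
next
  case False
  have "step barrier t \<le> ennreal (\<theta> * exp (\<beta> * t))" by (rule step_barrier_le_exp)
  also have "\<dots> \<le> ennreal (exp (\<beta> * t))"
    using theta by (intro ennreal_leI) (simp add: mult_left_le_one_le)
  finally show ?thesis using False by (simp add: barrier_nonpos_arg)
qed

definition kern :: "real \<Rightarrow> ennreal" where
  "kern t = barrier t - step barrier t"

lemma measurable_kern [measurable]: "kern \<in> borel_measurable borel"
  unfolding kern_def by measurable

lemma step_barrier_finite: "step barrier t < \<top>"
  using step_barrier_le[of t] by (rule le_less_trans) (simp add: barrier_def)

lemma kern_add_step: "kern t + step barrier t = barrier t"
  unfolding kern_def using step_barrier_le[of t] step_barrier_finite[of t]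
  by (simp add: diff_add_cancel_ennreal)

lemma kern_le: "kern t \<le> barrier t"
  unfolding kern_def by (simp add: diff_le_self_ennreal)

text \<open>Left of 0 \<open>barrier\<close> is a pure exponential, which \<open>step\<close>
  shrinks by at least the factor \<open>\<theta>\<close>. This keeps \<open>kern\<close> bounded
  away from 0 on compact intervals there.\<close>

lemma kern_ge:
  assumes "t \<le> 0"
  shows "ennreal ((1 - \<theta>) * exp (\<beta> * t)) \<le> kern t"
proof -
  have "ennreal ((1 - \<theta>) * exp (\<beta> * t)) = ennreal (exp (\<beta> * t)) - ennreal (\<theta> * exp (\<beta> * t))"
    using theta by (subst ennreal_minus) (auto simp: algebra_simps)
  also have "\<dots> \<le> kern t"
    unfolding kern_def barrier_nonpos_arg[OF assms]
    by (intro ennreal_minus_mono step_barrier_le_exp) auto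
  finally show ?thesis .
qed

text \<open>\<open>barrier\<close> is a distribution function, and for each of its levels the points
  between the level set and its translate by \<open>x\<close> form an interval of length
  \<open>x\<close>. For \<open>x < 0\<close> truncated subtraction makes both sides 0.\<close>

lemma nn_integral_barrier_diff:
  "(\<integral>\<^sup>+t. (barrier t - barrier (t - x)) \<partial>lborel) = ennreal x"
proof (cases "x \<ge> 0")
  case True
  \<comment> \<open>\<open>barrier t\<close> is the length of \<open>{z. 0 < z \<and> z < 1 \<and> ln z / \<beta> < t}\<close>.\<close>
  have *: "barrier t - barrier (t - x)
     = (\<integral>\<^sup>+z. indicator {0<..<1} z * indicator {ln z / \<beta><..ln z / \<beta> + x} t \<partial>lborel)" for t
  proof -
    define p q where "p = min 1 (exp (\<beta> * (t - x)))" and "q = min 1 (exp (\<beta> * t))"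
    have "p > 0" unfolding p_def by simp
    have "q \<le> 1" unfolding q_def by simp
    have "p \<le> q" using True beta_pos unfolding p_def q_def by (intro min.mono) auto
    have key: "(ln z / \<beta> < t \<and> t \<le> ln z / \<beta> + x) \<longleftrightarrow> (z < exp (\<beta> * t) \<and> exp (\<beta> * (t - x)) \<le> z)"
      if "z > 0" for z
    proof -
      have "ln z / \<beta> < t \<longleftrightarrow> ln z < \<beta> * t" using beta_pos by (simp add: field_simps)
      moreover have "t \<le> ln z / \<beta> + x \<longleftrightarrow> \<beta> * (t - x) \<le> ln z" using beta_pos by (simp add: field_simps)
      moreover have "ln z < \<beta> * t \<longleftrightarrow> z < exp (\<beta> * t)" using that
        by (metis exp_less_cancel_iff exp_ln)
      moreover have "\<beta> * (t - x) \<le> ln z \<longleftrightarrow> exp (\<beta> * (t - x)) \<le> z" using that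
        by (metis exp_le_cancel_iff exp_ln)
      ultimately show ?thesis by simp
    qed
    have "(\<integral>\<^sup>+z. indicator {0<..<1} z * indicator {ln z / \<beta><..ln z / \<beta> + x} t \<partial>lborel)
       = (\<integral>\<^sup>+z. indicator {p..<q} z \<partial>lborel)"
    proof (intro nn_integral_cong)
      fix z
      have "(z \<in> {0<..<1} \<and> t \<in> {ln z / \<beta><..ln z / \<beta> + x}) \<longleftrightarrow> z \<in> {p..<q}"
      proof (cases "z > 0")
        case z: True
        then show ?thesis unfolding greaterThanAtMost_iff key[OF z]
          by (auto simp: p_def q_def)
      next
        case False
        then show ?thesis using \<open>p > 0\<close> by auto
      qed
      then show "indicator {0<..<1} z * indicator {ln z / \<beta><..ln z / \<beta> + x} t = (indicator {p..<q} z :: ennreal)"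
        by (auto split: split_indicator)
    qed
    also have "\<dots> = ennreal (q - p)" using \<open>p \<le> q\<close> by simp
    also have "\<dots> = barrier t - barrier (t - x)"
      unfolding barrier_def using \<open>p > 0\<close> by (simp add: ennreal_minus p_def q_def)
    finally show ?thesis by simp
  qed
  have "(\<integral>\<^sup>+t. (barrier t - barrier (t - x)) \<partial>lborel)
      = (\<integral>\<^sup>+z. (\<integral>\<^sup>+t. indicator {0<..<1} z * indicator {ln z / \<beta><..ln z / \<beta> + x} t \<partial>lborel) \<partial>lborel)"
    unfolding * by (intro lborel_pair.Fubini') (simp add: greaterThanAtMost_def greaterThan_def atMost_def)
  also have "\<dots> = (\<integral>\<^sup>+z. indicator {0<..<1::real} z * ennreal x \<partial>lborel)"
    using True by (intro nn_integral_cong, subst nn_integral_cmult) auto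
  also have "\<dots> = ennreal x"
    by (subst nn_integral_multc) auto
  finally show ?thesis .
next
  case False
  then have "barrier t - barrier (t - x) = 0" for t
    using barrier_mono[of t "t - x"] by (simp add: diff_eq_0_iff_ennreal barrier_def)
  then show ?thesis using False by (simp add: ennreal_neg)
qed

text \<open>By Tonelli and \<open>nn_integral_barrier_diff\<close> the mass of \<open>kern\<close>
  is the mean of the walk. Since \<open>barrier t - barrier (t - x)\<close> changes sign with
  \<open>x\<close>, its positive and negative parts \<open>up\<close> and \<open>dn\<close> are
  integrated separately and matched with those of the mean.\<close>

lemma nn_integral_kern: "(\<integral>\<^sup>+t. kern t \<partial>lborel) = ennreal \<rho>"
proof -
  define up where "up t = (\<integral>\<^sup>+x. (barrier t - barrier (t - x)) \<partial>\<mu>)" for t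
  define dn where "dn t = (\<integral>\<^sup>+x. (barrier (t - x) - barrier t) \<partial>\<mu>)" for t
  have [measurable]: "up \<in> borel_measurable borel" "dn \<in> borel_measurable borel"
    unfolding up_def dn_def by measurable
  have fin: "barrier t < \<top>" for t by (simp add: barrier_def)
  \<comment> \<open>Truncated subtraction turns both sides into \<open>max a b\<close>.\<close>
  have maxeq: "a + (b - a) = b + (a - b)" if "a < \<top>" "b < \<top>" for a b :: ennreal
    using that
    by (metis add.commute add_diff_inverse_ennreal add.right_neutral diff_eq_0_iff_ennreal linear top.not_eq_extremum)
  have "kern t + dn t = up t" for t
  proof -
    have "step barrier t + up t = (\<integral>\<^sup>+x. barrier (t - x) + (barrier t - barrier (t - x)) \<partial>\<mu>)"
      unfolding step_def up_def by (intro nn_integral_add[symmetric]) measurable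
    also have "\<dots> = (\<integral>\<^sup>+x. barrier t + (barrier (t - x) - barrier t) \<partial>\<mu>)"
      by (intro nn_integral_cong maxeq fin)
    also have "\<dots> = barrier t + dn t"
      unfolding dn_def by (subst nn_integral_add) (auto simp: emeasure_space_1)
    also have "\<dots> = step barrier t + (kern t + dn t)"
      by (subst kern_add_step[symmetric]) (simp add: ac_simps)
    finally show ?thesis using step_barrier_finite[of t] by (auto simp: ennreal_add_left_cancel)
  qed
  then have "(\<integral>\<^sup>+t. kern t \<partial>lborel) + (\<integral>\<^sup>+t. dn t \<partial>lborel) = (\<integral>\<^sup>+t. up t \<partial>lborel)"
    by (subst nn_integral_add[symmetric]) auto
  moreover have "(\<integral>\<^sup>+t. up t \<partial>lborel) = (\<integral>\<^sup>+x. ennreal x \<partial>\<mu>)"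
  proof -
    interpret pair_sigma_finite lborel \<mu> ..
    have "(\<integral>\<^sup>+t. up t \<partial>lborel) = (\<integral>\<^sup>+x. (\<integral>\<^sup>+t. (barrier t - barrier (t - x)) \<partial>lborel) \<partial>\<mu>)"
      unfolding up_def by (intro Fubini'[symmetric]) measurable
    then show ?thesis by (simp add: nn_integral_barrier_diff)
  qed
  moreover have "(\<integral>\<^sup>+t. dn t \<partial>lborel) = (\<integral>\<^sup>+x. ennreal (- x) \<partial>\<mu>)"
  proof -
    interpret pair_sigma_finite lborel \<mu> ..
    have "(\<integral>\<^sup>+t. dn t \<partial>lborel) = (\<integral>\<^sup>+x. (\<integral>\<^sup>+t. (barrier (t - x) - barrier t) \<partial>lborel) \<partial>\<mu>)"
      unfolding dn_def by (intro Fubini'[symmetric]) measurable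
    also have "\<dots> = (\<integral>\<^sup>+x. ennreal (- x) \<partial>\<mu>)"
    proof (intro nn_integral_cong)
      fix x
      have "(\<integral>\<^sup>+t. (barrier ((t + x) - x) - barrier (t + x)) \<partial>lborel) = (\<integral>\<^sup>+t. (barrier (t - x) - barrier t) \<partial>lborel)"
        by (rule nn_integral_shift[where f = "\<lambda>t. barrier (t - x) - barrier t"]) measurable
      then show "(\<integral>\<^sup>+t. (barrier (t - x) - barrier t) \<partial>lborel) = ennreal (- x)"
        using nn_integral_barrier_diff[of "- x"] by simp
    qed
    finally show ?thesis .
  qed
  ultimately have eq: "(\<integral>\<^sup>+t. kern t \<partial>lborel) + (\<integral>\<^sup>+x. ennreal (- x) \<partial>\<mu>) = (\<integral>\<^sup>+x. ennreal x \<partial>\<mu>)"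
    by simp
  obtain p q where pq: "p \<ge> 0" "q \<ge> 0" "(\<integral>\<^sup>+x. ennreal x \<partial>\<mu>) = ennreal p" "(\<integral>\<^sup>+x. ennreal (- x) \<partial>\<mu>) = ennreal q"
     "\<rho> = p - q"
    using integrableE[OF int_mu] mean by metis
  have "(\<integral>\<^sup>+t. kern t \<partial>lborel) \<noteq> \<top>" using eq pq by auto
  then obtain k where k: "k \<ge> 0" "(\<integral>\<^sup>+t. kern t \<partial>lborel) = ennreal k"
    by (cases "\<integral>\<^sup>+t. kern t \<partial>lborel") auto
  have "k + q = p" using eq pq k by (simp flip: ennreal_plus)
  then show ?thesis using k pq by simp
qed

text \<open>Jensen's inequality would also give this from \<open>\<theta> < 1\<close>; here it is
  read off from the mass of \<open>kern\<close>, which is positive already on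
  \<open>{-1..0}\<close>.\<close>

lemma drift_pos: "\<rho> > 0"
proof -
  have "0 < ennreal ((1 - \<theta>) * exp (- \<beta>))" using theta by simp
  also have "\<dots> = (\<integral>\<^sup>+t. ennreal ((1 - \<theta>) * exp (- \<beta>)) * indicator {-1..0::real} t \<partial>lborel)"
    by (subst nn_integral_cmult_indicator) auto
  also have "\<dots> \<le> (\<integral>\<^sup>+t. kern t \<partial>lborel)"
  proof (intro nn_integral_mono)
    fix t :: real
    have "ennreal ((1 - \<theta>) * exp (- \<beta>)) \<le> kern t" if "t \<in> {-1..0}"
    proof -
      have "-\<beta> \<le> \<beta> * t" using that beta_pos mult_left_mono[of "-1" t \<beta>] by simp
      then have "ennreal ((1 - \<theta>) * exp (- \<beta>)) \<le> ennreal ((1 - \<theta>) * exp (\<beta> * t))"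
        using theta by (intro ennreal_leI mult_left_mono) auto
      also have "\<dots> \<le> kern t" using that by (intro kern_ge) auto
      finally show ?thesis .
    qed
    then show "ennreal ((1 - \<theta>) * exp (- \<beta>)) * indicator {-1..0} t \<le> kern t"
      by (auto split: split_indicator)
  qed
  finally show ?thesis by (simp add: nn_integral_kern)
qed

section \<open>Convolution with barrier and kernel\<close>

lemma conv_step_barrier:
  assumes [measurable]: "f \<in> borel_measurable borel"
  shows "conv f (step barrier) u = step (conv f barrier) u"
proof -
  interpret pair_sigma_finite lborel \<mu> ..
  have "conv f (step barrier) u = (\<integral>\<^sup>+s. (\<integral>\<^sup>+x. f s * barrier (u - x - s) \<partial>\<mu>) \<partial>lborel)"
    unfolding conv_def step_def
    by (intro nn_integral_cong) (simp add: nn_integral_cmult algebra_simps)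
  also have "\<dots> = (\<integral>\<^sup>+x. (\<integral>\<^sup>+s. f s * barrier (u - x - s) \<partial>lborel) \<partial>\<mu>)"
    by (intro Fubini'[symmetric]) measurable
  finally show ?thesis by (simp add: conv_def step_def)
qed

lemma conv_step:
  assumes [measurable]: "f \<in> borel_measurable borel"
  shows "conv (step f) barrier u = step (conv f barrier) u"
proof -
  interpret pair_sigma_finite lborel \<mu> ..
  have "conv (step f) barrier u = (\<integral>\<^sup>+s. (\<integral>\<^sup>+x. f (s - x) * barrier (u - s) \<partial>\<mu>) \<partial>lborel)"
    unfolding conv_def step_def
    by (intro nn_integral_cong) (simp add: nn_integral_multc)
  also have "\<dots> = (\<integral>\<^sup>+x. (\<integral>\<^sup>+s. f (s - x) * barrier (u - s) \<partial>lborel) \<partial>\<mu>)"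
    by (intro Fubini'[symmetric]) measurable
  also have "\<dots> = (\<integral>\<^sup>+x. conv f barrier (u - x) \<partial>\<mu>)"
  proof (intro nn_integral_cong)
    fix x
    have "(\<integral>\<^sup>+s. f ((s + x) - x) * barrier (u - (s + x)) \<partial>lborel) = (\<integral>\<^sup>+s. f (s - x) * barrier (u - s) \<partial>lborel)"
      by (rule nn_integral_shift[where f = "\<lambda>s. f (s - x) * barrier (u - s)"]) measurable
    then show "(\<integral>\<^sup>+s. f (s - x) * barrier (u - s) \<partial>lborel) = conv f barrier (u - x)"
      by (simp add: conv_def algebra_simps)
  qed
  finally show ?thesis by (simp add: step_def)
qed

lemma conv_barrier_eq:
  assumes [measurable]: "f \<in> borel_measurable borel"
  shows "conv f barrier u = conv f kern u + step (conv f barrier) u"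
proof -
  have "conv f barrier u = conv f (\<lambda>t. kern t + step barrier t) u"
    by (simp add: kern_add_step)
  also have "\<dots> = conv f kern u + conv f (step barrier) u"
    by (intro conv_add_right) measurable
  finally show ?thesis by (simp add: conv_step_barrier)
qed

text \<open>Convolving the inequality with \<open>barrier\<close> produces
  \<open>step (conv r barrier)\<close> on both sides, on the right through
  \<open>conv_barrier_eq\<close>. Finiteness allows its cancellation, and of the potential of
  \<open>r\<close> only the convolution with \<open>kern\<close> remains.\<close>

lemma conv_kern_barrier_ge:
  assumes [measurable]: "r \<in> borel_measurable borel" "l \<in> borel_measurable borel" "e \<in> borel_measurable borel"
    and le: "\<And>u. step r u + l u \<le> r u + e u"
    and fin: "conv r barrier u < \<top>"
  shows "conv l barrier u \<le> conv r kern u + conv e barrier u"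
proof -
  have "step (conv r barrier) u + conv l barrier u = conv (\<lambda>s. step r s + l s) barrier u"
    by (subst conv_add) (auto simp: conv_step)
  also have "\<dots> \<le> conv (\<lambda>s. r s + e s) barrier u"
    by (intro conv_mono le)
  also have "\<dots> = conv r barrier u + conv e barrier u"
    by (intro conv_add) measurable
  also have "conv r barrier u = conv r kern u + step (conv r barrier) u"
    by (intro conv_barrier_eq) measurable
  finally have *: "step (conv r barrier) u + conv l barrier u
      \<le> step (conv r barrier) u + (conv r kern u + conv e barrier u)"
    by (simp add: ac_simps)
  have "step (conv r barrier) u \<le> conv r barrier u"
    by (subst conv_barrier_eq) (auto simp: add_increasing)
  then have "step (conv r barrier) u < \<top>" using fin by (rule le_less_trans)
  with * show ?thesis by (auto simp: ennreal_add_left_cancel_le)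
qed

end

section \<open>Renewal asymptotics for slowly varying tails\<close>

lemma at_right_0_witness:
  fixes f :: "real \<Rightarrow> real"
  assumes "(f \<longlongrightarrow> y) (at_right 0)" "y < c"
  shows "\<exists>d>0. d < 1 \<and> f d < c"
proof -
  have "\<forall>\<^sub>F d in at_right 0. f d < c" using assms by (rule order_tendstoD)
  moreover have "\<forall>\<^sub>F d :: real in at_right 0. d \<in> {0<..<1}" by (rule eventually_at_rightI) auto
  ultimately have "\<forall>\<^sub>F d in at_right 0. d > 0 \<and> d < 1 \<and> f d < c" by eventually_elim auto
  then show ?thesis using eventually_happens'[OF trivial_limit_at_right_real] by blast
qed

lemma nn_integral_SUP_intervals:
  fixes f :: "real \<Rightarrow> ennreal"
  assumes [measurable]: "f \<in> borel_measurable borel"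
  shows "(SUP n. \<integral>\<^sup>+t. f t * indicator {-real n..real n} t \<partial>lborel) = (\<integral>\<^sup>+t. f t \<partial>lborel)"
proof -
  have "(SUP n. \<integral>\<^sup>+t. f t * indicator {-real n..real n} t \<partial>lborel)
      = (\<integral>\<^sup>+t. (SUP n. f t * indicator {-real n..real n} t) \<partial>lborel)"
    by (intro nn_integral_monotone_convergence_SUP[symmetric])
       (auto simp: incseq_def le_fun_def split: split_indicator)
  also have "\<dots> = (\<integral>\<^sup>+t. f t \<partial>lborel)"
  proof (intro nn_integral_cong antisym)
    fix t
    show "(SUP n. f t * indicator {-real n..real n} t) \<le> f t"
      by (auto intro!: SUP_least split: split_indicator)
    obtain n :: nat where "\<bar>t\<bar> \<le> real n" using real_arch_simple by blast
    then show "f t \<le> (SUP n. f t * indicator {-real n..real n} t)"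
      by (intro SUP_upper2[where i = n]) (auto split: split_indicator)
  qed
  finally show ?thesis .
qed

text \<open>The growth condition says that \<open>exp (- \<alpha> * u) * f u\<close> is decreasing,
  hence Borel.\<close>

lemma measurable_exp_growth:
  fixes f :: "real \<Rightarrow> real"
  assumes "\<And>u t. t \<ge> 0 \<Longrightarrow> f (u + t) \<le> exp (\<alpha> * t) * f u"
  shows "f \<in> borel_measurable borel"
proof -
  define g where "g u = - (exp (- \<alpha> * u) * f u)" for u
  have "mono g"
  proof (rule monoI)
    fix x y :: real assume "x \<le> y"
    then have "f y \<le> exp (\<alpha> * (y - x)) * f x" using assms[of "y - x" x] by simp
    then have "exp (- \<alpha> * y) * f y \<le> exp (- \<alpha> * y) * (exp (\<alpha> * (y - x)) * f x)"
      by (intro mult_left_mono) auto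
    also have "\<dots> = exp (- \<alpha> * x) * f x"
      by (simp add: algebra_simps flip: exp_add mult.assoc)
    finally show "g x \<le> g y" by (simp add: g_def)
  qed
  then have [measurable]: "g \<in> borel_measurable borel" by (rule borel_measurable_mono)
  have "f = (\<lambda>u. - (exp (\<alpha> * u) * g u))"
    by (auto simp: g_def fun_eq_iff simp flip: exp_add mult.assoc)
  also have "\<dots> \<in> borel_measurable borel" by measurable
  finally show ?thesis .
qed

text \<open>In logarithmic scale: \<open>l u = L (exp u)\<close> with \<open>L x / x powr \<alpha>\<close> a tail probability.\<close>

locale slow_tail =
  fixes l :: "real \<Rightarrow> real" and \<alpha> :: real
  assumes alpha_pos: "\<alpha> > 0"
    and l_pos: "\<And>u. l u > 0"
    and l_growth: "\<And>u t. t \<ge> 0 \<Longrightarrow> l (u + t) \<le> exp (\<alpha> * t) * l u"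
    and l_le: "\<And>u. l u \<le> exp (\<alpha> * u)"
    and l_slow: "\<And>t. ((\<lambda>u. l (u + t) / l u) \<longlongrightarrow> 1) at_top"
    and l_infinite: "(\<integral>\<^sup>+u. ennreal (l u) \<partial>lborel) = \<infinity>"
begin

lemma measurable_l [measurable]: "l \<in> borel_measurable borel"
  using l_growth by (rule measurable_exp_growth)

lemma l_nonneg: "l u \<ge> 0" using l_pos[of u] by simp

text \<open>Uniform convergence theorem for slow variation. Pointwise limits on a finite grid of
  mesh \<open>d\<close> suffice, because \<open>l_growth\<close> controls \<open>l\<close> between
  neighbouring grid points up to the factor \<open>exp (\<alpha> * d)\<close>.\<close>

lemma uniformly_slow:
  assumes "\<epsilon> > 0"
  shows "\<forall>\<^sub>F u in at_top. \<forall>t\<in>{-K..K}. (1 - \<epsilon>) * l u \<le> l (u + t) \<and> l (u + t) \<le> (1 + \<epsilon>) * l u"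
proof -
  \<comment> \<open>At \<open>d = 0\<close> both arguments of the maximum are
    \<open>1 - \<epsilon> / 2\<close>; a value below 1 encodes both inequalities wanted of
    \<open>d\<close>.\<close>
  have "((\<lambda>d. max (exp (\<alpha> * d) * (1 + \<epsilon> / 2) - \<epsilon>) (2 - \<epsilon> - exp (- \<alpha> * d) * (1 - \<epsilon> / 2)))
      \<longlongrightarrow> max (exp (\<alpha> * 0) * (1 + \<epsilon> / 2) - \<epsilon>) (2 - \<epsilon> - exp (- \<alpha> * 0) * (1 - \<epsilon> / 2))) (at_right 0)"
    by (intro tendsto_intros)
  from at_right_0_witness[OF this, of 1] assms
  obtain d where d: "d > 0" "exp (\<alpha> * d) * (1 + \<epsilon> / 2) < 1 + \<epsilon>"
      "exp (- \<alpha> * d) * (1 - \<epsilon> / 2) > 1 - \<epsilon>" by auto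
  define N :: int where "N = \<lceil>K / d\<rceil>"
  \<comment> \<open>The grid runs to \<open>N + 1\<close> because the lower bound at
    \<open>t\<close> uses the grid point to its right.\<close>
  have "\<forall>\<^sub>F u in at_top. \<forall>j\<in>{-N..N+1}. 1 - \<epsilon> / 2 < l (u + d * of_int j) / l u \<and> l (u + d * of_int j) / l u < 1 + \<epsilon> / 2"
    using assms by (intro eventually_ball_finite ballI eventually_conj order_tendstoD[OF l_slow]) auto
  then show ?thesis
  proof eventually_elim
    case (elim u)
    show ?case
    proof
      fix t assume t: "t \<in> {-K..K}"
      define j where "j = \<lfloor>t / d\<rfloor>"
      have j: "d * of_int j \<le> t" "t \<le> d * (of_int j + 1)"
        using floor_divide_lower[OF d(1), of t] floor_divide_upper[OF d(1), of t] by (auto simp: j_def mult.commute)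
      have "t / d \<ge> - (K / d)" "t / d \<le> K / d" using t d(1) by (auto simp: field_simps)
      then have "j \<in> {-N..N}" unfolding j_def N_def by (auto simp: le_floor_iff) linarith+
      then have *: "1 - \<epsilon> / 2 < l (u + d * of_int j) / l u" "l (u + d * of_int j) / l u < 1 + \<epsilon> / 2"
         "1 - \<epsilon> / 2 < l (u + d * of_int (j + 1)) / l u"
        using elim[rule_format, of j] elim[rule_format, of "j + 1"] by auto
      have "l (u + t) \<le> exp (\<alpha> * (t - d * of_int j)) * l (u + d * of_int j)"
        using l_growth[of "t - d * of_int j" "u + d * of_int j"] j by simp
      also have "\<dots> \<le> exp (\<alpha> * d) * l (u + d * of_int j)"
        using j alpha_pos l_nonneg mult_left_mono[of "t - d * of_int j" d \<alpha>] by (intro mult_right_mono) (auto simp: algebra_simps)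
      also have "\<dots> \<le> exp (\<alpha> * d) * ((1 + \<epsilon> / 2) * l u)"
        using *(2) l_pos[of u] by (intro mult_left_mono) (auto simp: field_simps)
      also have "\<dots> \<le> (1 + \<epsilon>) * l u"
        using d(2) l_pos[of u] by (simp flip: mult.assoc)
      finally have up: "l (u + t) \<le> (1 + \<epsilon>) * l u" .
      have "l (u + d * of_int (j + 1)) \<le> exp (\<alpha> * (d * of_int (j + 1) - t)) * l (u + t)"
        using l_growth[of "d * of_int (j + 1) - t" "u + t"] j by simp
      also have "\<dots> \<le> exp (\<alpha> * d) * l (u + t)"
        using j alpha_pos l_nonneg mult_left_mono[of "d * of_int (j + 1) - t" d \<alpha>] by (intro mult_right_mono) (auto simp: algebra_simps)
      finally have "exp (- \<alpha> * d) * l (u + d * of_int (j + 1)) \<le> exp (- \<alpha> * d) * (exp (\<alpha> * d) * l (u + t))"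
        by (intro mult_left_mono) auto
      also have "\<dots> = l (u + t)" by (simp flip: mult.assoc exp_add)
      finally have lo: "exp (- \<alpha> * d) * l (u + d * of_int (j + 1)) \<le> l (u + t)" .
      have "(1 - \<epsilon>) * l u \<le> exp (- \<alpha> * d) * (1 - \<epsilon> / 2) * l u"
        using d(3) l_pos[of u] by simp
      also have "\<dots> \<le> exp (- \<alpha> * d) * l (u + d * of_int (j + 1))"
        using *(3) l_pos[of u] unfolding mult.assoc by (intro mult_left_mono) (auto simp: field_simps)
      also note lo
      finally show "(1 - \<epsilon>) * l u \<le> l (u + t) \<and> l (u + t) \<le> (1 + \<epsilon>) * l u"
        using up by simp
    qed
  qed
qed

text \<open>Potter's bound: far out each unit step multiplies \<open>l\<close> by at most
  \<open>exp \<gamma>\<close>, and the last fractional step costs at most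
  \<open>exp \<alpha>\<close> by \<open>l_growth\<close>.\<close>

lemma potter:
  assumes "\<gamma> > 0"
  shows "\<forall>\<^sub>F u in at_top. \<forall>t\<ge>0. l (u + t) \<le> exp \<alpha> * exp (\<gamma> * t) * l u"
proof -
  have "\<forall>\<^sub>F u in at_top. l (u + 1) / l u < exp \<gamma>"
    using l_slow by (rule order_tendstoD) (use assms in simp)
  then obtain u0 where u0: "\<And>u. u \<ge> u0 \<Longrightarrow> l (u + 1) / l u < exp \<gamma>"
    by (auto simp: eventually_at_top_linorder)
  show ?thesis unfolding eventually_at_top_linorder
  proof (intro exI allI impI)
    fix u t :: real assume u: "u \<ge> u0" and t: "t \<ge> 0"
    have n: "l (u + real n) \<le> exp (\<gamma> * real n) * l u" for n
    proof (induction n)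
      case (Suc n)
      have "l (u + real (Suc n)) \<le> exp \<gamma> * l (u + real n)"
        using u0[of "u + real n"] u l_pos[of "u + real n"] by (simp add: field_simps)
      also have "\<dots> \<le> exp \<gamma> * (exp (\<gamma> * real n) * l u)"
        using Suc by (intro mult_left_mono) auto
      also have "\<dots> = exp (\<gamma> * real (Suc n)) * l u"
        by (simp add: algebra_simps flip: exp_add mult.assoc)
      finally show ?case .
    qed simp
    define n where "n = nat \<lfloor>t\<rfloor>"
    have nt: "real n \<le> t" "t \<le> real n + 1" using t unfolding n_def by linarith+
    have "l (u + t) \<le> exp (\<alpha> * (t - real n)) * l (u + real n)"
      using l_growth[of "t - real n" "u + real n"] nt by simp
    also have "\<dots> \<le> exp \<alpha> * l (u + real n)"
      using nt alpha_pos l_nonneg by (intro mult_right_mono) auto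
    also have "\<dots> \<le> exp \<alpha> * (exp (\<gamma> * real n) * l u)"
      using n by (intro mult_left_mono) auto
    also have "\<dots> \<le> exp \<alpha> * (exp (\<gamma> * t) * l u)"
      using nt assms l_nonneg by (intro mult_left_mono mult_right_mono) auto
    finally show "l (u + t) \<le> exp \<alpha> * exp (\<gamma> * t) * l u" by (simp add: mult.assoc)
  qed
qed

text \<open>After the substitution \<open>t = exp s\<close> this is the integral of L(t)/t over (0,
  exp u]. It is finite by \<open>l_le\<close>, so \<open>enn2real\<close> loses nothing.\<close>

definition cum :: "real \<Rightarrow> real" where
  "cum u = enn2real (\<integral>\<^sup>+s. ennreal (l s) * indicator {..u} s \<partial>lborel)"

lemma cum_nonneg: "cum u \<ge> 0" by (simp add: cum_def)

lemma ennreal_cum: "ennreal (cum u) = (\<integral>\<^sup>+s. ennreal (l s) * indicator {..u} s \<partial>lborel)"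
proof -
  have "(\<integral>\<^sup>+s. ennreal (l s) * indicator {..u} s \<partial>lborel)
      \<le> (\<integral>\<^sup>+s. ennreal (exp (\<alpha> * s)) * indicator {..u} s \<partial>lborel)"
    by (intro nn_integral_mono mult_right_mono ennreal_leI l_le) auto
  also have "\<dots> < \<top>" using alpha_pos by (subst nn_integral_exp_atMost) auto
  finally show ?thesis by (simp add: cum_def)
qed

lemma cum_mono: "u \<le> v \<Longrightarrow> cum u \<le> cum v"
proof -
  assume "u \<le> v"
  then have "ennreal (cum u) \<le> ennreal (cum v)"
    unfolding ennreal_cum by (intro nn_integral_mono) (auto split: split_indicator)
  then show ?thesis by (simp add: cum_nonneg)
qed

lemma measurable_cum [measurable]: "cum \<in> borel_measurable borel"
  using cum_mono by (intro borel_measurable_mono monoI)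

lemma cum_at_top: "filterlim cum at_top at_top"
proof -
  have "(SUP n. \<integral>\<^sup>+s. ennreal (l s) * indicator {-real n..real n} s \<partial>lborel) \<le> (SUP n. ennreal (cum (real n)))"
    unfolding ennreal_cum by (intro SUP_mono' nn_integral_mono) (auto split: split_indicator)
  then have top: "(SUP n. ennreal (cum (real n))) = \<top>"
    by (simp add: nn_integral_SUP_intervals l_infinite top_unique)
  show ?thesis unfolding filterlim_at_top eventually_at_top_linorder
  proof
    fix Z :: real
    have "ennreal Z < (SUP n. ennreal (cum (real n)))" unfolding top by simp
    then obtain n where "ennreal Z < ennreal (cum (real n))" by (auto simp: less_SUP_iff)
    then have "Z \<le> cum (real n)" by (metis cum_nonneg ennreal_less_iff ennreal_leI leD le_cases less_imp_le not_le_imp_less)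
    then show "\<exists>N. \<forall>n\<ge>N. Z \<le> cum n" using cum_mono order_trans by blast
  qed
qed

lemma const_le_cum:
  assumes "\<epsilon> > 0"
  shows "\<forall>\<^sub>F u in at_top. C \<le> \<epsilon> * cum u"
proof -
  have "\<forall>\<^sub>F u in at_top. C / \<epsilon> \<le> cum u" using cum_at_top by (simp add: filterlim_at_top)
  then show ?thesis by eventually_elim (use assms in \<open>simp add: field_simps\<close>)
qed

text \<open>A slowly varying function is negligible against its logarithmic integral: on the window
  of length \<open>K = 2 / \<epsilon>\<close> before \<open>u\<close> it stays above
  \<open>l u / 2\<close>, so this window alone contributes at least
  \<open>l u / \<epsilon>\<close>.\<close>

lemma l_small:
  assumes "\<epsilon> > 0"
  shows "\<forall>\<^sub>F u in at_top. l u \<le> \<epsilon> * cum u"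
proof -
  define K where "K = 2 / \<epsilon>"
  have K: "K > 0" using assms by (simp add: K_def)
  have "\<forall>\<^sub>F u in at_top. \<forall>t\<in>{-K..K}. (1 - 1/2) * l u \<le> l (u + t) \<and> l (u + t) \<le> (1 + 1/2) * l u"
    by (rule uniformly_slow) simp
  then show ?thesis
  proof eventually_elim
    case (elim u)
    have "ennreal (l u / 2 * K) = (\<integral>\<^sup>+s. ennreal (l u / 2) * indicator {u - K..u} s \<partial>lborel)"
      using K l_nonneg[of u] by (subst nn_integral_cmult_indicator) (auto simp flip: ennreal_mult)
    also have "\<dots> \<le> ennreal (cum u)"
      unfolding ennreal_cum
    proof (intro nn_integral_mono)
      fix s
      have "l u / 2 \<le> l s" if "s \<in> {u - K..u}" using elim[rule_format, of "s - u"] that K by auto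
      then show "ennreal (l u / 2) * indicator {u - K..u} s \<le> ennreal (l s) * indicator {..u} s"
        by (auto split: split_indicator intro!: ennreal_leI)
    qed
    finally have "l u / 2 * K \<le> cum u" by (simp add: cum_nonneg)
    then show ?case using assms by (simp add: K_def field_simps)
  qed
qed

text \<open>For \<open>c = \<beta>\<close> this is the contribution of \<open>s > u\<close> to the
  potential of \<open>l\<close>, as \<open>pot_eq\<close> shows.\<close>

definition future :: "real \<Rightarrow> real \<Rightarrow> ennreal" where
  "future c u = (\<integral>\<^sup>+s. ennreal (l s * exp (- c * (s - u))) * indicator {u<..} s \<partial>lborel)"

text \<open>Potter's bound with exponent \<open>\<beta> / 2\<close> uses up only half of the decay,
  so the integral is at most a constant times \<open>l u\<close>, which \<open>l_small\<close> makes
  negligible.\<close>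

lemma tail_small:
  assumes "\<beta> > 0" "\<epsilon> > 0"
  shows "\<forall>\<^sub>F u in at_top. future \<beta> u \<le> ennreal (\<epsilon> * cum u)"
proof -
  \<comment> \<open>The integral comes out as at most
    \<open>2 * exp \<alpha> / \<beta> * l u\<close>; this choice turns it into
    \<open>\<epsilon> * cum u\<close>.\<close>
  define \<epsilon>' where "\<epsilon>' = \<epsilon> * \<beta> / (2 * exp \<alpha>)"
  have "\<epsilon>' > 0" using assms by (simp add: \<epsilon>'_def)
  have "\<beta> / 2 > 0" using assms by simp
  from potter[OF this] l_small[OF \<open>\<epsilon>' > 0\<close>] show ?thesis
  proof eventually_elim
    case (elim u)
    have "future \<beta> u \<le> (\<integral>\<^sup>+s. ennreal (exp \<alpha> * l u * exp (\<beta> / 2 * u)) * (ennreal (exp (- (\<beta> / 2) * s)) * indicator {u..} s) \<partial>lborel)"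
      unfolding future_def
    proof (intro nn_integral_mono)
      fix s
      have "l s * exp (- \<beta> * (s - u)) \<le> exp \<alpha> * l u * exp (\<beta> / 2 * u) * exp (- (\<beta> / 2) * s)" if "s > u"
      proof -
        have "l s \<le> exp \<alpha> * exp (\<beta> / 2 * (s - u)) * l u" using elim(1)[rule_format, of "s - u"] that by simp
        then have "l s * exp (- \<beta> * (s - u)) \<le> exp \<alpha> * exp (\<beta> / 2 * (s - u)) * l u * exp (- \<beta> * (s - u))"
          by (intro mult_right_mono) auto
        also have "\<dots> = exp \<alpha> * l u * (exp (\<beta> / 2 * (s - u)) * exp (- \<beta> * (s - u)))" by simp
        also have "exp (\<beta> / 2 * (s - u)) * exp (- \<beta> * (s - u)) = exp (\<beta> / 2 * u) * exp (- (\<beta> / 2) * s)"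
          unfolding exp_add[symmetric] by (simp add: field_simps)
        finally show ?thesis by (simp add: mult.assoc)
      qed
      then show "ennreal (l s * exp (- \<beta> * (s - u))) * indicator {u<..} s
          \<le> ennreal (exp \<alpha> * l u * exp (\<beta> / 2 * u)) * (ennreal (exp (- (\<beta> / 2) * s)) * indicator {u..} s)"
        using l_nonneg[of u] by (auto split: split_indicator intro!: ennreal_leI simp flip: ennreal_mult)
    qed
    also have "\<dots> = ennreal (exp \<alpha> * l u * exp (\<beta> / 2 * u)) * ennreal (exp (- (\<beta> / 2) * u) / (\<beta> / 2))"
      using nn_integral_exp_atLeast[OF \<open>\<beta> / 2 > 0\<close>, of u] by (subst nn_integral_cmult) auto
    also have "\<dots> = ennreal (exp \<alpha> * l u * 2 / \<beta> * (exp (\<beta> / 2 * u) * exp (- (\<beta> / 2) * u)))"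
      using l_nonneg[of u] assms by (simp flip: ennreal_mult add: ac_simps)
    also have "exp (\<beta> / 2 * u) * exp (- (\<beta> / 2) * u) = 1" by (simp flip: exp_add)
    also have "ennreal (exp \<alpha> * l u * 2 / \<beta> * 1) \<le> ennreal (\<epsilon> * cum u)"
      using elim(2) assms by (intro ennreal_leI) (simp add: \<epsilon>'_def field_simps)
    finally show ?case .
  qed
qed

end

section \<open>Potential of the slowly varying tail, and the upper bound\<close>

locale slow_renewal = drift_walk \<mu> \<rho> \<beta> \<theta> + slow_tail l \<alpha>
  for \<mu> \<rho> \<beta> \<theta> l \<alpha>
begin

definition pot :: "real \<Rightarrow> ennreal" where
  "pot u = conv (\<lambda>s. ennreal (l s)) barrier u"

lemma measurable_pot [measurable]: "pot \<in> borel_measurable borel"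
  unfolding pot_def by measurable

lemma pot_mono: "u \<le> v \<Longrightarrow> pot u \<le> pot v"
  unfolding pot_def conv_def by (intro nn_integral_mono mult_left_mono barrier_mono) auto

lemma pot_shift: "t \<ge> 0 \<Longrightarrow> pot (u + t) \<le> ennreal (exp (\<beta> * t)) * pot u"
proof -
  assume t: "t \<ge> 0"
  have "pot (u + t) \<le> (\<integral>\<^sup>+s. ennreal (exp (\<beta> * t)) * (ennreal (l s) * barrier (u - s)) \<partial>lborel)"
    unfolding pot_def conv_def
  proof (intro nn_integral_mono)
    fix s
    have "barrier (u + t - s) \<le> ennreal (exp (\<beta> * t)) * barrier (u - s)"
      using barrier_shift[OF t, of "u - s"] by (simp add: algebra_simps)
    then have "ennreal (l s) * barrier (u + t - s) \<le> ennreal (l s) * (ennreal (exp (\<beta> * t)) * barrier (u - s))"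
      by (intro mult_left_mono) auto
    then show "ennreal (l s) * barrier (u + t - s) \<le> ennreal (exp (\<beta> * t)) * (ennreal (l s) * barrier (u - s))"
      by (simp add: ac_simps)
  qed
  also have "\<dots> = ennreal (exp (\<beta> * t)) * pot u"
    unfolding pot_def conv_def by (intro nn_integral_cmult) measurable
  finally show ?thesis .
qed

lemma pot_eq:
  "pot u = ennreal (cum u) + future \<beta> u"
proof -
  have "pot u = (\<integral>\<^sup>+s. ennreal (l s) * indicator {..u} s + ennreal (l s * exp (- \<beta> * (s - u))) * indicator {u<..} s \<partial>lborel)"
    unfolding pot_def conv_def
  proof (intro nn_integral_cong)
    fix s
    have "\<beta> * (u - s) = - \<beta> * (s - u)" by (simp add: algebra_simps)
    then show "ennreal (l s) * barrier (u - s) =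
         ennreal (l s) * indicator {..u} s + ennreal (l s * exp (- \<beta> * (s - u))) * indicator {u<..} s"
      by (cases "s \<le> u") (auto simp: barrier_nonneg_arg barrier_nonpos_arg ennreal_mult l_nonneg)
  qed
  then show ?thesis by (simp add: nn_integral_add ennreal_cum future_def)
qed

lemma pot_le_cum:
  assumes "\<epsilon> > 0"
  shows "\<forall>\<^sub>F u in at_top. pot u \<le> ennreal ((1 + \<epsilon>) * cum u)"
  using tail_small[OF beta_pos assms]
proof eventually_elim
  case (elim u)
  then have "pot u \<le> ennreal (cum u) + ennreal (\<epsilon> * cum u)"
    unfolding pot_eq by (intro add_left_mono)
  then show ?case using assms cum_nonneg[of u] by (simp add: distrib_right flip: ennreal_plus)
qed

lemma gt_inverse_drift: "a > 1 / \<rho> \<Longrightarrow> a > 0"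
  using drift_pos by (meson divide_pos_pos less_trans zero_less_one)

lemma kern_truncated:
  assumes "y < \<rho>"
  obtains K where "K \<ge> 0" "ennreal y \<le> (\<integral>\<^sup>+t. kern t * indicator {-K..K} t \<partial>lborel)"
proof -
  have "ennreal y < (SUP n. \<integral>\<^sup>+t. kern t * indicator {-real n..real n} t \<partial>lborel)"
    using assms drift_pos by (simp add: nn_integral_SUP_intervals nn_integral_kern ennreal_less_iff ennreal_lessI)
  then obtain n where "ennreal y < (\<integral>\<^sup>+t. kern t * indicator {-real n..real n} t \<partial>lborel)"
    by (auto simp: less_SUP_iff)
  then show ?thesis by (intro that[of "real n"]) auto
qed

text \<open>A compact piece of \<open>kern\<close> carries mass close to \<open>\<rho>\<close>, and
  \<open>l\<close> is nearly constant over it. The shifts \<open>t\<close> up to 1 are included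
  because \<open>growth_upper\<close> integrates over a window starting at \<open>u\<close>.\<close>

lemma conv_kern_ge:
  assumes a: "a > 1 / \<rho>"
  shows "\<forall>\<^sub>F u in at_top. \<forall>t\<in>{0..1}. ennreal (l (u + t)) \<le> ennreal a * conv (\<lambda>s. ennreal (l s)) kern u"
proof -
  have rho: "\<rho> > 0" and a0: "a > 0" using drift_pos gt_inverse_drift[OF a] by auto
  then have "1 / a < \<rho>" using a rho by (simp add: field_simps)
  then obtain y where y: "1 / a < y" "y < \<rho>" using dense by blast
  then have "y > 0" using a0 by (meson divide_pos_pos less_trans zero_less_one)
  obtain K where K: "K \<ge> 0" "ennreal y \<le> (\<integral>\<^sup>+t. kern t * indicator {-K..K} t \<partial>lborel)"
    using kern_truncated[OF y(2)] .
  \<comment> \<open>This \<epsilon> solves \<open>1 + \<epsilon> = a * (1 - \<epsilon>) * y\<close>,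
    balancing the error at \<open>u + t\<close> against the one in the convolution.\<close>
  define \<epsilon> where "\<epsilon> = (a * y - 1) / (a * y + 1)"
  have ay: "a * y > 1" using y a0 by (simp add: field_simps)
  have eps: "\<epsilon> > 0" using ay by (simp add: \<epsilon>_def)
  have eps1: "1 - \<epsilon> > 0" using ay by (simp add: \<epsilon>_def field_simps)
  have eps2: "1 + \<epsilon> = a * (1 - \<epsilon>) * y" using ay by (simp add: \<epsilon>_def field_simps)
  from uniformly_slow[OF eps, of K] uniformly_slow[OF eps, of 1] show ?thesis
  proof eventually_elim
    case (elim u)
    have "ennreal ((1 - \<epsilon>) * l u) * ennreal y \<le> ennreal ((1 - \<epsilon>) * l u) * (\<integral>\<^sup>+t. kern t * indicator {-K..K} t \<partial>lborel)"
      by (intro mult_left_mono K) auto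
    also have "\<dots> = (\<integral>\<^sup>+t. ennreal ((1 - \<epsilon>) * l u) * (kern t * indicator {-K..K} t) \<partial>lborel)"
      by (intro nn_integral_cmult[symmetric]) measurable
    also have "\<dots> \<le> (\<integral>\<^sup>+t. kern t * ennreal (l (u - t)) \<partial>lborel)"
    proof (intro nn_integral_mono)
      fix t
      have "(1 - \<epsilon>) * l u \<le> l (u - t)" if "t \<in> {-K..K}" using elim(1)[rule_format, of "-t"] that by auto
      then show "ennreal ((1 - \<epsilon>) * l u) * (kern t * indicator {-K..K} t) \<le> kern t * ennreal (l (u - t))"
        by (auto split: split_indicator simp: mult.commute intro!: mult_left_mono ennreal_leI)
    qed
    also have "\<dots> = conv (\<lambda>s. ennreal (l s)) kern u"
      by (subst conv_commute) (auto simp: conv_def)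
    finally have *: "ennreal ((1 - \<epsilon>) * l u) * ennreal y \<le> conv (\<lambda>s. ennreal (l s)) kern u" .
    show ?case
    proof
      fix t :: real assume t: "t \<in> {0..1}"
      have "ennreal (l (u + t)) \<le> ennreal ((1 + \<epsilon>) * l u)"
        using elim(2)[rule_format, of t] t by (intro ennreal_leI) auto
      also have "\<dots> = ennreal a * (ennreal ((1 - \<epsilon>) * l u) * ennreal y)"
        using a0 eps1 \<open>y > 0\<close> l_nonneg[of u] by (simp flip: ennreal_mult add: eps2 ac_simps)
      also have "\<dots> \<le> ennreal a * conv (\<lambda>s. ennreal (l s)) kern u"
        using * by (intro mult_left_mono) auto
      finally show "ennreal (l (u + t)) \<le> ennreal a * conv (\<lambda>s. ennreal (l s)) kern u" .
    qed
  qed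
qed


text \<open>The supersolution \<open>g = conv H barrier\<close> needs \<open>conv H kern\<close>
  above the inhomogeneity. For \<open>l\<close> far out \<open>conv_kern_ge\<close> provides this,
  but \<open>e\<close>, or \<open>l\<close> left of \<open>u0\<close>, may have peaks. Their
  integrals over \<open>{u..u+d}\<close> are dominated, since \<open>kern\<close> is at least
  \<open>c\<close> on \<open>{-1..0}\<close>; so \<open>comparison\<close> is applied to the window
  integrals \<open>rb\<close>, and \<open>r_growth\<close> brings \<open>r\<close> back.\<close>

lemma growth_upper:
  fixes r :: "real \<Rightarrow> real" and e :: "real \<Rightarrow> ennreal"
  assumes r_growth: "\<And>u t. t \<ge> 0 \<Longrightarrow> r (u + t) \<le> exp (\<alpha> * t) * r u"
    and r_nonneg: "\<And>u. r u \<ge> 0"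
    and r_le: "\<And>u. r u \<le> K * exp (\<beta> * u)"
    and e_meas [measurable]: "e \<in> borel_measurable borel"
    and e_fin: "(\<integral>\<^sup>+s. e s \<partial>lborel) < \<infinity>"
    and le: "\<And>u. ennreal (r u) \<le> step (\<lambda>s. ennreal (r s)) u + ennreal (l u) + e u"
    and a: "a > 1 / \<rho>"
  obtains C where "C \<ge> 0" "\<And>u. ennreal (r u) \<le> ennreal a * pot u + ennreal C"
proof -
  have [measurable]: "r \<in> borel_measurable borel" using r_growth by (rule measurable_exp_growth)
  have rho: "\<rho> > 0" by (rule drift_pos)
  have a0: "a > 0" by (rule gt_inverse_drift[OF a])
  obtain a' where a': "1 / \<rho> < a'" "a' < a" using a dense by blast
  have a'0: "a' > 0" by (rule gt_inverse_drift[OF a'(1)])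
  \<comment> \<open>The gap between \<open>a'\<close> and \<open>a\<close> pays for the factor
    \<open>exp (\<alpha> * d)\<close> lost when a window integral is turned back into a value of
    \<open>r\<close>.\<close>
  have "((\<lambda>d. exp (\<alpha> * d) * a') \<longlongrightarrow> exp (\<alpha> * 0) * a') (at_right 0)"
    by (intro tendsto_intros)
  from at_right_0_witness[OF this, of a] a' obtain d where d: "exp (\<alpha> * d) * a' < a" "d > 0" "d < 1" by auto
  obtain u0 where u0: "\<And>u t. u \<ge> u0 \<Longrightarrow> t \<in> {0..1} \<Longrightarrow>
      ennreal (l (u + t)) \<le> ennreal a' * conv (\<lambda>s. ennreal (l s)) kern u"
    using conv_kern_ge[OF a'(1)] unfolding eventually_at_top_linorder by blast
  define c where "c = (1 - \<theta>) * exp (- \<beta>)"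
  have c: "c > 0" using theta by (simp add: c_def)
  \<comment> \<open>Everything that \<open>conv_kern_ge\<close> does not cover: the error and, as
    \<open>t \<le> 1\<close>, the values of \<open>l\<close> up to \<open>u0 + 1\<close>.\<close>
  define f where "f s = e s + ennreal (l s) * indicator {..u0 + 1} s" for s
  \<comment> \<open>The factor \<open>d\<close> is the length of the window; \<open>1 / c\<close>
    compensates for the lower bound on \<open>kern\<close>.\<close>
  define H where "H s = ennreal (d * a') * ennreal (l s) + ennreal (1 / c) * f s" for s
  define g where "g = conv H barrier"
  define h where "h u = (\<integral>\<^sup>+t. (ennreal (l (u + t)) + e (u + t)) * indicator {0..d} t \<partial>lborel)" for u
  define rb where "rb u = (\<integral>\<^sup>+t. ennreal (r (u + t)) * indicator {0..d} t \<partial>lborel)" for u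
  have [measurable]: "f \<in> borel_measurable borel" "H \<in> borel_measurable borel"
      "g \<in> borel_measurable borel"
    unfolding f_def H_def g_def by measurable
  have conv_H: "conv H k u = ennreal (d * a') * conv (\<lambda>s. ennreal (l s)) k u + ennreal (1 / c) * conv f k u"
    if [measurable]: "k \<in> borel_measurable borel" for k u
    unfolding H_def by (subst conv_add) (auto simp: conv_cmult)
  have f_le: "(\<integral>\<^sup>+t. f (u + t) * indicator {0..d} t \<partial>lborel) \<le> ennreal (1 / c) * conv f kern u" for u
  proof -
    have "(\<integral>\<^sup>+t. f (u + t) * indicator {0..d} t \<partial>lborel) = (\<integral>\<^sup>+t. f (t + u) * indicator {u..u+d} (t + u) \<partial>lborel)"
      by (intro nn_integral_cong) (auto simp: add.commute split: split_indicator)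
    also have "\<dots> = (\<integral>\<^sup>+s. f s * indicator {u..u+d} s \<partial>lborel)"
      by (rule nn_integral_shift[where f = "\<lambda>s. f s * indicator {u..u+d} s"]) measurable
    also have "\<dots> \<le> (\<integral>\<^sup>+s. ennreal (1 / c) * (f s * kern (u - s)) \<partial>lborel)"
    proof (intro nn_integral_mono)
      fix s
      have "f s \<le> ennreal (1 / c) * (f s * kern (u - s))" if s: "s \<in> {u..u+d}"
      proof -
        have "- \<beta> \<le> \<beta> * (u - s)" using s d(3) beta_pos mult_left_mono[of "-1" "u - s" \<beta>] by simp
        then have "ennreal c \<le> ennreal ((1 - \<theta>) * exp (\<beta> * (u - s)))"
          unfolding c_def using theta by (intro ennreal_leI mult_left_mono) auto
        also have "\<dots> \<le> kern (u - s)" using s by (intro kern_ge) auto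
        finally have "ennreal (1 / c) * f s * ennreal c \<le> ennreal (1 / c) * f s * kern (u - s)"
          by (intro mult_left_mono) auto
        moreover have "ennreal (1 / c) * f s * ennreal c = f s * ennreal (1 / c * c)"
          using c by (subst ennreal_mult) (auto simp: ac_simps)
        ultimately show ?thesis using c by (simp add: ac_simps)
      qed
      then show "f s * indicator {u..u+d} s \<le> ennreal (1 / c) * (f s * kern (u - s))"
        by (auto split: split_indicator)
    qed
    also have "\<dots> = ennreal (1 / c) * conv f kern u"
      unfolding conv_def by (intro nn_integral_cmult) measurable
    finally show ?thesis .
  qed
  have h_le: "h u \<le> conv H kern u" for u
  proof -
    have "h u \<le> (\<integral>\<^sup>+t. ennreal a' * conv (\<lambda>s. ennreal (l s)) kern u * indicator {0..d} t + f (u + t) * indicator {0..d} t \<partial>lborel)"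
      unfolding h_def
    proof (intro nn_integral_mono)
      fix t
      have "ennreal (l (u + t)) + e (u + t) \<le> ennreal a' * conv (\<lambda>s. ennreal (l s)) kern u + f (u + t)"
        if "t \<in> {0..d}"
      proof (cases "u \<ge> u0")
        case True
        then show ?thesis using u0[OF True, of t] that d by (intro add_mono) (auto simp: f_def)
      next
        case False
        then have "f (u + t) = ennreal (l (u + t)) + e (u + t)" using that d by (simp add: f_def ac_simps)
        then show ?thesis by (simp add: add_increasing)
      qed
      then show "(ennreal (l (u + t)) + e (u + t)) * indicator {0..d} t
         \<le> ennreal a' * conv (\<lambda>s. ennreal (l s)) kern u * indicator {0..d} t + f (u + t) * indicator {0..d} t"
        by (auto split: split_indicator)
    qed
    also have "\<dots> = ennreal a' * conv (\<lambda>s. ennreal (l s)) kern u * ennreal d + (\<integral>\<^sup>+t. f (u + t) * indicator {0..d} t \<partial>lborel)"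
      using d by (subst nn_integral_add) (auto simp: nn_integral_cmult_indicator)
    also have "\<dots> \<le> ennreal a' * conv (\<lambda>s. ennreal (l s)) kern u * ennreal d + ennreal (1 / c) * conv f kern u"
      by (intro add_left_mono f_le)
    also have "\<dots> = conv H kern u"
      using d a'0 by (simp add: conv_H ennreal_mult ac_simps)
    finally show ?thesis .
  qed
  have rb_le: "rb u \<le> step rb u + h u" for u
  proof -
    interpret pair_sigma_finite lborel \<mu> ..
    have "rb u \<le> (\<integral>\<^sup>+t. step (\<lambda>s. ennreal (r s)) (u + t) * indicator {0..d} t
          + (ennreal (l (u + t)) + e (u + t)) * indicator {0..d} t \<partial>lborel)"
      unfolding rb_def using le by (intro nn_integral_mono) (auto simp: add.assoc split: split_indicator)
    also have "\<dots> = (\<integral>\<^sup>+t. step (\<lambda>s. ennreal (r s)) (u + t) * indicator {0..d} t \<partial>lborel) + h u"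
      unfolding h_def by (intro nn_integral_add) measurable
    also have "(\<integral>\<^sup>+t. step (\<lambda>s. ennreal (r s)) (u + t) * indicator {0..d} t \<partial>lborel)
       = (\<integral>\<^sup>+t. (\<integral>\<^sup>+x. ennreal (r (u - x + t)) * indicator {0..d} t \<partial>\<mu>) \<partial>lborel)"
      unfolding step_def by (intro nn_integral_cong) (auto simp: algebra_simps split: split_indicator)
    also have "\<dots> = step rb u"
      unfolding step_def rb_def by (intro Fubini'[symmetric]) measurable
    finally show ?thesis .
  qed
  have K0: "K \<ge> 0" using r_le[of 0] r_nonneg[of 0] by simp
  have rb_exp: "rb u \<le> ennreal (K * exp \<beta> * exp (\<beta> * u))" for u
  proof -
    have "rb u \<le> (\<integral>\<^sup>+t. ennreal (K * exp \<beta> * exp (\<beta> * u)) * indicator {0..1::real} t \<partial>lborel)"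
      unfolding rb_def
    proof (intro nn_integral_mono)
      fix t
      have "r (u + t) \<le> K * exp \<beta> * exp (\<beta> * u)" if "t \<in> {0..d}"
      proof -
        have "r (u + t) \<le> K * exp (\<beta> * (u + t))" by (rule r_le)
        also have "\<dots> \<le> K * exp (\<beta> * (u + 1))" using that d beta_pos K0 by (intro mult_left_mono) auto
        also have "\<dots> = K * exp \<beta> * exp (\<beta> * u)" by (simp add: exp_add algebra_simps)
        finally show ?thesis .
      qed
      then show "ennreal (r (u + t)) * indicator {0..d} t \<le> ennreal (K * exp \<beta> * exp (\<beta> * u)) * indicator {0..1} t"
        using d by (auto split: split_indicator intro!: ennreal_leI)
    qed
    also have "\<dots> = ennreal (K * exp \<beta> * exp (\<beta> * u))"
      by (subst nn_integral_cmult_indicator) auto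
    finally show ?thesis .
  qed
  have rb_g: "rb u \<le> g u" for u
  proof (rule comparison[where h = h and K = "K * exp \<beta>"])
    show "step g u + h u \<le> g u" for u
    proof -
      have "step g u + h u \<le> step g u + conv H kern u" by (intro add_left_mono h_le)
      also have "\<dots> = g u" unfolding g_def using conv_barrier_eq[of H u] by (simp add: add.commute)
      finally show ?thesis .
    qed
  qed (use rb_le rb_exp K0 in auto)
  \<comment> \<open>Since \<open>barrier \<le> 1\<close>, the potential of \<open>f\<close> is
    bounded by its total mass, which is finite.\<close>
  define D where "D = enn2real ((\<integral>\<^sup>+s. e s \<partial>lborel) + ennreal (cum (u0 + 1))) / c"
  have D0: "D \<ge> 0" using c by (simp add: D_def)
  have g_le: "g u \<le> ennreal (d * a') * pot u + ennreal D" for u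
  proof -
    have fin: "(\<integral>\<^sup>+s. e s \<partial>lborel) + ennreal (cum (u0 + 1)) < \<top>" using e_fin by simp
    have "conv f barrier u \<le> (\<integral>\<^sup>+s. f s * 1 \<partial>lborel)"
      unfolding conv_def by (intro nn_integral_mono mult_left_mono barrier_le_1) auto
    also have "\<dots> = (\<integral>\<^sup>+s. e s \<partial>lborel) + ennreal (cum (u0 + 1))"
      unfolding f_def by (simp add: nn_integral_add ennreal_cum)
    finally have "ennreal (1 / c) * conv f barrier u \<le> ennreal (1 / c) * ((\<integral>\<^sup>+s. e s \<partial>lborel) + ennreal (cum (u0 + 1)))"
      by (intro mult_left_mono) auto
    also have "\<dots> = ennreal D"
      using fin c by (simp add: D_def divide_inverse ennreal_mult mult.commute)
    finally show ?thesis
      unfolding g_def conv_H[OF measurable_barrier] pot_def by (intro add_left_mono)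
  qed
  show ?thesis
  proof (rule that)
    define C where "C = exp (\<alpha> * d) * D / d"
    show "C \<ge> 0" using D0 d by (simp add: C_def)
    fix u
    \<comment> \<open>The window now ends at \<open>u\<close>; on it \<open>r\<close> is at least
      \<open>exp (- \<alpha> * d) * r u\<close>.\<close>
    have "ennreal (d * exp (- \<alpha> * d) * r u) = (\<integral>\<^sup>+t. ennreal (exp (- \<alpha> * d) * r u) * indicator {0..d} t \<partial>lborel)"
      using d r_nonneg[of u] by (subst nn_integral_cmult_indicator) (auto simp flip: ennreal_mult simp: ac_simps)
    also have "\<dots> \<le> rb (u - d)"
      unfolding rb_def
    proof (intro nn_integral_mono)
      fix t
      have "exp (- \<alpha> * d) * r u \<le> r (u - d + t)" if "t \<in> {0..d}"
      proof -
        have "r u \<le> exp (\<alpha> * (d - t)) * r (u - d + t)" using r_growth[of "d - t" "u - d + t"] that by simp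
        also have "\<dots> \<le> exp (\<alpha> * d) * r (u - d + t)"
          using that alpha_pos r_nonneg by (intro mult_right_mono) auto
        finally have "exp (- \<alpha> * d) * r u \<le> exp (- \<alpha> * d) * (exp (\<alpha> * d) * r (u - d + t))"
          by (intro mult_left_mono) auto
        then show ?thesis by (simp flip: mult.assoc exp_add)
      qed
      then show "ennreal (exp (- \<alpha> * d) * r u) * indicator {0..d} t \<le> ennreal (r (u - d + t)) * indicator {0..d} t"
        by (auto split: split_indicator intro!: ennreal_leI)
    qed
    also have "\<dots> \<le> ennreal (d * a') * pot (u - d) + ennreal D"
      using rb_g g_le order_trans by blast
    also have "\<dots> \<le> ennreal (d * a') * pot u + ennreal D"
      using d by (intro add_right_mono mult_left_mono pot_mono) auto
    finally have "ennreal (exp (\<alpha> * d) / d) * ennreal (d * exp (- \<alpha> * d) * r u)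
        \<le> ennreal (exp (\<alpha> * d) / d) * (ennreal (d * a') * pot u + ennreal D)"
      by (intro mult_left_mono) auto
    also have "\<dots> = ennreal (exp (\<alpha> * d) * a') * pot u + ennreal C"
      using d D0 a'0 by (simp add: C_def distrib_left flip: mult.assoc ennreal_mult)
    also have "\<dots> \<le> ennreal a * pot u + ennreal C"
      using d by (intro add_right_mono mult_right_mono ennreal_leI) auto
    also have "ennreal (exp (\<alpha> * d) / d) * ennreal (d * exp (- \<alpha> * d) * r u)
       = ennreal (exp (\<alpha> * d) * exp (- \<alpha> * d) * r u)"
      using d r_nonneg[of u] by (simp flip: ennreal_mult)
    also have "exp (\<alpha> * d) * exp (- \<alpha> * d) * r u = r u" by (simp flip: exp_add)
    finally show "ennreal (r u) \<le> ennreal a * pot u + ennreal C" .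
  qed
qed

section \<open>The lower bound from an averaged identity\<close>

definition window :: "real \<Rightarrow> real \<Rightarrow> ennreal" where
  "window u t = (\<integral>\<^sup>+s. ennreal (l s) * indicator {u<..u - t} s \<partial>lborel)"

lemma measurable_window [measurable]: "window u \<in> borel_measurable borel"
  unfolding window_def greaterThanAtMost_def greaterThan_def atMost_def by measurable

lemma cum_window: "t < 0 \<Longrightarrow> ennreal (cum (u - t)) = ennreal (cum u) + window u t"
  unfolding ennreal_cum window_def
  by (subst nn_integral_add[symmetric]) (auto intro!: nn_integral_cong split: split_indicator)

text \<open>With \<open>kern t\<close> bounded by \<open>exp (\<beta> * t)\<close> and the order of
  integration exchanged, a point \<open>s > u\<close> receives the integral of
  \<open>exp (\<beta> * t)\<close> over \<open>t \<le> u - s\<close>, which is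
  \<open>1 / \<beta>\<close> times its weight in \<open>future\<close>.\<close>

lemma nn_integral_kern_window:
  "(\<integral>\<^sup>+t. kern t * indicator {..<0} t * window u t \<partial>lborel) \<le> ennreal (1 / \<beta>) * future \<beta> u"
proof -
  let ?T = "\<lambda>s t. ennreal (l s) * indicator {u<..} s * (ennreal (exp (\<beta> * t)) * indicator {..u - s} t)"
  have "(\<integral>\<^sup>+t. kern t * indicator {..<0} t * window u t \<partial>lborel)
     \<le> (\<integral>\<^sup>+t. (\<integral>\<^sup>+s. ?T s t \<partial>lborel) \<partial>lborel)"
  proof (intro nn_integral_mono)
    fix t :: real
    have "kern t * indicator {..<0} t * window u t \<le> ennreal (exp (\<beta> * t)) * window u t"
      using kern_le[of t] barrier_le_exp[of t] order_trans
      by (intro mult_right_mono) (auto split: split_indicator)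
    also have "\<dots> = (\<integral>\<^sup>+s. ennreal (exp (\<beta> * t)) * (ennreal (l s) * indicator {u<..u - t} s) \<partial>lborel)"
      unfolding window_def by (intro nn_integral_cmult[symmetric]) measurable
    also have "\<dots> = (\<integral>\<^sup>+s. ?T s t \<partial>lborel)"
      by (intro nn_integral_cong) (auto split: split_indicator simp: ac_simps)
    finally show "kern t * indicator {..<0} t * window u t
       \<le> (\<integral>\<^sup>+s. ?T s t \<partial>lborel)" .
  qed
  also have "\<dots> = (\<integral>\<^sup>+s. (\<integral>\<^sup>+t. ?T s t \<partial>lborel) \<partial>lborel)"
    unfolding atMost_def by (intro lborel_pair.Fubini') measurable
  also have "\<dots> = (\<integral>\<^sup>+s. ennreal (1 / \<beta>) * (ennreal (l s * exp (- \<beta> * (s - u))) * indicator {u<..} s) \<partial>lborel)"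
  proof (intro nn_integral_cong)
    fix s
    have "(\<integral>\<^sup>+t. ?T s t \<partial>lborel)
       = ennreal (l s) * indicator {u<..} s * ennreal (exp (\<beta> * (u - s)) / \<beta>)"
      by (subst nn_integral_cmult) (auto simp: nn_integral_exp_atMost[OF beta_pos])
    moreover have "\<beta> * (u - s) = - \<beta> * (s - u)" by (simp add: algebra_simps)
    ultimately show "(\<integral>\<^sup>+t. ?T s t \<partial>lborel)
       = ennreal (1 / \<beta>) * (ennreal (l s * exp (- \<beta> * (s - u))) * indicator {u<..} s)"
      using beta_pos l_nonneg[of s] by (auto split: split_indicator simp flip: ennreal_mult simp: ac_simps)
  qed
  also have "\<dots> = ennreal (1 / \<beta>) * future \<beta> u" unfolding future_def by (intro nn_integral_cmult) measurable
  finally show ?thesis .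
qed

lemma eventually_le_cum:
  fixes r :: "real \<Rightarrow> real"
  assumes upper: "\<And>a. a > 1 / \<rho> \<Longrightarrow> \<exists>C\<ge>0. \<forall>u. ennreal (r u) \<le> ennreal a * pot u + ennreal C"
    and a: "a > 1 / \<rho>"
  shows "\<forall>\<^sub>F u in at_top. r u \<le> a * cum u"
proof -
  obtain b where b: "1 / \<rho> < b" "b < a" using a dense by blast
  have b0: "b > 0" by (rule gt_inverse_drift[OF b(1)])
  obtain C where C: "C \<ge> 0" "\<And>u. ennreal (r u) \<le> ennreal b * pot u + ennreal C"
    using upper[OF b(1)] by blast
  \<comment> \<open>Half of the gap \<open>a - b\<close> pays for replacing \<open>pot\<close> by
    \<open>cum\<close>, the other half for the constant \<open>C\<close>.\<close>
  define \<epsilon> where "\<epsilon> = (a - b) / (2 * b)"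
  have eps: "\<epsilon> > 0" using b b0 by (simp add: \<epsilon>_def)
  have "(a - b) / 2 > 0" using b by simp
  from pot_le_cum[OF eps] const_le_cum[OF this, of C] show ?thesis
  proof eventually_elim
    case (elim u)
    have "ennreal (r u) \<le> ennreal b * pot u + ennreal C" by (rule C)
    also have "\<dots> \<le> ennreal b * ennreal ((1 + \<epsilon>) * cum u) + ennreal C"
      using elim by (intro add_right_mono mult_left_mono) auto
    also have "\<dots> = ennreal (b * ((1 + \<epsilon>) * cum u) + C)"
      using b0 eps cum_nonneg[of u] C by (simp flip: ennreal_mult ennreal_plus)
    finally have "r u \<le> b * ((1 + \<epsilon>) * cum u) + C"
      using b0 eps cum_nonneg[of u] C by (subst (asm) ennreal_le_iff) auto
    also have "b * ((1 + \<epsilon>) * cum u) = (b + (a - b) / 2) * cum u"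
      using b0 by (simp add: \<epsilon>_def field_simps)
    also have "\<dots> + C \<le> (b + (a - b) / 2) * cum u + (a - b) / 2 * cum u"
      using elim by simp
    also have "\<dots> = a * cum u" by (simp add: field_simps)
    finally show ?case .
  qed
qed

lemma le_cum_plus_const:
  assumes r: "\<forall>\<^sub>F u in at_top. r u \<le> a * cum u" "\<And>u. r u \<le> K * exp (\<beta> * u)"
    and K0: "K \<ge> 0" and a0: "a \<ge> 0"
  obtains C where "C \<ge> 0" "\<And>u. r u \<le> a * cum u + C"
proof -
  obtain u0 where u0: "\<And>u. u \<ge> u0 \<Longrightarrow> r u \<le> a * cum u"
    using r(1) by (auto simp: eventually_at_top_linorder)
  have "r u \<le> a * cum u + K * exp (\<beta> * u0)" for u
  proof (cases "u \<ge> u0")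
    case True
    then show ?thesis using u0[of u] K0 by (simp add: add_increasing2)
  next
    case False
    have "r u \<le> K * exp (\<beta> * u)" by (rule r(2))
    also have "\<dots> \<le> K * exp (\<beta> * u0)" using False K0 beta_pos by (intro mult_left_mono) auto
    finally show ?thesis using a0 cum_nonneg[of u] by (simp add: add_increasing)
  qed
  then show ?thesis using K0 by (intro that[of "K * exp (\<beta> * u0)"]) auto
qed

text \<open>The identity \<open>conv r kern = conv l barrier\<close>, up to errors, prescribes a weighted average of
  \<open>r\<close>. As \<open>r\<close> is nowhere much larger than \<open>cum / \<rho>\<close> and \<open>exp (- \<alpha> * u) * r u\<close> decreases, a value
  \<open>r u\<close> well below \<open>cum u / \<rho>\<close> would make this average too small.\<close>

lemma renewal_asymptotics:
  fixes r :: "real \<Rightarrow> real" and e :: "real \<Rightarrow> ennreal"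
  assumes r_growth: "\<And>u t. t \<ge> 0 \<Longrightarrow> r (u + t) \<le> exp (\<alpha> * t) * r u"
    and r_nonneg: "\<And>u. r u \<ge> 0"
    and r_le: "\<And>u. r u \<le> K * exp (\<beta> * u)"
    and r_fin: "\<And>u. conv (\<lambda>s. ennreal (r s)) barrier u < \<infinity>"
    and e_meas [measurable]: "e \<in> borel_measurable borel"
    and e_small: "\<And>\<epsilon>. \<epsilon> > 0 \<Longrightarrow> \<forall>\<^sub>F u in at_top. conv e barrier u \<le> ennreal (\<epsilon> * cum u)"
    and ge: "\<And>u. step (\<lambda>s. ennreal (r s)) u + ennreal (l u) \<le> ennreal (r u) + e u"
    and upper: "\<And>a. a > 1 / \<rho> \<Longrightarrow> \<exists>C\<ge>0. \<forall>u. ennreal (r u) \<le> ennreal a * pot u + ennreal C"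
  shows "((\<lambda>u. r u / cum u) \<longlongrightarrow> 1 / \<rho>) at_top"
proof -
  have [measurable]: "r \<in> borel_measurable borel" using r_growth by (rule measurable_exp_growth)
  have rho: "\<rho> > 0" by (rule drift_pos)
  have K0: "K \<ge> 0" using r_le[of 0] r_nonneg[of 0] by simp
  have cum_pos: "\<forall>\<^sub>F u in at_top. cum u > 0"
    using cum_at_top by (simp add: filterlim_at_top_dense)
  have ev_upper: "\<forall>\<^sub>F u in at_top. r u \<le> a * cum u" if "a > 1 / \<rho>" for a
    by (rule eventually_le_cum[OF _ that]) (rule upper)
  have lower: "\<forall>\<^sub>F u in at_top. y < r u / cum u" if y: "y < 1 / \<rho>" for y
  proof -
    \<comment> \<open>The factor \<open>exp (- \<alpha> * d)\<close> is the loss in comparing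
      \<open>r (u - t)\<close> with \<open>r u\<close> for \<open>-d \<le> t \<le> 0\<close>; a
      small \<open>d\<close> keeps the result above \<open>y\<close>.\<close>
    have "((\<lambda>d. - (exp (- \<alpha> * d) / \<rho>)) \<longlongrightarrow> - (exp (- \<alpha> * 0) / \<rho>)) (at_right 0)"
      using rho by (intro tendsto_intros) auto
    from at_right_0_witness[OF this, of "- y"] y obtain d where d: "exp (- \<alpha> * d) / \<rho> > y" "d > 0" by auto
    \<comment> \<open>On \<open>{-d..0}\<close> the integrand is tied to \<open>r u\<close>;
      elsewhere only the upper bound \<open>a * cum + C\<close> is available.\<close>
    define kin kout where "kin = (\<integral>\<^sup>+t. kern t * indicator {-d..0} t \<partial>lborel)"
      and "kout = (\<integral>\<^sup>+t. kern t * indicator (-{-d..0}) t \<partial>lborel)"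
    have split: "kin + kout = ennreal \<rho>"
      unfolding kin_def kout_def nn_integral_kern[symmetric]
      by (subst nn_integral_add[symmetric]) (auto intro!: nn_integral_cong split: split_indicator)
    then have "kin \<noteq> \<top>" "kout \<noteq> \<top>" by auto
    then obtain k k' where k: "k \<ge> 0" "kin = ennreal k" and k': "k' \<ge> 0" "kout = ennreal k'"
      by (metis ennreal_cases)
    have kk': "k' = \<rho> - k" using split k k' rho by (simp flip: ennreal_plus)
    have "ennreal k > 0"
    proof -
      have "0 < ennreal ((1 - \<theta>) * exp (- \<beta> * d) * d)" using theta d by simp
      also have "\<dots> = (\<integral>\<^sup>+t. ennreal ((1 - \<theta>) * exp (- \<beta> * d)) * indicator {-d..0} t \<partial>lborel)"
        using d theta by (subst nn_integral_cmult_indicator) (auto simp flip: ennreal_mult)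
      also have "\<dots> \<le> kin" unfolding kin_def
      proof (intro nn_integral_mono)
        fix t
        have "ennreal ((1 - \<theta>) * exp (- \<beta> * d)) \<le> kern t" if "t \<in> {-d..0}"
        proof -
          have "- \<beta> * d \<le> \<beta> * t" using that beta_pos mult_left_mono[of "-d" t \<beta>] by simp
          then have "ennreal ((1 - \<theta>) * exp (- \<beta> * d)) \<le> ennreal ((1 - \<theta>) * exp (\<beta> * t))"
            using theta by (intro ennreal_leI mult_left_mono) auto
          also have "\<dots> \<le> kern t" using that by (intro kern_ge) auto
          finally show ?thesis .
        qed
        then show "ennreal ((1 - \<theta>) * exp (- \<beta> * d)) * indicator {-d..0} t \<le> kern t * indicator {-d..0} t"
          by (auto split: split_indicator)
      qed
      finally show ?thesis using k by simp
    qed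
    then have k_pos: "k > 0" by simp
    \<comment> \<open>\<open>M\<close> collects the coefficients of \<epsilon>:
      \<open>2 * \<rho>\<close> from the mass \<open>k'\<close>, the middle term from the part of
      \<open>cum\<close> beyond \<open>u\<close>, and 1 from the error term.\<close>
    define M where "M = 2 * \<rho> + (1 / \<rho> + 1) / \<beta> + 1"
    have M: "M > 0" using rho beta_pos by (simp add: M_def add_pos_pos)
    \<comment> \<open>Now \<open>\<epsilon> * M\<close> is at most half of the gap
      \<open>k * (exp (- \<alpha> * d) / \<rho> - y)\<close>; the cap 1 gives
      \<open>a \<le> 1 / \<rho> + 1\<close>.\<close>
    define \<epsilon> where "\<epsilon> = min 1 (k * (exp (- \<alpha> * d) / \<rho> - y) / (2 * M))"
    have eps: "\<epsilon> > 0" "\<epsilon> \<le> 1" using k_pos d M by (auto simp: \<epsilon>_def)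
    define a where "a = 1 / \<rho> + \<epsilon>"
    have a: "a > 1 / \<rho>" using eps by (simp add: a_def)
    have a0: "a > 0" by (rule gt_inverse_drift[OF a])
    obtain C where C: "C \<ge> 0" "\<And>u. r u \<le> a * cum u + C"
      using le_cum_plus_const[OF ev_upper[OF a] r_le K0] a0 by auto
    from e_small[OF eps(1)] tail_small[OF beta_pos eps(1)] const_le_cum[OF eps(1), of C] cum_pos
    show ?thesis
    proof eventually_elim
      case (elim u)
      have "ennreal (cum u) \<le> pot u" unfolding pot_eq by simp
      also have "\<dots> \<le> conv (\<lambda>s. ennreal (r s)) kern u + conv e barrier u"
        unfolding pot_def using ge r_fin by (intro conv_kern_barrier_ge) auto
      also have "conv (\<lambda>s. ennreal (r s)) kern u = (\<integral>\<^sup>+t. kern t * ennreal (r (u - t)) \<partial>lborel)"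
        by (subst conv_commute) (auto simp: conv_def)
      also have "\<dots> \<le> (\<integral>\<^sup>+t. kern t * indicator {-d..0} t * ennreal (exp (\<alpha> * d) * r u)
            + kern t * indicator (-{-d..0}) t * ennreal (a * cum u + C)
            + ennreal a * (kern t * indicator {..<0} t * window u t) \<partial>lborel)"
      proof (intro nn_integral_mono)
        fix t
        show "kern t * ennreal (r (u - t)) \<le> kern t * indicator {-d..0} t * ennreal (exp (\<alpha> * d) * r u)
            + kern t * indicator (-{-d..0}) t * ennreal (a * cum u + C)
            + ennreal a * (kern t * indicator {..<0} t * window u t)"
        proof (cases "t \<in> {-d..0}")
          case True
          have "r (u - t) \<le> exp (\<alpha> * (- t)) * r u" using r_growth[of "-t" u] True by simp
          also have "\<dots> \<le> exp (\<alpha> * d) * r u"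
            using True alpha_pos r_nonneg by (intro mult_right_mono) (use mult_left_mono[of "-t" d \<alpha>] in auto)
          finally have "kern t * ennreal (r (u - t)) \<le> kern t * ennreal (exp (\<alpha> * d) * r u)"
            by (intro mult_left_mono ennreal_leI) auto
          then show ?thesis using True by (auto simp: add_increasing2)
        next
          case out: False
          have "ennreal (r (u - t)) \<le> ennreal (a * cum (u - t) + C)" by (intro ennreal_leI C)
          also have "\<dots> = ennreal a * ennreal (cum (u - t)) + ennreal C"
            using a0 C cum_nonneg by (simp flip: ennreal_mult ennreal_plus)
          \<comment> \<open>For \<open>t < 0\<close> the argument \<open>u - t\<close> exceeds
            \<open>u\<close> and the surplus of \<open>cum\<close> is \<open>window u t\<close>; for
            \<open>t \<ge> 0\<close> monotonicity is enough.\<close>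
          also have "\<dots> \<le> ennreal a * (ennreal (cum u) + indicator {..<0} t * window u t) + ennreal C"
          proof (cases "t < 0")
            case True
            then show ?thesis by (simp add: cum_window)
          next
            case False
            then have "cum (u - t) \<le> cum u" by (intro cum_mono) auto
            then show ?thesis using False by (auto intro!: add_right_mono mult_left_mono ennreal_leI)
          qed
          also have "\<dots> = ennreal (a * cum u + C) + ennreal a * (indicator {..<0} t * window u t)"
            using a0 C cum_nonneg[of u] by (simp add: distrib_left ac_simps flip: ennreal_mult ennreal_plus)
          finally have "kern t * ennreal (r (u - t))
              \<le> kern t * (ennreal (a * cum u + C) + ennreal a * (indicator {..<0} t * window u t))"
            by (intro mult_left_mono) auto
          then show ?thesis using out by (simp add: distrib_left ac_simps)
        qed
      qed
      also have "\<dots> = kin * ennreal (exp (\<alpha> * d) * r u) + kout * ennreal (a * cum u + C)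
            + ennreal a * (\<integral>\<^sup>+t. kern t * indicator {..<0} t * window u t \<partial>lborel)"
        unfolding kin_def kout_def
        by (simp add: nn_integral_add nn_integral_multc nn_integral_cmult)
      also have "\<dots> \<le> kin * ennreal (exp (\<alpha> * d) * r u) + kout * ennreal (a * cum u + C)
            + ennreal a * (ennreal (1 / \<beta>) * ennreal (\<epsilon> * cum u))"
        using order_trans[OF nn_integral_kern_window mult_left_mono[OF elim(2)]]
        by (intro add_left_mono mult_left_mono) auto
      also have "\<dots> = ennreal (k * (exp (\<alpha> * d) * r u) + k' * (a * cum u + C) + a * (1 / \<beta> * (\<epsilon> * cum u)))"
        unfolding k(2) k'(2) using k k' a0 beta_pos eps cum_nonneg[of u] r_nonneg[of u] C
        by (simp flip: ennreal_mult ennreal_plus)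
      finally have "ennreal (cum u) \<le> ennreal (k * (exp (\<alpha> * d) * r u) + k' * (a * cum u + C) + a * (1 / \<beta> * (\<epsilon> * cum u)))
          + ennreal (\<epsilon> * cum u)"
        using elim(1) by (meson add_mono order_trans order_refl)
      then have "cum u \<le> k * (exp (\<alpha> * d) * r u) + k' * (a * cum u + C) + a * (1 / \<beta> * (\<epsilon> * cum u)) + \<epsilon> * cum u"
        using k k' a0 beta_pos eps cum_nonneg[of u] r_nonneg[of u] C
        by (simp add: ennreal_le_iff flip: ennreal_plus)
      also have "\<dots> \<le> k * (exp (\<alpha> * d) * r u) + k' * (a * cum u + \<epsilon> * cum u) + a * (1 / \<beta> * (\<epsilon> * cum u)) + \<epsilon> * cum u"
        using elim(3) k' by (simp add: mult_left_mono)
      finally have "cum u / cum u \<le> (k * (exp (\<alpha> * d) * r u) + k' * (a * cum u + \<epsilon> * cum u) + a * (1 / \<beta> * (\<epsilon> * cum u)) + \<epsilon> * cum u) / cum u"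
        using elim(4) by (intro divide_right_mono) auto
      then have "1 \<le> k * exp (\<alpha> * d) * (r u / cum u) + k' * (a + \<epsilon>) + a * \<epsilon> / \<beta> + \<epsilon>"
        using elim(4) by (simp add: add_divide_distrib distrib_left)
      moreover have "k' * (a + \<epsilon>) + a * \<epsilon> / \<beta> + \<epsilon> \<le> 1 - k / \<rho> + \<epsilon> * M"
      proof -
        have "k' * (a + \<epsilon>) = (\<rho> - k) * (1 / \<rho>) + 2 * (\<rho> - k) * \<epsilon>"
          by (simp add: kk' a_def algebra_simps)
        also have "(\<rho> - k) * (1 / \<rho>) = 1 - k / \<rho>" using rho by (simp add: field_simps)
        also have "2 * (\<rho> - k) * \<epsilon> \<le> 2 * \<rho> * \<epsilon>" using k eps by (intro mult_right_mono) auto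
        finally have 1: "k' * (a + \<epsilon>) \<le> 1 - k / \<rho> + 2 * \<rho> * \<epsilon>" by simp
        have "a * \<epsilon> / \<beta> \<le> (1 / \<rho> + 1) * \<epsilon> / \<beta>"
          using eps beta_pos by (intro divide_right_mono mult_right_mono) (auto simp: a_def)
        with 1 show ?thesis by (simp add: M_def algebra_simps)
      qed
      ultimately have "k / \<rho> - \<epsilon> * M \<le> k * exp (\<alpha> * d) * (r u / cum u)" by simp
      moreover have "\<epsilon> * M \<le> k * (exp (- \<alpha> * d) / \<rho> - y) / 2"
      proof -
        have "\<epsilon> * M \<le> k * (exp (- \<alpha> * d) / \<rho> - y) / (2 * M) * M"
          using M by (intro mult_right_mono) (auto simp: \<epsilon>_def)
        then show ?thesis using M by simp
      qed
      ultimately have main: "k / \<rho> - k * (exp (- \<alpha> * d) / \<rho> - y) / 2 \<le> k * (exp (\<alpha> * d) * (r u / cum u))"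
        unfolding mult.assoc by linarith
      \<comment> \<open>With \<open>E = exp (\<alpha> * d) \<ge> 1\<close> and the gap
        \<open>z\<close>, \<open>y * E = 1 / \<rho> - z * E\<close>, which lies below
        \<open>1 / \<rho> - z / 2\<close>.\<close>
      have "k * y * exp (\<alpha> * d) < k / \<rho> - k * (exp (- \<alpha> * d) / \<rho> - y) / 2"
      proof -
        define E where "E = exp (\<alpha> * d)"
        have E: "E \<ge> 1" "exp (- \<alpha> * d) = 1 / E" using alpha_pos d by (auto simp: E_def exp_minus field_simps)
        define z where "z = 1 / E / \<rho> - y"
        have z: "z > 0" using d E by (simp add: z_def)
        have "y * E = 1 / \<rho> - z * E" using E by (simp add: z_def field_simps)
        moreover have "z * E > z / 2" using z E mult_left_mono[of 1 E z] by simp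
        ultimately have "y * E < 1 / \<rho> - z / 2" by simp
        then have "k * (y * E) < k * (1 / \<rho> - z / 2)" using k_pos by (intro mult_strict_left_mono)
        then show ?thesis unfolding E(2) z_def[symmetric] by (simp add: E_def algebra_simps)
      qed
      with main have "k * (exp (\<alpha> * d) * y) < k * (exp (\<alpha> * d) * (r u / cum u))" by (simp only: ac_simps)
      then have "exp (\<alpha> * d) * y < exp (\<alpha> * d) * (r u / cum u)"
        using k_pos by (rule mult_left_less_imp_less[OF _ less_imp_le])
      then show "y < r u / cum u"
        by (rule mult_left_less_imp_less) simp
    qed
  qed
  show ?thesis
  proof (rule order_tendstoI)
    fix a assume "1 / \<rho> < a"
    then obtain b where b: "1 / \<rho> < b" "b < a" using dense by blast
    from ev_upper[OF b(1)] cum_pos show "\<forall>\<^sub>F u in at_top. r u / cum u < a"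
    proof eventually_elim
      case (elim u)
      then have "r u / cum u \<le> b" by (simp add: field_simps)
      then show ?case using b by simp
    qed
  qed (rule lower)
qed

end

section \<open>Elementary estimates\<close>

text \<open>Weighted AM-GM between 1 and \<open>y\<close>. The equality case is included because
  \<open>A_moment_less\<close> needs strictness; it holds as \<open>ln x = x - 1\<close> only at
  \<open>x = 1\<close>, applied at \<open>y / g\<close> and \<open>1 / g\<close>.\<close>

lemma young_powr:
  fixes p y :: real
  assumes "0 < p" "p < 1" "y \<ge> 0"
  shows "y powr p \<le> (1 - p) + p * y"
    and "y powr p = (1 - p) + p * y \<Longrightarrow> y = 1"
proof -
  have "y powr p \<le> (1 - p) + p * y \<and> (y powr p = (1 - p) + p * y \<longrightarrow> y = 1)"
  proof (cases "y = 0")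
    case True
    then show ?thesis using assms by auto
  next
    case False
    then have y: "y > 0" using assms by simp
    define g where "g = (1 - p) + p * y"
    have g: "g > 0" using assms y by (simp add: g_def add_pos_pos)
    have 1: "ln (y / g) \<le> y / g - 1" "ln (1 / g) \<le> 1 / g - 1"
      using y g by (auto intro!: ln_le_minus_one)
    have "p * (y / g - 1) + (1 - p) * (1 / g - 1) = ((1 - p) + p * y) / g - 1"
      using g by (simp add: field_simps)
    then have zero: "p * (y / g - 1) + (1 - p) * (1 / g - 1) = 0"
      using g by (simp add: g_def[symmetric])
    have split: "p * ln y - ln g = p * ln (y / g) + (1 - p) * ln (1 / g)"
      using y g by (simp add: ln_div algebra_simps)
    have "p * ln (y / g) + (1 - p) * ln (1 / g) \<le> p * (y / g - 1) + (1 - p) * (1 / g - 1)"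
      using 1 assms by (intro add_mono mult_left_mono) auto
    then have le: "p * ln y \<le> ln g" using split zero by simp
    have ypow: "y powr p = exp (p * ln y)" using y by (simp add: powr_def)
    have "y powr p \<le> g" using le g by (simp add: ypow) (metis exp_le_cancel_iff exp_ln)
    moreover have "y = 1" if eq: "y powr p = g"
    proof -
      have "p * ln y = ln g" using eq ypow by (metis ln_exp)
      then have e: "p * (y / g - 1 - ln (y / g)) + (1 - p) * (1 / g - 1 - ln (1 / g)) = 0"
        using split zero by (simp add: algebra_simps)
      have "p * (y / g - 1 - ln (y / g)) \<ge> 0" "(1 - p) * (1 / g - 1 - ln (1 / g)) \<ge> 0"
        using 1 assms by auto
      with e have "(1 - p) * (1 / g - 1 - ln (1 / g)) = 0" "p * (y / g - 1 - ln (y / g)) = 0" by linarith+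
      then have "ln (1 / g) = 1 / g - 1" "ln (y / g) = y / g - 1" using assms by auto
      then have "1 / g = 1" "y / g = 1"
        using ln_eq_minus_one[of "1 / g"] ln_eq_minus_one[of "y / g"] g y by simp_all
      then show "y = 1" using g by simp
    qed
    ultimately show ?thesis by (simp add: g_def)
  qed
  then show "y powr p \<le> (1 - p) + p * y" "y powr p = (1 - p) + p * y \<Longrightarrow> y = 1" by auto
qed

lemma powr_add_le:
  fixes a b s :: real
  assumes "a \<ge> 0" "b \<ge> 0" "0 < s" "s \<le> 1"
  shows "(a + b) powr s \<le> a powr s + b powr s"
proof (cases "a + b = 0")
  case True
  then show ?thesis using assms by simp
next
  case False
  then have c: "a + b > 0" using assms by simp
  have *: "x / (a + b) * (a + b) powr s \<le> x powr s" if "x \<ge> 0" "x \<le> a + b" for x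
  proof (cases "x = 0")
    case False
    have "x / (a + b) = (x / (a + b)) powr 1" using that False c by simp
    also have "\<dots> \<le> (x / (a + b)) powr s"
      using that False c assms by (intro powr_mono') auto
    finally have "x / (a + b) * (a + b) powr s \<le> (x / (a + b)) powr s * (a + b) powr s"
      by (intro mult_right_mono) auto
    also have "\<dots> = x powr s" using that c by (simp flip: powr_mult)
    finally show ?thesis .
  qed (use assms in simp)
  have "(a + b) powr s = a / (a + b) * (a + b) powr s + b / (a + b) * (a + b) powr s"
    using c by (simp flip: distrib_right add_divide_distrib)
  also have "\<dots> \<le> a powr s + b powr s" using assms by (intro add_mono *) auto
  finally show ?thesis .
qed

text \<open>For \<open>s > 1\<close> powers are not subadditive. Splitting at
  \<open>b = t * a\<close> keeps the coefficient of the first term as close to 1 as desired, so that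
  a moment of \<open>A\<close> below 1 still contracts; the price is a large coefficient on
  \<open>b\<close>.\<close>

lemma truncated_powr_add_le:
  fixes a b s t x :: real
  assumes "a \<ge> 0" "b \<ge> 0" "s > 0" "t > 0" "x > 0"
  shows "min (a + b) x powr s \<le> (1 + t) powr s * min a x powr s + (1 + 1 / t) powr s * b powr s"
proof (cases "b \<le> t * a")
  case True
  have "min (a + b) x \<le> min ((1 + t) * a) ((1 + t) * x)"
    using True assms by (intro min.mono) (auto simp: algebra_simps)
  also have "\<dots> = (1 + t) * min a x" using assms by (simp add: min_mult_distrib_left)
  finally have "min (a + b) x powr s \<le> ((1 + t) * min a x) powr s"
    using assms by (intro powr_mono2) auto
  also have "\<dots> = (1 + t) powr s * min a x powr s" using assms by (intro powr_mult)
  finally show ?thesis by (simp add: add_increasing2)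
next
  case False
  have "min (a + b) x \<le> (1 + 1 / t) * b" using False assms by (auto simp: field_simps min_le_iff_disj)
  then have "min (a + b) x powr s \<le> ((1 + 1 / t) * b) powr s"
    using assms by (intro powr_mono2) auto
  also have "\<dots> = (1 + 1 / t) powr s * b powr s" using assms by (intro powr_mult)
  finally show ?thesis by (simp add: add_increasing)
qed

lemma truncated_powr_add_le':
  fixes a b s x :: real
  assumes "a \<ge> 0" "b \<ge> 0" "0 < s" "s \<le> 1" "x > 0"
  shows "min (a + b) x powr s \<le> min a x powr s + b powr s"
proof -
  have "min (a + b) x powr s \<le> (min a x + b) powr s"
    using assms by (intro powr_mono2) auto
  also have "\<dots> \<le> min a x powr s + b powr s"
    using assms by (intro powr_add_le) auto
  finally show ?thesis .
qed

text \<open>Moves weight from \<open>b\<close> to \<open>a\<close>: if \<open>b \<le> a\<close>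
  everything is absorbed by \<open>a powr \<alpha>\<close>, otherwise the factor
  \<open>a powr (\<alpha> - \<eta> - s)\<close> is raised to the same power of
  \<open>b\<close>.\<close>

lemma interpolate_powr:
  fixes a b \<alpha> \<eta> s :: real
  assumes "a \<ge> 0" "b \<ge> 0" "0 < s" "s \<le> \<alpha> - \<eta>" "0 < \<eta>"
  shows "a powr (\<alpha> - s) * b powr s \<le> a powr \<alpha> + a powr \<eta> * b powr (\<alpha> - \<eta>)"
proof (cases "a = 0 \<or> b = 0")
  case True
  then show ?thesis using assms by (auto simp: powr_def)
next
  case False
  then have ab: "a > 0" "b > 0" using assms by auto
  show ?thesis
  proof (cases "b \<le> a")
    case True
    have "a powr (\<alpha> - s) * b powr s \<le> a powr (\<alpha> - s) * a powr s"
      using assms True ab by (intro mult_left_mono powr_mono2) auto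
    also have "\<dots> = a powr \<alpha>" by (simp flip: powr_add)
    finally show ?thesis by (simp add: add_increasing2)
  next
    case False
    have "a powr (\<alpha> - s) * b powr s = a powr \<eta> * a powr (\<alpha> - \<eta> - s) * b powr s"
      by (simp flip: powr_add)
    also have "\<dots> \<le> a powr \<eta> * b powr (\<alpha> - \<eta> - s) * b powr s"
      using assms False ab by (intro mult_left_mono mult_right_mono powr_mono2) auto
    also have "\<dots> = a powr \<eta> * b powr (\<alpha> - \<eta>)" by (simp add: mult.assoc flip: powr_add)
    finally show ?thesis by (simp add: add_increasing)
  qed
qed

section \<open>Logarithmic integrals over threshold events\<close>

lemma nn_integral_exp_lessThan:
  fixes c v :: real
  assumes "c > 0"
  shows "(\<integral>\<^sup>+s. (if s < v then ennreal (exp (c * s)) else 0) \<partial>lborel) = ennreal (exp (c * v) / c)"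
proof -
  have "(\<integral>\<^sup>+s. (if s < v then ennreal (exp (c * s)) else 0) \<partial>lborel)
      = (\<integral>\<^sup>+s. ennreal (exp (c * s)) * indicator {..v} s \<partial>lborel)"
    using AE_lborel_singleton[of v]
    by (intro nn_integral_cong_AE) (auto split: split_indicator)
  then show ?thesis using nn_integral_exp_atMost[OF assms] by simp
qed

lemma nn_integral_exp_below:
  fixes c z :: real
  assumes "c > 0"
  shows "(\<integral>\<^sup>+u. (if exp u < z then ennreal (exp (c * u)) else 0) \<partial>lborel) = ennreal (max z 0 powr c / c)"
proof (cases "z > 0")
  case True
  then have "exp u < z \<longleftrightarrow> u < ln z" for u by (metis exp_less_cancel_iff exp_ln)
  then show ?thesis using nn_integral_exp_lessThan[OF assms, of "ln z"] True
    by (simp add: powr_def)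
next
  case False
  then have "\<not> exp u < z" for u by (meson exp_gt_zero less_trans)
  then show ?thesis using False by simp
qed

lemma nn_integral_log_interval_le:
  fixes f :: "real \<Rightarrow> ennreal" and p q :: real
  assumes "p > 0" "p \<le> q" "\<And>u. p \<le> exp u \<Longrightarrow> exp u < q \<Longrightarrow> f u \<le> C"
  shows "(\<integral>\<^sup>+u. (if p \<le> exp u \<and> exp u < q then f u else 0) \<partial>lborel) \<le> C * ennreal ((q - p) / p)"
proof -
  have iff: "p \<le> exp u \<and> exp u < q \<longleftrightarrow> u \<in> {ln p..<ln q}" for u
    using exp_le_cancel_iff[of "ln p" u] exp_less_cancel_iff[of u "ln q"] assms(1,2) by simp
  have "(\<integral>\<^sup>+u. (if p \<le> exp u \<and> exp u < q then f u else 0) \<partial>lborel) \<le> (\<integral>\<^sup>+u. C * indicator {ln p..<ln q} u \<partial>lborel)"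
    using assms(3) iff by (intro nn_integral_mono) (auto split: split_indicator)
  also have "\<dots> = C * ennreal (ln q - ln p)"
    using assms by (subst nn_integral_cmult_indicator) auto
  also have "ln q - ln p \<le> (q - p) / p"
    using ln_le_minus_one[of "q / p"] assms by (simp add: ln_div diff_divide_distrib)
  finally show ?thesis by (simp add: ennreal_leI mult_left_mono)
qed

lemma powr_mult_ratio_le:
  fixes m n :: real
  assumes "0 < n" "n \<le> m" "s \<le> 1"
  shows "m powr \<alpha> * (n / m) \<le> m powr (\<alpha> - s) * n powr s"
proof -
  have "n / m = (n / m) powr 1" using assms by simp
  also have "\<dots> \<le> (n / m) powr s" using assms by (intro powr_mono') auto
  finally have "m powr \<alpha> * (n / m) \<le> m powr \<alpha> * (n / m) powr s" by (intro mult_left_mono) auto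
  also have "\<dots> = m powr (\<alpha> - s) * n powr s" using assms by (simp add: powr_divide powr_diff)
  finally show ?thesis .
qed

text \<open>Here \<open>a + b\<close> passes the level although neither summand does. On the
  logarithmic scale this range has length at most min/max, while \<open>exp (\<alpha> * u)\<close>
  is at most \<open>(2 * max a b) powr \<alpha>\<close>. The ratio is weakened to its power
  \<open>s\<close> or \<open>t\<close>, depending on which summand is larger, to match the mixed
  moments at hand.\<close>

lemma log_integral_sum_over_max:
  fixes a b \<alpha> s t :: real
  assumes "\<alpha> > 0" "a > 0" "b > 0" "s \<le> 1" "t \<le> 1"
  shows "(\<integral>\<^sup>+u. (if max a b \<le> exp u \<and> exp u < a + b then ennreal (exp (\<alpha> * u)) else 0) \<partial>lborel)
     \<le> ennreal (2 powr \<alpha> * (a powr (\<alpha> - s) * b powr s + b powr (\<alpha> - t) * a powr t))"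
proof -
  have *: "(\<integral>\<^sup>+u. (if m \<le> exp u \<and> exp u < m + n then ennreal (exp (\<alpha> * u)) else 0) \<partial>lborel)
     \<le> ennreal (2 powr \<alpha> * (m powr (\<alpha> - s) * n powr s))" if "0 < n" "n \<le> m" "s \<le> 1" for m n s
  proof -
    have "exp (\<alpha> * u) \<le> (2 * m) powr \<alpha>" if "exp u < m + n" for u
    proof -
      have "exp u powr \<alpha> \<le> (2 * m) powr \<alpha>" using that \<open>n \<le> m\<close> assms by (intro powr_mono2) auto
      then show ?thesis by (simp add: powr_def mult.commute)
    qed
    then have "(\<integral>\<^sup>+u. (if m \<le> exp u \<and> exp u < m + n then ennreal (exp (\<alpha> * u)) else 0) \<partial>lborel)
       \<le> ennreal ((2 * m) powr \<alpha>) * ennreal ((m + n - m) / m)"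
      using that by (intro nn_integral_log_interval_le) (auto intro!: ennreal_leI)
    also have "\<dots> = ennreal (2 powr \<alpha> * (m powr \<alpha> * (n / m)))"
      using that by (simp add: powr_mult mult.assoc flip: ennreal_mult)
    also have "\<dots> \<le> ennreal (2 powr \<alpha> * (m powr (\<alpha> - s) * n powr s))"
      using that by (intro ennreal_leI mult_left_mono powr_mult_ratio_le) auto
    finally show ?thesis .
  qed
  show ?thesis
  proof (cases "b \<le> a")
    case True
    then have "max a b = a" by simp
    then show ?thesis using *[OF assms(3) True assms(4)]
      by (auto elim!: order_trans intro!: ennreal_leI mult_left_mono)
  next
    case False
    then have "max a b = b" "a \<le> b" by simp_all
    then show ?thesis using *[OF assms(2) _ assms(5), of b]
      by (auto simp: add.commute elim!: order_trans intro!: ennreal_leI mult_left_mono)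
  qed
qed

lemma log_integral_min:
  fixes a b \<alpha> t :: real
  assumes "0 < t" "t < \<alpha>"
  shows "(\<integral>\<^sup>+u. (if exp u < a \<and> exp u < b then ennreal (exp (\<alpha> * u)) else 0) \<partial>lborel)
     \<le> ennreal (\<bar>a\<bar> powr t * max b 0 powr (\<alpha> - t) / \<alpha>)"
proof -
  define m where "m = max (min a b) 0"
  have "(\<integral>\<^sup>+u. (if exp u < a \<and> exp u < b then ennreal (exp (\<alpha> * u)) else 0) \<partial>lborel) = ennreal (m powr \<alpha> / \<alpha>)"
    using nn_integral_exp_below[of \<alpha> "min a b"] assms by (simp add: m_def)
  also have "m powr \<alpha> = m powr t * m powr (\<alpha> - t)" by (simp flip: powr_add)
  also have "\<dots> \<le> \<bar>a\<bar> powr t * max b 0 powr (\<alpha> - t)"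
    using assms by (intro mult_mono powr_mono2) (auto simp: m_def)
  finally show ?thesis using assms by (simp add: ennreal_leI divide_right_mono)
qed

text \<open>Here \<open>b\<close> passes the level but a negative \<open>a\<close> pulls the sum
  back. If \<open>\<bar>a\<bar> \<le> b / 2\<close> the range is short on the logarithmic scale;
  otherwise \<open>b < 2 * \<bar>a\<bar>\<close>, and the whole range below \<open>b\<close> can be
  charged.\<close>

lemma log_integral_loss:
  fixes a b \<alpha> t :: real
  assumes "0 < t" "t < \<alpha>" "t \<le> 1" "b > 0"
  shows "(\<integral>\<^sup>+u. (if a + b \<le> exp u \<and> exp u < b then ennreal (exp (\<alpha> * u)) else 0) \<partial>lborel)
     \<le> ennreal ((2 + 2 / \<alpha>) * (\<bar>a\<bar> powr t * b powr (\<alpha> - t)))" (is "(\<integral>\<^sup>+u. ?f u \<partial>lborel) \<le> _")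
proof (cases "a \<ge> 0")
  case True
  then have "?f u = 0" for u by auto
  then show ?thesis by simp
next
  case False
  define n where "n = \<bar>a\<bar>"
  have n: "n > 0" "a = - n" using False by (auto simp: n_def)
  define X where "X = n powr t * b powr (\<alpha> - t)"
  have X0: "X \<ge> 0" by (simp add: X_def)
  have expb: "exp (\<alpha> * u) \<le> b powr \<alpha>" if "exp u < b" for u
  proof -
    have "exp u powr \<alpha> \<le> b powr \<alpha>" using that assms by (intro powr_mono2) auto
    then show ?thesis by (simp add: powr_def mult.commute)
  qed
  show ?thesis
  proof (cases "n \<le> b / 2")
    case True
    have "(\<integral>\<^sup>+u. ?f u \<partial>lborel)
       \<le> ennreal (b powr \<alpha>) * ennreal ((b - (a + b)) / (a + b))"
      using expb n True assms by (intro nn_integral_log_interval_le) (auto intro!: ennreal_leI)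
    also have "(b - (a + b)) / (a + b) \<le> 2 * (n / b)"
      using n True assms by (simp add: field_simps)
    then have "ennreal (b powr \<alpha>) * ennreal ((b - (a + b)) / (a + b)) \<le> ennreal (b powr \<alpha>) * ennreal (2 * (n / b))"
      by (intro mult_left_mono ennreal_leI) auto
    also have "\<dots> = ennreal (2 * (b powr \<alpha> * (n / b)))"
      using n assms by (simp flip: ennreal_mult add: ac_simps)
    also have "\<dots> \<le> ennreal (2 * X)"
      using powr_mult_ratio_le[of n b t \<alpha>] n True assms
      by (intro ennreal_leI mult_left_mono) (auto simp: X_def mult.commute)
    also have "\<dots> \<le> ennreal ((2 + 2 / \<alpha>) * X)"
      using X0 assms by (intro ennreal_leI mult_right_mono) auto
    finally show ?thesis by (simp add: X_def n_def)
  next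
    case False
    have "(\<integral>\<^sup>+u. ?f u \<partial>lborel)
       \<le> (\<integral>\<^sup>+u. (if exp u < b then ennreal (exp (\<alpha> * u)) else 0) \<partial>lborel)"
      by (intro nn_integral_mono) auto
    also have "\<dots> = ennreal (b powr \<alpha> / \<alpha>)"
      using assms nn_integral_exp_below[of \<alpha> b] by simp
    also have "b powr \<alpha> \<le> 2 * X"
    proof -
      have "b powr \<alpha> = b powr t * b powr (\<alpha> - t)" by (simp flip: powr_add)
      also have "b powr t \<le> (2 * n) powr t" using False assms by (intro powr_mono2) auto
      also have "(2 * n) powr t = 2 powr t * n powr t" using n by (simp add: powr_mult)
      also have "2 powr t \<le> (2::real) powr 1" using assms by (intro powr_mono) auto
      finally show ?thesis using assms by (simp add: X_def mult_right_mono)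
    qed
    then have "ennreal (b powr \<alpha> / \<alpha>) \<le> ennreal ((2 + 2 / \<alpha>) * X)"
      using assms X0 by (intro ennreal_leI) (simp add: field_simps add_increasing2)
    finally show ?thesis by (simp add: X_def n_def)
  qed
qed

section \<open>Moments of the perpetuity\<close>

text \<open>By \<open>tail_laplace\<close> this is a moment of order \<open>\<alpha> - c\<close>.
  The trivial bound \<open>l_le\<close> handles the left part of the line, \<open>future\<close> the
  right part.\<close>

lemma (in slow_tail) laplace_finite:
  assumes "0 < c" "c < \<alpha>"
  shows "(\<integral>\<^sup>+u. ennreal (l u * exp (- c * u)) \<partial>lborel) < \<infinity>"
proof -
  obtain u where u: "future c u \<le> ennreal (1 * cum u)"
    using tail_small[OF assms(1) zero_less_one] by (auto simp: eventually_at_top_linorder)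
  have "(\<integral>\<^sup>+s. ennreal (l s * exp (- c * s)) \<partial>lborel)
     \<le> (\<integral>\<^sup>+s. ennreal (exp ((\<alpha> - c) * s)) * indicator {..u} s
          + ennreal (exp (- c * u)) * (ennreal (l s * exp (- c * (s - u))) * indicator {u<..} s) \<partial>lborel)"
  proof (intro nn_integral_mono)
    fix s
    have "l s * exp (- c * s) \<le> exp ((\<alpha> - c) * s)"
    proof -
      have "l s * exp (- c * s) \<le> exp (\<alpha> * s) * exp (- c * s)" using l_le by (intro mult_right_mono) auto
      also have "\<dots> = exp ((\<alpha> - c) * s)" by (simp add: algebra_simps flip: exp_add)
      finally show ?thesis .
    qed
    moreover have "l s * exp (- c * s) = exp (- c * u) * (l s * exp (- c * (s - u)))"
      by (simp add: algebra_simps flip: exp_add)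
    ultimately show "ennreal (l s * exp (- c * s)) \<le> ennreal (exp ((\<alpha> - c) * s)) * indicator {..u} s
          + ennreal (exp (- c * u)) * (ennreal (l s * exp (- c * (s - u))) * indicator {u<..} s)"
      using l_nonneg[of s] by (cases "s \<le> u") (auto simp: ennreal_leI simp flip: ennreal_mult)
  qed
  also have "\<dots> = ennreal (exp ((\<alpha> - c) * u) / (\<alpha> - c))
          + ennreal (exp (- c * u)) * future c u"
    using assms by (subst nn_integral_add) (auto simp: nn_integral_exp_atMost nn_integral_cmult future_def)
  also have "\<dots> < \<infinity>"
    using u[THEN le_less_trans] by (auto simp: ennreal_mult_less_top)
  finally show ?thesis .
qed

text \<open>The hypotheses take the form in which they are applied: \<open>A\<close> is nonnegative
  everywhere, and independence says that in an integral over \<open>(R, A, B)\<close> the variable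
  \<open>R\<close> may be replaced by a copy integrated separately.\<close>

locale perpetuity = prob_space M for M :: "'a measure" +
  fixes A B R :: "'a \<Rightarrow> real" and \<alpha> \<eta> :: real
  assumes measurable_A [measurable]: "A \<in> borel_measurable M"
    and measurable_B [measurable]: "B \<in> borel_measurable M"
    and measurable_R [measurable]: "R \<in> borel_measurable M"
    and alpha: "\<alpha> > 0"
    and eta: "0 < \<eta>" "\<eta> < \<alpha>" "\<eta> \<le> 1"
    and A_nonneg: "\<And>w. A w \<ge> 0"
    and A_nontrivial: "\<not> (AE w in M. A w = 1)"
    and A_moment: "(\<integral>\<^sup>+w. ennreal (A w powr \<alpha>) \<partial>M) = 1"
    and A_log_moment: "integrable M (\<lambda>w. A w powr \<alpha> * ln (A w))"
    and B_slow: "slowly_varying (\<lambda>x. x powr \<alpha> * prob {w \<in> space M. B w > x})"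
    and B_infinite: "(\<integral>\<^sup>+w. ennreal (max (B w) 0 powr \<alpha>) \<partial>M) = \<infinity>"
    and B_neg_moment: "\<And>s. 0 < s \<Longrightarrow> s < \<alpha> \<Longrightarrow> (\<integral>\<^sup>+w. ennreal (max (- B w) 0 powr s) \<partial>M) < \<infinity>"
    and AB_moment: "(\<integral>\<^sup>+w. ennreal (A w powr \<eta> * max (B w) 0 powr (\<alpha> - \<eta>)) \<partial>M) < \<infinity>"
    and independent: "\<And>f. f \<in> borel_measurable (borel \<Otimes>\<^sub>M (borel \<Otimes>\<^sub>M borel)) \<Longrightarrow>
        (\<integral>\<^sup>+w. f (R w, A w, B w) \<partial>M) = (\<integral>\<^sup>+w. (\<integral>\<^sup>+v. f (R v, A w, B w) \<partial>M) \<partial>M)"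
    and stationary: "distr M borel R = distr M borel (\<lambda>w. A w * R w + B w)"
begin

lemma stationary_nn_integral:
  assumes [measurable]: "f \<in> borel_measurable borel"
  shows "(\<integral>\<^sup>+w. f (R w) \<partial>M) = (\<integral>\<^sup>+w. f (A w * R w + B w) \<partial>M)"
proof -
  have "(\<integral>\<^sup>+w. f (R w) \<partial>M) = (\<integral>\<^sup>+x. f x \<partial>distr M borel R)"
    by (simp add: nn_integral_distr)
  also have "\<dots> = (\<integral>\<^sup>+w. f (A w * R w + B w) \<partial>M)"
    unfolding stationary by (simp add: nn_integral_distr)
  finally show ?thesis .
qed

lemma independent':
  assumes [measurable]: "(\<lambda>(r, a, b). f r a b) \<in> borel_measurable (borel \<Otimes>\<^sub>M (borel \<Otimes>\<^sub>M borel))"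
  shows "(\<integral>\<^sup>+w. f (R w) (A w) (B w) \<partial>M) = (\<integral>\<^sup>+w. (\<integral>\<^sup>+v. f (R v) (A w) (B w) \<partial>M) \<partial>M)"
  using independent[OF assms] by simp

abbreviation moment :: "('a \<Rightarrow> real) \<Rightarrow> real \<Rightarrow> ennreal" where
  "moment X s \<equiv> (\<integral>\<^sup>+w. ennreal (X w powr s) \<partial>M)"

abbreviation abs_moment :: "('a \<Rightarrow> real) \<Rightarrow> real \<Rightarrow> ennreal" where
  "abs_moment X s \<equiv> moment (\<lambda>w. \<bar>X w\<bar>) s"

text \<open>Convexity in the order: moments are at most 1 at order 0 and equal to 1 at order
  \<alpha>. A moment of at least 1 in between would make the nonnegative defect \<open>D\<close> in
  Young's inequality vanish almost surely, which forces \<open>A = 1\<close>.\<close>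

lemma A_moment_less:
  assumes "0 < s" "s < \<alpha>"
  shows "moment A s < 1"
proof (rule ccontr)
  assume "\<not> ?thesis"
  then have ge: "1 \<le> moment A s" by (simp add: not_less)
  define p where "p = s / \<alpha>"
  have p: "0 < p" "p < 1" using assms alpha by (auto simp: p_def)
  have pow: "(A w powr \<alpha>) powr p = A w powr s" for w using alpha by (simp add: powr_powr p_def)
  define D where "D w = (1 - p) + p * A w powr \<alpha> - A w powr s" for w
  have D0: "D w \<ge> 0" for w using young_powr(1)[OF p, of "A w powr \<alpha>"] by (simp add: D_def pow)
  have D_meas [measurable]: "D \<in> borel_measurable M" unfolding D_def by measurable
  have "moment A s + (\<integral>\<^sup>+w. ennreal (D w) \<partial>M) = (\<integral>\<^sup>+w. ennreal ((1 - p) + p * A w powr \<alpha>) \<partial>M)"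
    by (subst nn_integral_add[symmetric])
       (auto intro!: nn_integral_cong arg_cong[where f = ennreal] simp: D0 simp flip: ennreal_plus, simp add: D_def)
  also have "\<dots> = (\<integral>\<^sup>+w. ennreal (1 - p) + ennreal p * ennreal (A w powr \<alpha>) \<partial>M)"
    using p by (intro nn_integral_cong) (auto simp flip: ennreal_plus ennreal_mult)
  also have "\<dots> = ennreal (1 - p) + ennreal p"
    by (subst nn_integral_add) (auto simp: nn_integral_cmult A_moment emeasure_space_1)
  also have "\<dots> = 1" using p by (simp flip: ennreal_plus)
  finally have eq: "moment A s + (\<integral>\<^sup>+w. ennreal (D w) \<partial>M) = 1" .
  have "1 + (\<integral>\<^sup>+w. ennreal (D w) \<partial>M) \<le> 1 + 0"
    using add_right_mono[OF ge, of "\<integral>\<^sup>+w. ennreal (D w) \<partial>M"] eq by simp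
  then have "(\<integral>\<^sup>+w. ennreal (D w) \<partial>M) = 0"
    by (subst (asm) ennreal_add_left_cancel_le) simp
  then have "AE w in M. ennreal (D w) = 0"
    by (subst (asm) nn_integral_0_iff_AE) auto
  then have "AE w in M. D w = 0"
  proof eventually_elim
    case (elim w)
    then show ?case using D0[of w] by (simp add: ennreal_eq_0_iff)
  qed
  then have "AE w in M. A w = 1"
  proof eventually_elim
    case (elim w)
    then have "A w powr \<alpha> = 1"
      using young_powr(2)[OF p, of "A w powr \<alpha>"] by (simp add: D_def pow)
    then show ?case using A_nonneg[of w] alpha
      by (cases "A w = 0") (auto simp: powr_def)
  qed
  then show False using A_nontrivial by simp
qed

lemma A_moment_real:
  assumes "0 < s" "s < \<alpha>"
  shows "\<exists>\<theta>. 0 \<le> \<theta> \<and> \<theta> < 1 \<and> moment A s = ennreal \<theta>"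
  using A_moment_less[OF assms]
  by (cases "moment A s") (auto simp flip: ennreal_1 simp: ennreal_less_iff)

section \<open>Tails in logarithmic scale\<close>

definition tail :: "('a \<Rightarrow> real) \<Rightarrow> real \<Rightarrow> real" where
  "tail X u = exp (\<alpha> * u) * prob {w \<in> space M. X w > exp u}"

lemma tail_nonneg: "tail X u \<ge> 0" by (simp add: tail_def)

lemma tail_le: "tail X u \<le> exp (\<alpha> * u)"
  by (simp add: tail_def mult_left_le)

lemma tail_growth:
  assumes [measurable]: "X \<in> borel_measurable M" and "t \<ge> 0"
  shows "tail X (u + t) \<le> exp (\<alpha> * t) * tail X u"
proof -
  have le: "exp u \<le> exp (u + t)" using assms by simp
  have "{w \<in> space M. X w > exp (u + t)} \<subseteq> {w \<in> space M. X w > exp u}"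
    using le_less_trans[OF le] by auto
  then have "prob {w \<in> space M. X w > exp (u + t)} \<le> prob {w \<in> space M. X w > exp u}"
    by (intro finite_measure_mono) measurable
  then have "exp (\<alpha> * (u + t)) * prob {w \<in> space M. X w > exp (u + t)} \<le> exp (\<alpha> * (u + t)) * prob {w \<in> space M. X w > exp u}"
    by (intro mult_left_mono) auto
  then show ?thesis by (simp add: tail_def distrib_left exp_add ac_simps)
qed

text \<open>With the factor \<open>exp (\<alpha> * u)\<close> inside the expectation, inequalities
  between tails can be checked at each sample point.\<close>

abbreviation weight :: "real \<Rightarrow> bool \<Rightarrow> ennreal" where
  "weight u P \<equiv> (if P then ennreal (exp (\<alpha> * u)) else 0)"

lemma tail_eq_nn_integral:
  assumes [measurable]: "X \<in> borel_measurable M"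
  shows "ennreal (tail X u) = (\<integral>\<^sup>+w. weight u (exp u < X w) \<partial>M)"
proof -
  have "(\<integral>\<^sup>+w. weight u (exp u < X w) \<partial>M)
      = (\<integral>\<^sup>+w. ennreal (exp (\<alpha> * u)) * indicator {w \<in> space M. X w > exp u} w \<partial>M)"
    by (intro nn_integral_cong) (auto split: split_indicator)
  also have "\<dots> = ennreal (exp (\<alpha> * u)) * emeasure M {w \<in> space M. X w > exp u}"
    by (intro nn_integral_cmult_indicator) measurable
  finally show ?thesis by (simp add: tail_def ennreal_mult emeasure_eq_measure)
qed

text \<open>Layer-cake formula in logarithmic scale. The case \<open>c = 0\<close> turns the
  infinite moment of \<open>B\<close> into \<open>l_infinite\<close>; positive \<open>c\<close>
  links Laplace integrals to moments of order below \<alpha>.\<close>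

lemma tail_laplace:
  assumes [measurable]: "X \<in> borel_measurable M" and "c < \<alpha>"
  shows "(\<integral>\<^sup>+u. ennreal (tail X u * exp (- c * u)) \<partial>lborel)
    = ennreal (1 / (\<alpha> - c)) * (\<integral>\<^sup>+w. ennreal (max (X w) 0 powr (\<alpha> - c)) \<partial>M)"
proof -
  interpret pair_sigma_finite lborel M ..
  have "(\<integral>\<^sup>+u. ennreal (tail X u * exp (- c * u)) \<partial>lborel)
      = (\<integral>\<^sup>+u. (\<integral>\<^sup>+w. (if exp u < X w then ennreal (exp ((\<alpha> - c) * u)) else 0) \<partial>M) \<partial>lborel)"
  proof (intro nn_integral_cong)
    fix u
    have "ennreal (tail X u * exp (- c * u)) = (\<integral>\<^sup>+w. weight u (exp u < X w) * ennreal (exp (- c * u)) \<partial>M)"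
      by (subst nn_integral_multc) (auto simp: tail_nonneg ennreal_mult tail_eq_nn_integral)
    also have "\<dots> = (\<integral>\<^sup>+w. (if exp u < X w then ennreal (exp ((\<alpha> - c) * u)) else 0) \<partial>M)"
      by (intro nn_integral_cong) (auto simp: algebra_simps simp flip: ennreal_mult exp_add)
    finally show "ennreal (tail X u * exp (- c * u)) = (\<integral>\<^sup>+w. (if exp u < X w then ennreal (exp ((\<alpha> - c) * u)) else 0) \<partial>M)" .
  qed
  also have "\<dots> = (\<integral>\<^sup>+w. (\<integral>\<^sup>+u. (if exp u < X w then ennreal (exp ((\<alpha> - c) * u)) else 0) \<partial>lborel) \<partial>M)"
    by (intro Fubini'[symmetric]) measurable
  also have "\<dots> = (\<integral>\<^sup>+w. ennreal (1 / (\<alpha> - c)) * ennreal (max (X w) 0 powr (\<alpha> - c)) \<partial>M)"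
    using assms by (intro nn_integral_cong) (simp add: nn_integral_exp_below flip: ennreal_mult)
  also have "\<dots> = ennreal (1 / (\<alpha> - c)) * (\<integral>\<^sup>+w. ennreal (max (X w) 0 powr (\<alpha> - c)) \<partial>M)"
    by (intro nn_integral_cmult) measurable
  finally show ?thesis .
qed

sublocale slow_tail "tail B" \<alpha>
proof
  let ?L = "\<lambda>x. x powr \<alpha> * prob {w \<in> space M. B w > x}"
  have eq: "tail B u = ?L (exp u)" for u by (simp add: tail_def powr_def)
  show "tail B u > 0" for u using B_slow unfolding eq slowly_varying_def by auto
  show "((\<lambda>u. tail B (u + t) / tail B u) \<longlongrightarrow> 1) at_top" for t
  proof -
    have "((\<lambda>x. ?L (exp t * x) / ?L x) \<longlongrightarrow> 1) at_top"
      using B_slow unfolding slowly_varying_def by auto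
    from filterlim_compose[OF this exp_at_top] show ?thesis
      unfolding eq exp_add by (simp add: mult.commute)
  qed
  show "(\<integral>\<^sup>+u. ennreal (tail B u) \<partial>lborel) = \<infinity>"
    using tail_laplace[OF measurable_B, of 0] alpha by (simp add: B_infinite ennreal_mult_top)
qed (use alpha tail_growth tail_le in auto)

lemma B_moment:
  assumes "0 < s" "s < \<alpha>"
  shows "abs_moment B s < \<infinity>"
proof -
  have "ennreal (1 / s) * (\<integral>\<^sup>+w. ennreal (max (B w) 0 powr s) \<partial>M) < \<infinity>"
    using laplace_finite[of "\<alpha> - s"] tail_laplace[OF measurable_B, of "\<alpha> - s"] assms by simp
  then have pos: "(\<integral>\<^sup>+w. ennreal (max (B w) 0 powr s) \<partial>M) < \<infinity>"
    using assms by (auto simp: ennreal_mult_less_top)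
  have "abs_moment B s
     \<le> (\<integral>\<^sup>+w. ennreal (max (B w) 0 powr s) + ennreal (max (- B w) 0 powr s) \<partial>M)"
    by (intro nn_integral_mono) (auto simp: max_def simp flip: ennreal_plus)
  also have "\<dots> < \<infinity>" using pos B_neg_moment[OF assms] by (subst nn_integral_add) auto
  finally show ?thesis .
qed

text \<open>One round multiplies the term in \<open>x powr q\<close> by \<open>c\<close> times the
  moment of order \<open>s - q\<close>, since \<open>(x / A) powr q\<close> releases
  \<open>A powr (- q)\<close>, and it multiplies constants by \<open>\<theta>\<close>; the
  inhomogeneity sums to a geometric series. The start may grow in \<open>x\<close> provided
  \<open>\<tau> < 1\<close> or a small \<epsilon> suppresses it.\<close>

lemma truncated_moment_iterate:
  fixes F :: "real \<Rightarrow> ennreal" and c b K \<epsilon> \<tau> \<theta> s q x :: real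
  assumes step: "\<And>x. x > 0 \<Longrightarrow> F x \<le> ennreal c * (\<integral>\<^sup>+w. ennreal (A w powr s) * F (x / A w) \<partial>M) + ennreal b"
    and start: "\<And>x. x > 0 \<Longrightarrow> F x \<le> ennreal (\<epsilon> * x powr q) + ennreal K"
    and q: "ennreal c * moment A (s - q) \<le> ennreal \<tau>"
    and s: "ennreal c * moment A s \<le> ennreal \<theta>"
    and nonneg: "c \<ge> 0" "b \<ge> 0" "K \<ge> 0" "\<epsilon> \<ge> 0" "\<tau> \<ge> 0" "0 \<le> \<theta>" "\<theta> < 1"
    and x: "x > 0"
  shows "F x \<le> ennreal (\<tau> ^ n * \<epsilon> * x powr q + \<theta> ^ n * K + b / (1 - \<theta>))"
  using x
proof (induction n arbitrary: x)
  case 0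
  then have "F x \<le> ennreal (\<epsilon> * x powr q + K)" using start[of x] nonneg by simp
  also have "\<dots> \<le> ennreal (\<epsilon> * x powr q + K + b / (1 - \<theta>))" using nonneg by (intro ennreal_leI) simp
  finally show ?case by simp
next
  case (Suc n)
  define D where "D = \<theta> ^ n * K + b / (1 - \<theta>)"
  define E where "E = \<tau> ^ n * \<epsilon> * x powr q"
  have DE: "D \<ge> 0" "E \<ge> 0" using nonneg by (auto simp: D_def E_def)
  have "(\<integral>\<^sup>+w. ennreal (A w powr s) * F (x / A w) \<partial>M)
     \<le> (\<integral>\<^sup>+w. ennreal E * ennreal (A w powr (s - q)) + ennreal D * ennreal (A w powr s) \<partial>M)"
  proof (intro nn_integral_mono)
    fix w
    show "ennreal (A w powr s) * F (x / A w) \<le> ennreal E * ennreal (A w powr (s - q)) + ennreal D * ennreal (A w powr s)"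
    \<comment> \<open>At \<open>A w = 0\<close> the quotient \<open>x / A w\<close> is 0, outside
      the induction hypothesis, but the factor \<open>A w powr s\<close> is 0 as well.\<close>
    proof (cases "A w = 0")
      case False
      then have a: "A w > 0" using A_nonneg[of w] by simp
      have "ennreal (A w powr s) * F (x / A w) \<le> ennreal (A w powr s) * ennreal (\<tau> ^ n * \<epsilon> * (x / A w) powr q + D)"
        using Suc.IH[of "x / A w"] a Suc.prems by (intro mult_left_mono) (auto simp: D_def add.assoc)
      also have "\<dots> = ennreal (E * A w powr (s - q) + D * A w powr s)"
        using a Suc.prems nonneg DE
        by (subst ennreal_mult[symmetric]) (auto simp: E_def powr_divide powr_diff field_simps)
      also have "\<dots> = ennreal E * ennreal (A w powr (s - q)) + ennreal D * ennreal (A w powr s)"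
        using DE by (simp flip: ennreal_mult ennreal_plus)
      finally show ?thesis .
    qed simp
  qed
  also have "\<dots> = ennreal E * moment A (s - q) + ennreal D * moment A s"
    by (subst nn_integral_add) (auto simp: nn_integral_cmult)
  finally have "ennreal c * (\<integral>\<^sup>+w. ennreal (A w powr s) * F (x / A w) \<partial>M)
     \<le> ennreal c * (ennreal E * moment A (s - q) + ennreal D * moment A s)"
    by (intro mult_left_mono) auto
  also have "\<dots> = ennreal E * (ennreal c * moment A (s - q)) + ennreal D * (ennreal c * moment A s)"
    by (simp add: distrib_left ac_simps)
  also have "\<dots> \<le> ennreal E * ennreal \<tau> + ennreal D * ennreal \<theta>"
    by (intro add_mono mult_left_mono q s) auto
  finally have "F x \<le> ennreal E * ennreal \<tau> + ennreal D * ennreal \<theta> + ennreal b"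
    using step[OF Suc.prems] by (meson add_right_mono order_trans)
  also have "\<dots> = ennreal (E * \<tau> + D * \<theta> + b)"
    using DE nonneg by (simp flip: ennreal_mult ennreal_plus)
  also have "E * \<tau> + D * \<theta> + b = \<tau> ^ Suc n * \<epsilon> * x powr q + \<theta> ^ Suc n * K + b / (1 - \<theta>)"
  proof -
    have "b / (1 - \<theta>) * \<theta> + b = b / (1 - \<theta>)" using nonneg by (simp add: field_simps)
    then show ?thesis by (simp add: D_def E_def algebra_simps)
  qed
  finally show ?case .
qed

text \<open>Finite before any moment of \<open>R\<close> is known, and compatible with scaling:
  truncating \<open>A * R\<close> at \<open>x\<close> means truncating \<open>R\<close> at
  \<open>x / A\<close>.\<close>

definition truncated_moment :: "real \<Rightarrow> real \<Rightarrow> ennreal" where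
  "truncated_moment s x = (\<integral>\<^sup>+w. ennreal (min \<bar>R w\<bar> x powr s) \<partial>M)"

lemma truncated_moment_step:
  assumes "s > 0" "c \<ge> 0" "k \<ge> 0"
    and ineq: "\<And>a b x. a \<ge> 0 \<Longrightarrow> b \<ge> 0 \<Longrightarrow> x > 0 \<Longrightarrow> min (a + b) x powr s \<le> c * min a x powr s + k * b powr s"
    and x: "x > 0"
  shows "truncated_moment s x \<le> ennreal c * (\<integral>\<^sup>+w. ennreal (A w powr s) * truncated_moment s (x / A w) \<partial>M)
     + ennreal k * abs_moment B s"
proof -
  have "truncated_moment s x = (\<integral>\<^sup>+w. ennreal (min \<bar>A w * R w + B w\<bar> x powr s) \<partial>M)"
    unfolding truncated_moment_def by (rule stationary_nn_integral) measurable
  also have "\<dots> \<le> (\<integral>\<^sup>+w. ennreal c * ennreal (min (A w * \<bar>R w\<bar>) x powr s) + ennreal k * ennreal (\<bar>B w\<bar> powr s) \<partial>M)"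
  proof (intro nn_integral_mono)
    fix w
    have "min \<bar>A w * R w + B w\<bar> x powr s \<le> min (A w * \<bar>R w\<bar> + \<bar>B w\<bar>) x powr s"
      using assms A_nonneg[of w] abs_triangle_ineq[of "A w * R w" "B w"]
      by (intro powr_mono2 min.mono) (auto simp: abs_mult)
    also have "\<dots> \<le> c * min (A w * \<bar>R w\<bar>) x powr s + k * \<bar>B w\<bar> powr s"
      using A_nonneg[of w] x by (intro ineq) auto
    finally show "ennreal (min \<bar>A w * R w + B w\<bar> x powr s) \<le> ennreal c * ennreal (min (A w * \<bar>R w\<bar>) x powr s) + ennreal k * ennreal (\<bar>B w\<bar> powr s)"
      using assms by (simp add: ennreal_leI flip: ennreal_mult ennreal_plus)
  qed
  also have "\<dots> = ennreal c * (\<integral>\<^sup>+w. ennreal (min (A w * \<bar>R w\<bar>) x powr s) \<partial>M) + ennreal k * abs_moment B s"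
    by (subst nn_integral_add) (auto simp: nn_integral_cmult)
  also have "(\<integral>\<^sup>+w. ennreal (min (A w * \<bar>R w\<bar>) x powr s) \<partial>M)
     = (\<integral>\<^sup>+w. (\<integral>\<^sup>+v. ennreal (min (A w * \<bar>R v\<bar>) x powr s) \<partial>M) \<partial>M)"
    by (rule independent'[where f = "\<lambda>r a b. ennreal (min (a * \<bar>r\<bar>) x powr s)"]) measurable
  also have "\<dots> = (\<integral>\<^sup>+w. ennreal (A w powr s) * truncated_moment s (x / A w) \<partial>M)"
  proof (intro nn_integral_cong)
    fix w
    have "min (A w * \<bar>R v\<bar>) x powr s = A w powr s * min \<bar>R v\<bar> (x / A w) powr s" for v
    proof (cases "A w = 0")
      case False
      then have a: "A w > 0" using A_nonneg[of w] by simp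
      then have "min (A w * \<bar>R v\<bar>) x = A w * min \<bar>R v\<bar> (x / A w)" by (simp add: min_mult_distrib_left)
      then show ?thesis using a x by (simp add: powr_mult)
    qed (use x in auto)
    then show "(\<integral>\<^sup>+v. ennreal (min (A w * \<bar>R v\<bar>) x powr s) \<partial>M) = ennreal (A w powr s) * truncated_moment s (x / A w)"
      unfolding truncated_moment_def by (simp add: ennreal_mult nn_integral_cmult)
  qed
  finally show ?thesis .
qed

lemma moment_from_truncated:
  assumes "s > 0" "\<And>x. x > 0 \<Longrightarrow> truncated_moment s x \<le> ennreal b"
  shows "abs_moment R s < \<infinity>"
proof -
  have "abs_moment R s \<le> (\<integral>\<^sup>+w. (SUP n. ennreal (min \<bar>R w\<bar> (real (Suc n)) powr s)) \<partial>M)"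
  proof (intro nn_integral_mono)
    fix w
    obtain n :: nat where "\<bar>R w\<bar> \<le> real n" using real_arch_simple by blast
    then show "ennreal (\<bar>R w\<bar> powr s) \<le> (SUP n. ennreal (min \<bar>R w\<bar> (real (Suc n)) powr s))"
      by (intro SUP_upper2[where i = n]) (auto simp: min_def)
  qed
  also have "\<dots> = (SUP n. truncated_moment s (real (Suc n)))"
    unfolding truncated_moment_def using assms
    by (intro nn_integral_monotone_convergence_SUP)
       (auto simp: incseq_def le_fun_def intro!: ennreal_leI powr_mono2)
  also have "\<dots> \<le> ennreal b" by (intro SUP_least assms) auto
  also have "\<dots> < \<infinity>" by simp
  finally show ?thesis .
qed

text \<open>Subadditivity allows \<open>c = 1\<close>. The iteration runs with \<open>q = s\<close>,
  where the growing term is not contracted (\<open>\<tau> = 1\<close>), but tightness of the law of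
  \<open>R\<close> makes its coefficient \<epsilon> as small as a fixed \<open>x\<close>
  requires.\<close>

lemma R_moment_small:
  assumes "0 < s" "s < \<alpha>" "s \<le> 1"
  shows "abs_moment R s < \<infinity>"
proof -
  define b where "b = enn2real (abs_moment B s)"
  have b: "b \<ge> 0" "abs_moment B s = ennreal b"
    using B_moment[OF assms(1,2)] by (auto simp: b_def)
  obtain \<theta> where theta: "0 \<le> \<theta>" "moment A s = ennreal \<theta>" "\<theta> < 1"
    using A_moment_real[OF assms(1,2)] by blast
  have step: "truncated_moment s x \<le> ennreal 1 * (\<integral>\<^sup>+w. ennreal (A w powr s) * truncated_moment s (x / A w) \<partial>M) + ennreal b"
    if "x > 0" for x
    using truncated_moment_step[of s 1 1 x] truncated_powr_add_le'[of _ _ s] assms that b by simp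
  show ?thesis
  proof (rule moment_from_truncated[OF assms(1)])
    fix x :: real assume x: "x > 0"
    have eps_bound: "truncated_moment s x \<le> ennreal (b / (1 - \<theta>)) + ennreal \<delta>" if \<delta>: "\<delta> > 0" for \<delta> :: real
    proof -
      \<comment> \<open>At the fixed \<open>x\<close> the growing term becomes exactly
        \<open>\<delta> / 2\<close>, leaving \<open>\<delta> / 2\<close> for the decaying term
        \<open>\<theta> ^ m * K\<close>.\<close>
      define \<epsilon> where "\<epsilon> = \<delta> / (2 * x powr s)"
      have eps: "\<epsilon> > 0" using \<delta> x by (simp add: \<epsilon>_def)
      have "(\<lambda>n. prob {w \<in> space M. \<bar>R w\<bar> > real n}) \<longlonglongrightarrow> prob (\<Inter>n. {w \<in> space M. \<bar>R w\<bar> > real n})"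
        by (intro finite_Lim_measure_decseq) (auto simp: decseq_def)
      also have "(\<Inter>n. {w \<in> space M. \<bar>R w\<bar> > real n}) = {}"
        using real_arch_simple not_less by auto blast
      finally have "\<forall>\<^sub>F n in sequentially. prob {w \<in> space M. \<bar>R w\<bar> > real n} < \<epsilon>"
        using eps by (auto intro: order_tendstoD)
      then obtain n where n: "prob {w \<in> space M. \<bar>R w\<bar> > real n} < \<epsilon>"
        by (auto simp: eventually_sequentially)
      define K where "K = real n powr s"
      have start: "truncated_moment s y \<le> ennreal (\<epsilon> * y powr s) + ennreal K" if y: "y > 0" for y
      proof -
        have "truncated_moment s y \<le> (\<integral>\<^sup>+w. ennreal (y powr s) * indicator {w \<in> space M. \<bar>R w\<bar> > real n} w + ennreal K \<partial>M)"
          unfolding truncated_moment_def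
        proof (intro nn_integral_mono)
          fix w assume w: "w \<in> space M"
          have "min \<bar>R w\<bar> y powr s \<le> y powr s" using y assms by (intro powr_mono2) auto
          moreover have "min \<bar>R w\<bar> y powr s \<le> K" if "\<bar>R w\<bar> \<le> real n"
            unfolding K_def using that y assms by (intro powr_mono2) auto
          ultimately show "ennreal (min \<bar>R w\<bar> y powr s) \<le> ennreal (y powr s) * indicator {w \<in> space M. \<bar>R w\<bar> > real n} w + ennreal K"
            using w by (auto split: split_indicator intro!: add_increasing2 ennreal_leI)
        qed
        also have "\<dots> = ennreal (y powr s) * emeasure M {w \<in> space M. \<bar>R w\<bar> > real n} + ennreal K"
          by (subst nn_integral_add) (auto simp: emeasure_space_1 nn_integral_cmult_indicator)
        also have "\<dots> = ennreal (y powr s * prob {w \<in> space M. \<bar>R w\<bar> > real n}) + ennreal K"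
          by (simp add: emeasure_eq_measure ennreal_mult)
        also have "\<dots> \<le> ennreal (\<epsilon> * y powr s) + ennreal K"
        proof -
          have "y powr s * prob {w \<in> space M. \<bar>R w\<bar> > real n} \<le> y powr s * \<epsilon>"
            using n by (intro mult_left_mono) auto
          then show ?thesis by (intro add_right_mono ennreal_leI) (simp only: mult.commute)
        qed
        finally show ?thesis .
      qed
      \<comment> \<open>The left side is P(A > 0), because \<open>0 powr 0 = 0\<close>.\<close>
      have one: "moment A (s - s) \<le> 1"
      proof -
        have "moment A (s - s) \<le> (\<integral>\<^sup>+w. 1 \<partial>M)"
          by (intro nn_integral_mono) (auto simp: powr_def)
        then show ?thesis by (simp add: emeasure_space_1)
      qed
      have bound: "truncated_moment s x \<le> ennreal (1 ^ n * \<epsilon> * x powr s + \<theta> ^ n * K + b / (1 - \<theta>))" for n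
      proof (rule truncated_moment_iterate[OF step start])
        show "ennreal 1 * moment A (s - s) \<le> ennreal 1"
          using one by simp
        show "ennreal 1 * moment A s \<le> ennreal \<theta>"
          using theta(2) by simp
        show "0 \<le> K" by (simp add: K_def)
      qed (use x b(1) eps theta(1,3) in simp_all)
      have "\<forall>\<^sub>F n in sequentially. \<theta> ^ n * K < \<delta> / 2"
      proof -
        have "(\<lambda>n. \<theta> ^ n * K) \<longlonglongrightarrow> 0 * K" using theta by (intro tendsto_intros LIMSEQ_power_zero) auto
        then show ?thesis using \<delta> by (intro order_tendstoD) auto
      qed
      then obtain m where m: "\<theta> ^ m * K < \<delta> / 2" by (auto simp: eventually_sequentially)
      have "1 ^ m * \<epsilon> * x powr s = \<delta> / 2" using x by (simp add: \<epsilon>_def)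
      then have "1 ^ m * \<epsilon> * x powr s + \<theta> ^ m * K + b / (1 - \<theta>) \<le> b / (1 - \<theta>) + \<delta>"
        using m by linarith
      then have "truncated_moment s x \<le> ennreal (b / (1 - \<theta>) + \<delta>)"
        by (rule order_trans[OF bound ennreal_leI])
      also have "\<dots> = ennreal (b / (1 - \<theta>)) + ennreal \<delta>"
        using b(1) theta(3) \<delta> by (intro ennreal_plus) auto
      finally show ?thesis .
    qed
    show "truncated_moment s x \<le> ennreal (b / (1 - \<theta>))"
      by (rule ennreal_le_epsilon) (rule eps_bound)
  qed
qed

text \<open>For \<open>s > 1\<close> the start is a moment of small order \<open>p\<close>, which
  bounds the truncated moment by a multiple of \<open>x powr (s - p)\<close>. With
  \<open>q = s - p\<close> that term contracts by the moment of \<open>A\<close> of order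
  \<open>p\<close>, and \<open>m < 1\<close> leaves room for a coefficient
  \<open>c > 1\<close>.\<close>

lemma R_moment:
  assumes "0 < s" "s < \<alpha>"
  shows "abs_moment R s < \<infinity>"
proof (cases "s \<le> 1")
  case True
  then show ?thesis using R_moment_small assms by simp
next
  case False
  define p where "p = 1 / 2 * min 1 s"
  have p: "0 < p" "p < s" "p \<le> 1" "p < \<alpha>" using assms by (auto simp: p_def min_def)
  define \<theta> where "\<theta> r = enn2real (moment A r)" for r
  have theta: "0 \<le> \<theta> r" "moment A r = ennreal (\<theta> r)" "\<theta> r < 1" if "0 < r" "r < \<alpha>" for r
    using A_moment_real[OF that] by (auto simp: \<theta>_def)
  define m where "m = max (\<theta> p) (\<theta> s)"
  have m: "0 \<le> m" "m < 1" "\<theta> p \<le> m" "\<theta> s \<le> m" unfolding m_def using theta(1)[OF p(1,4)] theta(3)[OF p(1,4)] theta(3)[OF assms] by (simp_all add: le_max_iff_disj)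
  have "((\<lambda>t. (1 + t) powr s * m) \<longlongrightarrow> (1 + 0) powr s * m) (at_right 0)"
    by (intro tendsto_intros) auto
  from at_right_0_witness[OF this, of 1] m obtain t where t: "(1 + t) powr s * m < 1" "t > 0" by auto
  define c k \<tau> where "c = (1 + t) powr s" and "k = (1 + 1 / t) powr s" and "\<tau> = c * m"
  have tau: "0 \<le> \<tau>" "\<tau> < 1" "c \<ge> 0" "k \<ge> 0" using t m by (auto simp: \<tau>_def c_def k_def)
  define b where "b = enn2real (ennreal k * abs_moment B s)"
  have b: "b \<ge> 0" "ennreal k * abs_moment B s = ennreal b"
    using B_moment[OF assms] by (auto simp: b_def ennreal_mult_less_top)
  have step: "truncated_moment s x \<le> ennreal c * (\<integral>\<^sup>+w. ennreal (A w powr s) * truncated_moment s (x / A w) \<partial>M) + ennreal b"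
    if "x > 0" for x
    using truncated_moment_step[of s c k x] truncated_powr_add_le[of _ _ s t] assms that t tau
    unfolding b(2)[symmetric] by (simp add: c_def k_def)
  define \<epsilon> where "\<epsilon> = enn2real (abs_moment R p)"
  have eps: "\<epsilon> \<ge> 0" "abs_moment R p = ennreal \<epsilon>"
    using R_moment_small[of p] p by (auto simp: \<epsilon>_def)
  have start: "truncated_moment s x \<le> ennreal (\<epsilon> * x powr (s - p)) + ennreal 0" if x: "x > 0" for x
  proof -
    have "truncated_moment s x \<le> (\<integral>\<^sup>+w. ennreal (x powr (s - p)) * ennreal (\<bar>R w\<bar> powr p) \<partial>M)"
      unfolding truncated_moment_def
    proof (intro nn_integral_mono)
      fix w
      have "min \<bar>R w\<bar> x powr s = min \<bar>R w\<bar> x powr (s - p) * min \<bar>R w\<bar> x powr p" by (simp flip: powr_add)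
      also have "\<dots> \<le> x powr (s - p) * \<bar>R w\<bar> powr p"
        using p x by (intro mult_mono powr_mono2) auto
      finally show "ennreal (min \<bar>R w\<bar> x powr s) \<le> ennreal (x powr (s - p)) * ennreal (\<bar>R w\<bar> powr p)"
        by (simp add: ennreal_leI flip: ennreal_mult)
    qed
    also have "\<dots> = ennreal (\<epsilon> * x powr (s - p))"
      by (subst nn_integral_cmult) (auto simp: eps ennreal_mult mult.commute)
    finally show ?thesis by simp
  qed
  show ?thesis
  proof (rule moment_from_truncated[OF assms(1)])
    fix x :: real assume x: "x > 0"
    have bound: "truncated_moment s x \<le> ennreal (\<tau> ^ n * \<epsilon> * x powr (s - p) + \<tau> ^ n * 0 + b / (1 - \<tau>))" for n
    proof (rule truncated_moment_iterate[OF step start])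
      show "ennreal c * moment A (s - (s - p)) \<le> ennreal \<tau>"
        using theta(1,2)[of p] p m tau by (simp add: \<tau>_def ennreal_leI mult_left_mono flip: ennreal_mult)
      show "ennreal c * moment A s \<le> ennreal \<tau>"
        using theta(1,2)[of s] assms m tau by (simp add: \<tau>_def ennreal_leI mult_left_mono flip: ennreal_mult)
    qed (use x b eps tau in auto)
    have "(\<lambda>n. \<tau> ^ n * \<epsilon> * x powr (s - p) + b / (1 - \<tau>)) \<longlonglongrightarrow> 0 * \<epsilon> * x powr (s - p) + b / (1 - \<tau>)"
      using tau by (intro tendsto_intros LIMSEQ_power_zero) auto
    then have "(\<lambda>n. ennreal (\<tau> ^ n * \<epsilon> * x powr (s - p) + b / (1 - \<tau>))) \<longlonglongrightarrow> ennreal (b / (1 - \<tau>))"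
      by (intro tendsto_ennrealI) auto
    then show "truncated_moment s x \<le> ennreal (b / (1 - \<tau>))"
      using bound by (intro LIMSEQ_le_const) auto
  qed
qed

end

section \<open>The renewal inequalities and their error terms\<close>

text \<open>The event that \<open>a\<close> exceeds the level by at most \<open>m\<close> is traded
  for a bound in which \<open>a\<close> enters only through \<open>exp u < a\<close>. With
  \<open>a = A * R\<close> and \<open>m\<close> the negative part of \<open>B\<close>, independence
  then yields the tail of \<open>R\<close> instead of a difference of two tails.\<close>

lemma (in drift_walk) log_integral_deficit:
  assumes "\<alpha> > 0" "m \<ge> 0" "a > 0"
  shows "(\<integral>\<^sup>+u. (if v \<le> u \<and> a - m \<le> exp u \<and> exp u < a then ennreal (exp (\<alpha> * u)) * barrier (w - u) else 0) \<partial>lborel)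
    \<le> ennreal (2 + 4 * exp (\<beta> * ln 2) * exp (\<alpha> / 2)) *
      (\<integral>\<^sup>+u. (if v - 1 \<le> u \<and> exp u < a then ennreal (min 1 (m * exp (- u)) * exp (\<alpha> * u)) * barrier (w - u) else 0) \<partial>lborel)"
    (is "(\<integral>\<^sup>+u. ?f u \<partial>lborel) \<le> ennreal (2 + ?c) * (\<integral>\<^sup>+u. ?g u \<partial>lborel)")
proof -
  let ?L = "\<integral>\<^sup>+u. ?f u \<partial>lborel" and ?R = "\<integral>\<^sup>+u. ?g u \<partial>lborel"
  let ?z = "m / a * (a powr \<alpha> * exp (- (\<alpha> / 2)))"
  show ?thesis
  proof (cases "a / 2 \<le> m")
    \<comment> \<open>Here the weight \<open>min 1 (m * exp (- u))\<close> is at least 1/2 wherever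
      \<open>exp u < a\<close>.\<close>
    case True
    have "?L \<le> (\<integral>\<^sup>+u. ennreal 2 * ?g u \<partial>lborel)"
    proof (intro nn_integral_mono)
      fix u
      have "ennreal (exp (\<alpha> * u)) \<le> ennreal 2 * ennreal (min 1 (m * exp (- u)) * exp (\<alpha> * u))" if "exp u < a"
      proof -
        have "exp u / 2 \<le> m" using that True by simp
        then have "m * exp (- u) \<ge> 1 / 2" by (simp add: exp_minus field_simps)
        then have "1 * exp (\<alpha> * u) \<le> 2 * min 1 (m * exp (- u)) * exp (\<alpha> * u)"
          by (intro mult_right_mono) auto
        then have "ennreal (exp (\<alpha> * u)) \<le> ennreal (2 * (min 1 (m * exp (- u)) * exp (\<alpha> * u)))"
          by (intro ennreal_leI) (simp add: mult.assoc)
        then show ?thesis by (subst (asm) ennreal_mult') auto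
      qed
      from mult_right_mono[OF this, of "barrier (w - u)"]
      show "?f u
        \<le> ennreal 2 * ?g u"
        by (auto simp: mult.assoc)
    qed
    also have "\<dots> = ennreal 2 * ?R" by (intro nn_integral_cmult) measurable
    also have "\<dots> \<le> ennreal (2 + ?c) * ?R"
      by (intro mult_right_mono ennreal_leI) auto
    finally show ?thesis .
  next
    case False
    have lna: "exp u < a \<longleftrightarrow> u < ln a" for u
      using exp_less_cancel_iff[of u "ln a"] assms by simp
    show ?thesis
    proof (cases "v < ln a")
      case v: False
      then have "?f u = 0" for u
        using lna[of u] by auto
      then show ?thesis by simp
    next
      case v: True
      define G where "G = barrier (w - ln a)"
      have expa: "a powr \<alpha> = exp (\<alpha> * ln a)" using assms by (simp add: powr_def)
      have "?L \<le> (\<integral>\<^sup>+u. (if a - m \<le> exp u \<and> exp u < a then ennreal (exp (\<alpha> * u)) * barrier (w - u) else 0) \<partial>lborel)"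
        by (intro nn_integral_mono) auto
      also have "\<dots> \<le> (ennreal (a powr \<alpha>) * (ennreal (exp (\<beta> * ln 2)) * G)) * ennreal ((a - (a - m)) / (a - m))"
      proof (rule nn_integral_log_interval_le)
        fix u assume u: "a - m \<le> exp u" "exp u < a"
        have "exp (ln a - ln 2) \<le> exp u" using u False assms by (simp add: exp_diff)
        then have "ln a - ln 2 \<le> u" by simp
        then have "barrier (w - u) \<le> barrier (w - ln a + ln 2)" by (intro barrier_mono) auto
        also have "\<dots> \<le> ennreal (exp (\<beta> * ln 2)) * G"
          unfolding G_def by (intro barrier_shift) auto
        finally have 1: "barrier (w - u) \<le> ennreal (exp (\<beta> * ln 2)) * G" .
        have "exp (\<alpha> * u) \<le> a powr \<alpha>" using u lna[of u] assms by (simp add: expa)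
        then show "ennreal (exp (\<alpha> * u)) * barrier (w - u) \<le> ennreal (a powr \<alpha>) * (ennreal (exp (\<beta> * ln 2)) * G)"
          by (intro mult_mono 1 ennreal_leI) auto
      qed (use False assms in auto)
      also have "(a - (a - m)) / (a - m) \<le> 2 * m / a"
        using False assms by (simp add: field_simps) (metis mult_left_mono less_imp_le not_le mult.commute mult.left_commute)
      then have "(ennreal (a powr \<alpha>) * (ennreal (exp (\<beta> * ln 2)) * G)) * ennreal ((a - (a - m)) / (a - m))
         \<le> (ennreal (a powr \<alpha>) * (ennreal (exp (\<beta> * ln 2)) * G)) * ennreal (2 * m / a)"
        by (intro mult_left_mono ennreal_leI) auto
      also have "\<dots> = ennreal (a powr \<alpha> * exp (\<beta> * ln 2) * (2 * m / a)) * G"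
      proof -
        have "ennreal p * (ennreal q * G) * ennreal r = ennreal (p * q * r) * G" if "p \<ge> 0" "q \<ge> 0" "r \<ge> 0" for p q r
          using that by (simp add: ennreal_mult ac_simps)
        then show ?thesis using assms by simp
      qed
      \<comment> \<open>\<open>?z * G\<close> bounds the right-hand integrand on the half unit
        before \<open>ln a\<close>, which lies above \<open>v - 1\<close>. The 4 is the 2 of the
        logarithmic length \<open>2 * m / a\<close> divided by that length 1/2.\<close>
      also have "a powr \<alpha> * exp (\<beta> * ln 2) * (2 * m / a) = ?c * (?z * (1 / 2))"
        by (simp add: exp_minus field_simps)
      also have "ennreal (?c * (?z * (1 / 2))) * G
         = ennreal ?c * (ennreal (?z) * G * ennreal (1 / 2))"
      proof -
        have *: "ennreal (p * (q * r)) * G = ennreal p * (ennreal q * G * ennreal r)" if "p \<ge> 0" "q \<ge> 0" "r \<ge> 0" for p q r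
          using that by (simp add: ennreal_mult ac_simps)
        show ?thesis by (rule *) (use assms in auto)
      qed
      also have "ennreal (?z) * G * ennreal (1 / 2)
         = (\<integral>\<^sup>+u. ennreal (?z) * G * indicator {ln a - 1/2..<ln a} u \<partial>lborel)"
        by (subst nn_integral_cmult_indicator) auto
      also have "\<dots> \<le> ?R"
      proof (intro nn_integral_mono)
        fix u
        have "ennreal (?z) * G
            \<le> ennreal (min 1 (m * exp (- u)) * exp (\<alpha> * u)) * barrier (w - u)" if u: "u \<in> {ln a - 1/2..<ln a}"
        proof (rule mult_mono)
          have "exp (- ln a) \<le> exp (- u)" using u by simp
          then have "1 / a \<le> exp (- u)" using assms by (simp add: exp_minus divide_inverse)
          then have "m * (1 / a) \<le> m * exp (- u)" using assms by (intro mult_left_mono) auto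
          moreover have "m / a \<le> 1" using False assms by simp
          ultimately have 1: "m / a \<le> min 1 (m * exp (- u))" by simp
          have "\<alpha> * (ln a - 1/2) \<le> \<alpha> * u" using u assms by (intro mult_left_mono) auto
          then have "exp (\<alpha> * ln a - \<alpha> / 2) \<le> exp (\<alpha> * u)" by (simp add: algebra_simps)
          then have 2: "a powr \<alpha> * exp (- (\<alpha> / 2)) \<le> exp (\<alpha> * u)" by (simp add: expa flip: exp_add)
          show "ennreal (?z) \<le> ennreal (min 1 (m * exp (- u)) * exp (\<alpha> * u))"
            using 1 2 assms by (intro ennreal_leI mult_mono) auto
          show "G \<le> barrier (w - u)" unfolding G_def using u by (intro barrier_mono) auto
        qed auto
        then show "ennreal (?z) * G * indicator {ln a - 1/2..<ln a} u
           \<le> ?g u"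
          using v by (auto simp: lna split: split_indicator)
      qed
      finally have "?L \<le> ennreal ?c * ?R" by (simp add: mult_left_mono)
      also have "\<dots> \<le> ennreal (2 + ?c) * ?R" by (intro mult_right_mono ennreal_leI) auto
      finally show ?thesis .
    qed
  qed
qed

lemma nn_integral_min_exp:
  fixes m :: real
  assumes "m \<ge> 0"
  shows "(\<integral>\<^sup>+s. ennreal (min 1 (m * exp (- s))) * indicator {0..} s \<partial>lborel) \<le> ennreal (1 + max 0 (ln m))"
proof -
  define v where "v = max 0 (ln m)"
  have v0: "v \<ge> 0" by (simp add: v_def)
  have mv: "m * exp (- v) \<le> 1"
  proof (cases "m > 1")
    case True
    then show ?thesis by (simp add: v_def exp_minus)
  next
    case False
    then have "ln m \<le> 0" using assms by (cases "m = 0") auto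
    then show ?thesis using False by (simp add: v_def)
  qed
  have "(\<integral>\<^sup>+s. ennreal (min 1 (m * exp (- s))) * indicator {0..} s \<partial>lborel)
     \<le> (\<integral>\<^sup>+s. indicator {0..v} s + ennreal m * (ennreal (exp (- 1 * s)) * indicator {v..} s) \<partial>lborel)"
  proof (intro nn_integral_mono)
    fix s
    show "ennreal (min 1 (m * exp (- s))) * indicator {0..} s
       \<le> indicator {0..v} s + ennreal m * (ennreal (exp (- 1 * s)) * indicator {v..} s)"
    proof (cases "s \<le> v")
      case True
      then show ?thesis by (auto split: split_indicator intro!: add_increasing2 simp: ennreal_le_1)
    next
      case False
      then show ?thesis using assms
        by (auto split: split_indicator intro!: ennreal_leI simp flip: ennreal_mult)
    qed
  qed
  also have "\<dots> = ennreal v + ennreal m * ennreal (exp (- v))"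
    using nn_integral_exp_atLeast[of 1 v] by (subst nn_integral_add) (auto simp: nn_integral_cmult v_def)
  also have "\<dots> = ennreal (v + m * exp (- v))"
    using v0 assms by (simp flip: ennreal_mult ennreal_plus)
  also have "\<dots> \<le> ennreal (1 + v)"
    using mv by (intro ennreal_leI) simp
  finally show ?thesis by (simp add: v_def)
qed

section \<open>Tilted law and the fixed point equation in logarithmic scale\<close>

context perpetuity
begin

text \<open>The value \<open>ln 0 = 0\<close> is harmless, because the density vanishes where
  \<open>A = 0\<close>.\<close>

definition tilt :: "real measure" where
  "tilt = distr (density M (\<lambda>w. ennreal (A w powr \<alpha>))) borel (\<lambda>w. ln (A w))"

definition drift :: real where
  "drift = expectation (\<lambda>w. A w powr \<alpha> * ln (A w))"

definition contraction :: real where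
  "contraction = enn2real (moment A (\<alpha> / 2))"

lemma sets_tilt [measurable_cong]: "sets tilt = sets borel"
  by (simp add: tilt_def)

lemma nn_integral_tilt:
  assumes [measurable]: "f \<in> borel_measurable borel"
  shows "(\<integral>\<^sup>+x. f x \<partial>tilt) = (\<integral>\<^sup>+w. ennreal (A w powr \<alpha>) * f (ln (A w)) \<partial>M)"
  unfolding tilt_def by (simp add: nn_integral_distr nn_integral_density)

lemma prob_space_tilt: "prob_space tilt"
proof (rule prob_spaceI)
  have "(\<integral>\<^sup>+x. 1 \<partial>tilt) = 1" by (subst nn_integral_tilt) (simp_all add: A_moment)
  then show "emeasure tilt (space tilt) = 1" by simp
qed

sublocale tilted: slow_renewal tilt drift "\<alpha> / 2" contraction "tail B" \<alpha>
proof (intro slow_renewal.intro drift_walk.intro prob_space_tilt drift_walk_axioms.intro slow_tail_axioms)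
  show "sets tilt = sets borel" by (rule sets_tilt)
  show "integrable tilt (\<lambda>x. x)"
    unfolding tilt_def by (subst integrable_distr_eq) (auto simp: integrable_real_density A_log_moment)
  show "(\<integral>x. x \<partial>tilt) = drift"
    unfolding tilt_def drift_def by (simp add: integral_distr integral_real_density)
  show "0 < \<alpha> / 2" using alpha by simp
  have half: "0 < \<alpha> / 2" "\<alpha> / 2 < \<alpha>" using alpha by auto
  obtain \<theta> where t: "0 \<le> \<theta>" "\<theta> < 1" "moment A (\<alpha> / 2) = ennreal \<theta>"
    using A_moment_real[OF half] by blast
  then have c: "contraction = \<theta>" by (simp add: contraction_def)
  show "0 \<le> contraction" "contraction < 1" using t c by auto
  have "(\<integral>\<^sup>+x. ennreal (exp (- (\<alpha> / 2) * x)) \<partial>tilt) = moment A (\<alpha> / 2)"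
  proof (subst nn_integral_tilt, measurable, intro nn_integral_cong)
    fix w
    have "A w powr \<alpha> * exp (- (\<alpha> / 2) * ln (A w)) = A w powr (\<alpha> / 2)"
      by (cases "A w = 0") (auto simp: powr_def simp flip: exp_add)
    then show "ennreal (A w powr \<alpha>) * ennreal (exp (- (\<alpha> / 2) * ln (A w))) = ennreal (A w powr (\<alpha> / 2))"
      by (simp flip: ennreal_mult)
  qed
  then show "(\<integral>\<^sup>+x. ennreal (exp (- (\<alpha> / 2) * x)) \<partial>tilt) = ennreal contraction" using t c by simp
qed

lemma step_eq:
  assumes [measurable]: "f \<in> borel_measurable borel"
  shows "tilted.step f u = (\<integral>\<^sup>+w. ennreal (A w powr \<alpha>) * f (u - ln (A w)) \<partial>M)"
  unfolding tilted.step_def by (subst nn_integral_tilt) auto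

lemma measurable_tail [measurable]:
  "X \<in> borel_measurable M \<Longrightarrow> tail X \<in> borel_measurable borel"
  using tail_growth by (rule measurable_exp_growth)

lemma scaled_tail:
  assumes "A w > 0"
  shows "ennreal (A w powr \<alpha>) * ennreal (tail R (u - ln (A w)))
     = (\<integral>\<^sup>+v. weight u (exp u < A w * R v) \<partial>M)"
proof -
  have "ennreal (A w powr \<alpha>) * ennreal (tail R (u - ln (A w)))
     = (\<integral>\<^sup>+v. ennreal (A w powr \<alpha>) * (if exp (u - ln (A w)) < R v then ennreal (exp (\<alpha> * (u - ln (A w)))) else 0) \<partial>M)"
    by (subst nn_integral_cmult) (auto simp: tail_eq_nn_integral)
  also have "\<dots> = (\<integral>\<^sup>+v. weight u (exp u < A w * R v) \<partial>M)"
  proof (intro nn_integral_cong)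
    fix v
    have "exp (u - ln (A w)) < R v \<longleftrightarrow> exp u < A w * R v"
      using assms by (simp add: exp_diff field_simps)
    moreover have "A w powr \<alpha> * exp (\<alpha> * (u - ln (A w))) = exp (\<alpha> * u)"
      using assms by (simp add: powr_def algebra_simps flip: exp_add)
    ultimately show "ennreal (A w powr \<alpha>) * (if exp (u - ln (A w)) < R v then ennreal (exp (\<alpha> * (u - ln (A w)))) else 0)
       = weight u (exp u < A w * R v)"
      by (auto simp flip: ennreal_mult)
  qed
  finally show ?thesis .
qed

text \<open>The reason for tilting: given \<open>A\<close>, the product
  \<open>A powr \<alpha> * tail R (u - ln A)\<close> is \<open>exp (\<alpha> * u)\<close> times the
  probability of \<open>A * R > exp u\<close>, so \<open>step\<close> turns the tail of
  \<open>R\<close> into the tail of \<open>A * R\<close>.\<close>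

lemma step_tail:
  "tilted.step (\<lambda>s. ennreal (tail R s)) u = (\<integral>\<^sup>+w. weight u (exp u < A w * R w) \<partial>M)"
proof -
  have "tilted.step (\<lambda>s. ennreal (tail R s)) u
      = (\<integral>\<^sup>+w. (\<integral>\<^sup>+v. weight u (exp u < A w * R v) \<partial>M) \<partial>M)"
  proof (subst step_eq, measurable, intro nn_integral_cong)
    fix w
    show "ennreal (A w powr \<alpha>) * ennreal (tail R (u - ln (A w)))
       = (\<integral>\<^sup>+v. weight u (exp u < A w * R v) \<partial>M)"
      using scaled_tail[of w u] A_nonneg[of w] by (cases "A w = 0") auto
  qed
  also have "\<dots> = (\<integral>\<^sup>+w. weight u (exp u < A w * R w) \<partial>M)"
    by (rule independent'[where f = "\<lambda>r a b. if exp u < a * r then ennreal (exp (\<alpha> * u)) else 0", symmetric]) measurable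
  finally show ?thesis .
qed

lemma tail_R_eq:
  "ennreal (tail R u) = (\<integral>\<^sup>+w. weight u (exp u < A w * R w + B w) \<partial>M)"
  unfolding tail_eq_nn_integral[OF measurable_R]
  by (rule stationary_nn_integral[where f = "\<lambda>r. if exp u < r then ennreal (exp (\<alpha> * u)) else 0"]) measurable

lemma product_moment:
  assumes "abs_moment R p < \<infinity>"
    and "(\<integral>\<^sup>+w. ennreal (A w powr p * max (B w) 0 powr q) \<partial>M) < \<infinity>"
  shows "(\<integral>\<^sup>+w. ennreal (\<bar>A w * R w\<bar> powr p * max (B w) 0 powr q) \<partial>M) < \<infinity>"
proof -
  have "(\<integral>\<^sup>+w. ennreal (\<bar>A w * R w\<bar> powr p * max (B w) 0 powr q) \<partial>M)
     = (\<integral>\<^sup>+w. (\<integral>\<^sup>+v. ennreal (\<bar>A w * R v\<bar> powr p * max (B w) 0 powr q) \<partial>M) \<partial>M)"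
    by (rule independent'[where f = "\<lambda>r a b. ennreal (\<bar>a * r\<bar> powr p * max b 0 powr q)"]) measurable
  also have "\<dots> = (\<integral>\<^sup>+w. ennreal (A w powr p * max (B w) 0 powr q) * (\<integral>\<^sup>+v. ennreal (\<bar>R v\<bar> powr p) \<partial>M) \<partial>M)"
  proof (intro nn_integral_cong)
    fix w
    have "(\<integral>\<^sup>+v. ennreal (\<bar>A w * R v\<bar> powr p * max (B w) 0 powr q) \<partial>M)
       = (\<integral>\<^sup>+v. ennreal (A w powr p * max (B w) 0 powr q) * ennreal (\<bar>R v\<bar> powr p) \<partial>M)"
      using A_nonneg[of w]
      by (intro nn_integral_cong) (simp add: abs_mult powr_mult ac_simps flip: ennreal_mult)
    then show "(\<integral>\<^sup>+v. ennreal (\<bar>A w * R v\<bar> powr p * max (B w) 0 powr q) \<partial>M)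
       = ennreal (A w powr p * max (B w) 0 powr q) * (\<integral>\<^sup>+v. ennreal (\<bar>R v\<bar> powr p) \<partial>M)"
      by (simp add: nn_integral_cmult)
  qed
  also have "\<dots> = (\<integral>\<^sup>+w. ennreal (A w powr p * max (B w) 0 powr q) \<partial>M) * (\<integral>\<^sup>+v. ennreal (\<bar>R v\<bar> powr p) \<partial>M)"
    by (intro nn_integral_multc) measurable
  also have "\<dots> < \<infinity>" using assms by (simp add: ennreal_mult_less_top)
  finally show ?thesis .
qed

text \<open>At most 1, as \<open>log_integral_sum_over_max\<close> requires of its exponents, and at
  most \<open>\<alpha> - \<eta>\<close>, as \<open>interpolate_powr\<close> requires.\<close>

definition \<sigma> :: real where "\<sigma> = min 1 (\<alpha> - \<eta>)"

lemma sigma: "0 < \<sigma>" "\<sigma> \<le> 1" "\<sigma> \<le> \<alpha> - \<eta>" "\<sigma> < \<alpha>"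
  using eta by (auto simp: \<sigma>_def)

lemma product_moments:
  shows "(\<integral>\<^sup>+w. ennreal (\<bar>A w * R w\<bar> powr \<eta> * max (B w) 0 powr (\<alpha> - \<eta>)) \<partial>M) < \<infinity>"
    and "(\<integral>\<^sup>+w. ennreal (\<bar>A w * R w\<bar> powr (\<alpha> - \<sigma>) * max (B w) 0 powr \<sigma>) \<partial>M) < \<infinity>"
proof -
  show "(\<integral>\<^sup>+w. ennreal (\<bar>A w * R w\<bar> powr \<eta> * max (B w) 0 powr (\<alpha> - \<eta>)) \<partial>M) < \<infinity>"
    using eta by (intro product_moment R_moment AB_moment) auto
  have "(\<integral>\<^sup>+w. ennreal (A w powr (\<alpha> - \<sigma>) * max (B w) 0 powr \<sigma>) \<partial>M)
     \<le> (\<integral>\<^sup>+w. ennreal (A w powr \<alpha>) + ennreal (A w powr \<eta> * max (B w) 0 powr (\<alpha> - \<eta>)) \<partial>M)"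
    using sigma eta A_nonneg
    by (intro nn_integral_mono) (auto intro!: ennreal_leI interpolate_powr simp flip: ennreal_plus)
  also have "\<dots> < \<infinity>"
    using AB_moment by (subst nn_integral_add) (auto simp: A_moment)
  finally show "(\<integral>\<^sup>+w. ennreal (\<bar>A w * R w\<bar> powr (\<alpha> - \<sigma>) * max (B w) 0 powr \<sigma>) \<partial>M) < \<infinity>"
    using sigma by (intro product_moment R_moment) auto
qed

section \<open>Error terms in the fixed point equation\<close>

definition both_needed :: "real \<Rightarrow> ennreal" where
  "both_needed u = (\<integral>\<^sup>+w. weight u (0 < A w * R w \<and> 0 < B w \<and> max (A w * R w) (B w) \<le> exp u \<and> exp u < A w * R w + B w) \<partial>M)"

definition both_large :: "real \<Rightarrow> ennreal" where
  "both_large u = (\<integral>\<^sup>+w. weight u (exp u < A w * R w \<and> exp u < B w) \<partial>M)"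

definition B_compensated :: "real \<Rightarrow> ennreal" where
  "B_compensated u = (\<integral>\<^sup>+w. weight u (A w * R w + B w \<le> exp u \<and> exp u < B w) \<partial>M)"

text \<open>A negative \<open>B\<close> pulls \<open>A * R\<close> back below the level. No
  integrability over \<open>u\<close> is claimed for this error; its convolution with
  \<open>barrier\<close> is bounded separately.\<close>

definition AR_compensated :: "real \<Rightarrow> ennreal" where
  "AR_compensated u = (\<integral>\<^sup>+w. weight u (B w \<le> 0 \<and> A w * R w + B w \<le> exp u \<and> exp u < A w * R w) \<partial>M)"

lemma measurable_errors [measurable]:
  "both_needed \<in> borel_measurable borel" "both_large \<in> borel_measurable borel"
  "B_compensated \<in> borel_measurable borel" "AR_compensated \<in> borel_measurable borel"
  unfolding both_needed_def both_large_def B_compensated_def AR_compensated_def by measurable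

lemma tail_R_le: "ennreal (tail R u) \<le> tilted.step (\<lambda>s. ennreal (tail R s)) u + ennreal (tail B u) + both_needed u"
proof -
  have "ennreal (tail R u) \<le> (\<integral>\<^sup>+w. weight u (exp u < A w * R w)
      + weight u (exp u < B w)
      + weight u (0 < A w * R w \<and> 0 < B w \<and> max (A w * R w) (B w) \<le> exp u \<and> exp u < A w * R w + B w) \<partial>M)"
    unfolding tail_R_eq
  proof (intro nn_integral_mono)
    fix w
    show "weight u (exp u < A w * R w + B w)
       \<le> weight u (exp u < A w * R w)
      + weight u (exp u < B w)
      + weight u (0 < A w * R w \<and> 0 < B w \<and> max (A w * R w) (B w) \<le> exp u \<and> exp u < A w * R w + B w)"
      using exp_gt_zero[of u] by (auto simp: add_increasing add_increasing2 not_less)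
  qed
  also have "\<dots> = tilted.step (\<lambda>s. ennreal (tail R s)) u + ennreal (tail B u) + both_needed u"
    unfolding step_tail tail_eq_nn_integral[OF measurable_B] both_needed_def
    by (simp add: nn_integral_add)
  finally show ?thesis .
qed

text \<open>When both \<open>A * R\<close> and \<open>B\<close> exceed the level so does the sum,
  and \<open>both_large\<close> absorbs the double count; when only one does, either the sum does
  too or the other summand is negative.\<close>

lemma tail_R_ge:
  "tilted.step (\<lambda>s. ennreal (tail R s)) u + ennreal (tail B u)
     \<le> ennreal (tail R u) + (both_large u + B_compensated u + AR_compensated u)"
proof -
  have "tilted.step (\<lambda>s. ennreal (tail R s)) u + ennreal (tail B u)
     = (\<integral>\<^sup>+w. weight u (exp u < A w * R w)
        + weight u (exp u < B w) \<partial>M)"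
    unfolding step_tail tail_eq_nn_integral[OF measurable_B] by (simp add: nn_integral_add)
  also have "\<dots> \<le> (\<integral>\<^sup>+w. weight u (exp u < A w * R w + B w)
      + (weight u (exp u < A w * R w \<and> exp u < B w)
       + weight u (A w * R w + B w \<le> exp u \<and> exp u < B w)
       + weight u (B w \<le> 0 \<and> A w * R w + B w \<le> exp u \<and> exp u < A w * R w)) \<partial>M)"
  proof (intro nn_integral_mono)
    fix w
    show "weight u (exp u < A w * R w)
        + weight u (exp u < B w)
      \<le> weight u (exp u < A w * R w + B w)
      + (weight u (exp u < A w * R w \<and> exp u < B w)
       + weight u (A w * R w + B w \<le> exp u \<and> exp u < B w)
       + weight u (B w \<le> 0 \<and> A w * R w + B w \<le> exp u \<and> exp u < A w * R w))"
      using exp_gt_zero[of u] by (auto simp: add_increasing add_increasing2 not_less)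
  qed
  also have "\<dots> = ennreal (tail R u) + (both_large u + B_compensated u + AR_compensated u)"
    unfolding tail_R_eq both_large_def B_compensated_def AR_compensated_def
    by (simp add: nn_integral_add)
  finally show ?thesis .
qed

lemma log_integral_Fubini:
  assumes [measurable]: "Measurable.pred (borel \<Otimes>\<^sub>M M) (\<lambda>(u, w). P u w)"
    and "\<And>w. (\<integral>\<^sup>+u. weight u (P u w) \<partial>lborel) \<le> f w"
    and "(\<integral>\<^sup>+w. f w \<partial>M) < \<infinity>"
  shows "(\<integral>\<^sup>+u. (\<integral>\<^sup>+w. weight u (P u w) \<partial>M) \<partial>lborel) < \<infinity>"
proof -
  interpret pair_sigma_finite lborel M ..
  have "(\<integral>\<^sup>+u. (\<integral>\<^sup>+w. weight u (P u w) \<partial>M) \<partial>lborel)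
     = (\<integral>\<^sup>+w. (\<integral>\<^sup>+u. weight u (P u w) \<partial>lborel) \<partial>M)"
    by (intro Fubini'[symmetric]) measurable
  also have "\<dots> \<le> (\<integral>\<^sup>+w. f w \<partial>M)" by (intro nn_integral_mono assms)
  also note assms(3)
  finally show ?thesis .
qed

lemma nn_integral_both_needed: "(\<integral>\<^sup>+u. both_needed u \<partial>lborel) < \<infinity>"
  unfolding both_needed_def
proof (rule log_integral_Fubini)
  let ?X = "\<lambda>w. \<bar>A w * R w\<bar> powr (\<alpha> - \<sigma>) * max (B w) 0 powr \<sigma>"
  let ?Y = "\<lambda>w. \<bar>A w * R w\<bar> powr \<eta> * max (B w) 0 powr (\<alpha> - \<eta>)"
  fix w
  show "(\<integral>\<^sup>+u. weight u (0 < A w * R w \<and> 0 < B w \<and> max (A w * R w) (B w) \<le> exp u \<and> exp u < A w * R w + B w) \<partial>lborel) \<le> ennreal (2 powr \<alpha>) * (ennreal (?X w) + ennreal (?Y w))"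
  proof (cases "0 < A w * R w \<and> 0 < B w")
    case True
    then show ?thesis
      using log_integral_sum_over_max[of \<alpha> "A w * R w" "B w" \<sigma> \<eta>] alpha sigma eta
      by (simp add: mult.commute flip: ennreal_plus ennreal_mult)
  qed auto
next
  show "(\<integral>\<^sup>+w. ennreal (2 powr \<alpha>) * (ennreal (\<bar>A w * R w\<bar> powr (\<alpha> - \<sigma>) * max (B w) 0 powr \<sigma>)
      + ennreal (\<bar>A w * R w\<bar> powr \<eta> * max (B w) 0 powr (\<alpha> - \<eta>))) \<partial>M) < \<infinity>"
    using product_moments by (simp add: nn_integral_cmult nn_integral_add ennreal_mult_less_top)
qed measurable

lemma nn_integral_both_large: "(\<integral>\<^sup>+u. both_large u \<partial>lborel) < \<infinity>"
  unfolding both_large_def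
proof (rule log_integral_Fubini)
  show "(\<integral>\<^sup>+u. weight u (exp u < A w * R w \<and> exp u < B w) \<partial>lborel)
     \<le> ennreal (1 / \<alpha>) * ennreal (\<bar>A w * R w\<bar> powr \<eta> * max (B w) 0 powr (\<alpha> - \<eta>))" for w
    using log_integral_min[of \<eta> \<alpha> "A w * R w" "B w"] eta alpha by (simp flip: ennreal_mult)
  show "(\<integral>\<^sup>+w. ennreal (1 / \<alpha>) * ennreal (\<bar>A w * R w\<bar> powr \<eta> * max (B w) 0 powr (\<alpha> - \<eta>)) \<partial>M) < \<infinity>"
    using product_moments by (simp add: nn_integral_cmult ennreal_mult_less_top)
qed measurable

lemma nn_integral_B_compensated: "(\<integral>\<^sup>+u. B_compensated u \<partial>lborel) < \<infinity>"
  unfolding B_compensated_def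
proof (rule log_integral_Fubini)
  fix w
  show "(\<integral>\<^sup>+u. weight u (A w * R w + B w \<le> exp u \<and> exp u < B w) \<partial>lborel)
     \<le> ennreal (2 + 2 / \<alpha>) * ennreal (\<bar>A w * R w\<bar> powr \<eta> * max (B w) 0 powr (\<alpha> - \<eta>))"
  proof (cases "B w > 0")
    case True
    then show ?thesis
      using log_integral_loss[of \<eta> \<alpha> "B w" "A w * R w"] eta alpha
      by (subst ennreal_mult[symmetric]) auto
  next
    case False
    then have "\<not> exp u < B w" for u using exp_gt_zero[of u] by linarith
    then show ?thesis by simp
  qed
next
  show "(\<integral>\<^sup>+w. ennreal (2 + 2 / \<alpha>) * ennreal (\<bar>A w * R w\<bar> powr \<eta> * max (B w) 0 powr (\<alpha> - \<eta>)) \<partial>M) < \<infinity>"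
    using product_moments by (simp add: nn_integral_cmult ennreal_mult_less_top)
qed measurable

end

section \<open>The negative part of B\<close>

context perpetuity
begin

text \<open>Up to constants, the coefficient of \<open>pot\<close> in the bound for
  \<open>AR_compensated\<close>. The powers of \<open>A\<close> come from
  \<open>pot_backward\<close> at \<open>x = ln A\<close>; a large lower limit \<open>v\<close> makes
  the coefficient small and not merely finite.\<close>

definition deficit_tail :: "real \<Rightarrow> ennreal" where
  "deficit_tail v = (\<integral>\<^sup>+w. ennreal (A w powr \<alpha> + A w powr (\<alpha> / 2)) *
     (\<integral>\<^sup>+s. ennreal (min 1 (max (- B w) 0 * exp (- s))) * indicator {v..} s \<partial>lborel) \<partial>M)"

text \<open>A finite drift makes the negative part of \<open>B\<close> harmless: either \<open>B\<^sub>-\<close> is at most \<open>A\<^sup>2\<close>, and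
  \<open>A powr \<alpha> * ln A\<close> is integrable, or \<open>A\<close> is at most the square root of \<open>B\<^sub>-\<close>.\<close>

lemma log_moment_bound:
  fixes a m :: real
  assumes "a \<ge> 0" "m \<ge> 0"
  shows "(a powr \<alpha> + a powr (\<alpha> / 2)) * (1 + max 0 (ln m))
     \<le> 2 * (1 + a powr \<alpha> + 4 * \<bar>a powr \<alpha> * ln a\<bar> + 8 / \<alpha> * m powr (3 * \<alpha> / 4))"
proof -
  define x where "x = a powr \<alpha>"
  have x0: "x \<ge> 0" by (simp add: x_def)
  have half: "a powr (\<alpha> / 2) \<le> 1 + x"
  proof (cases "a \<le> 1")
    case True
    then have "a powr (\<alpha> / 2) \<le> 1 powr (\<alpha> / 2)" using assms alpha by (intro powr_mono2) auto
    then show ?thesis using x0 by simp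
  next
    case False
    then have "a powr (\<alpha> / 2) \<le> x" unfolding x_def using alpha by (intro powr_mono) auto
    then show ?thesis by simp
  qed
  have key: "(1 + x) * max 0 (ln m) \<le> 4 * \<bar>x * ln a\<bar> + 8 / \<alpha> * m powr (3 * \<alpha> / 4)"
  proof (cases "m \<le> 1")
    case True
    then have "ln m \<le> 0" using assms by (cases "m = 0") auto
    then show ?thesis using alpha by (simp add: add_nonneg_nonneg)
  next
    case m: False
    then have lnm: "ln m > 0" by simp
    show ?thesis
    proof (cases "m \<le> a\<^sup>2")
      case True
      then have a1: "a > 1" using m assms by (smt (verit) power_le_one)
      have "ln m \<le> ln (a\<^sup>2)" using m True by (intro ln_mono) auto
      also have "\<dots> = 2 * ln a" using a1 by (simp add: ln_realpow)
      finally have "ln m \<le> 2 * ln a" .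
      moreover have "1 \<le> x" using a1 alpha by (simp add: x_def ge_one_powr_ge_zero)
      ultimately have "(1 + x) * ln m \<le> (2 * x) * (2 * ln a)"
        using lnm by (intro mult_mono) auto
      also have "\<dots> = 4 * \<bar>x * ln a\<bar>" using a1 x0 by simp
      finally show ?thesis using lnm alpha by (simp add: max_def add_increasing2)
    next
      case False
      have "x = (a powr 2) powr (\<alpha> / 2)" by (simp add: x_def powr_powr)
      also have "a powr 2 = a\<^sup>2" using assms by (simp add: powr_numeral)
      also have "(a\<^sup>2) powr (\<alpha> / 2) \<le> m powr (\<alpha> / 2)" using False alpha by (intro powr_mono2) auto
      finally have "x \<le> m powr (\<alpha> / 2)" .
      moreover have "1 \<le> m powr (\<alpha> / 2)" using m alpha by (simp add: ge_one_powr_ge_zero)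
      moreover have "ln m \<le> 4 / \<alpha> * m powr (\<alpha> / 4)"
        using ln_powr_bound[of m "\<alpha> / 4"] m alpha by (simp add: field_simps)
      ultimately have "(1 + x) * ln m \<le> (2 * m powr (\<alpha> / 2)) * (4 / \<alpha> * m powr (\<alpha> / 4))"
        using lnm x0 by (intro mult_mono) auto
      also have "\<dots> = 8 / \<alpha> * (m powr (\<alpha> / 2) * m powr (\<alpha> / 4))" by simp
      also have "m powr (\<alpha> / 2) * m powr (\<alpha> / 4) = m powr (3 * \<alpha> / 4)"
        by (simp flip: powr_add)
      finally show ?thesis using lnm by (simp add: max_def)
    qed
  qed
  have "(x + a powr (\<alpha> / 2)) * (1 + max 0 (ln m)) \<le> (2 * (1 + x)) * (1 + max 0 (ln m))"
    using half x0 by (intro mult_right_mono) auto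
  also have "\<dots> = 2 * (1 + x + (1 + x) * max 0 (ln m))" by (simp add: algebra_simps)
  also have "\<dots> \<le> 2 * (1 + x + (4 * \<bar>x * ln a\<bar> + 8 / \<alpha> * m powr (3 * \<alpha> / 4)))"
    using key by simp
  finally show ?thesis by (simp add: x_def)
qed

lemma deficit_bound_integrable:
  "(\<integral>\<^sup>+w. ennreal ((A w powr \<alpha> + A w powr (\<alpha> / 2)) * (1 + max 0 (ln (max (- B w) 0)))) \<partial>M) < \<infinity>"
proof -
  have log: "(\<integral>\<^sup>+w. ennreal \<bar>A w powr \<alpha> * ln (A w)\<bar> \<partial>M) < \<infinity>"
    using A_log_moment by (simp add: integrable_iff_bounded)
  have neg: "(\<integral>\<^sup>+w. ennreal (max (- B w) 0 powr (3 * \<alpha> / 4)) \<partial>M) < \<infinity>"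
    using alpha by (intro B_neg_moment) auto
  have "(\<integral>\<^sup>+w. ennreal ((A w powr \<alpha> + A w powr (\<alpha> / 2)) * (1 + max 0 (ln (max (- B w) 0)))) \<partial>M)
    \<le> (\<integral>\<^sup>+w. ennreal 2 * (1 + ennreal (A w powr \<alpha>) + ennreal 4 * ennreal \<bar>A w powr \<alpha> * ln (A w)\<bar>
         + ennreal (8 / \<alpha>) * ennreal (max (- B w) 0 powr (3 * \<alpha> / 4))) \<partial>M)"
  proof (intro nn_integral_mono)
    fix w
    have eq: "ennreal (2 * (1 + p + 4 * q + r * s)) = ennreal 2 * (1 + ennreal p + ennreal 4 * ennreal q + ennreal r * ennreal s)"
      if "p \<ge> 0" "q \<ge> 0" "r \<ge> 0" "s \<ge> 0" for p q r s
      using that by (simp add: ennreal_mult)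
    show "ennreal ((A w powr \<alpha> + A w powr (\<alpha> / 2)) * (1 + max 0 (ln (max (- B w) 0))))
      \<le> ennreal 2 * (1 + ennreal (A w powr \<alpha>) + ennreal 4 * ennreal \<bar>A w powr \<alpha> * ln (A w)\<bar>
         + ennreal (8 / \<alpha>) * ennreal (max (- B w) 0 powr (3 * \<alpha> / 4)))"
      using A_nonneg[of w] alpha by (intro order_trans[OF ennreal_leI[OF log_moment_bound] eq[THEN eq_refl]]) auto
  qed
  also have "\<dots> < \<infinity>"
    using log neg by (simp add: nn_integral_cmult nn_integral_add A_moment ennreal_mult_less_top emeasure_space_1)
  finally show ?thesis .
qed

text \<open>Dominated convergence: the inner integral is at most the negative part of
  \<open>B\<close> times \<open>exp (- v)\<close>, and for \<open>v \<ge> 0\<close> at most 1 plus a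
  positive logarithm, for which \<open>deficit_bound_integrable\<close> supplies the
  majorant.\<close>

lemma deficit_tail_tendsto: "(\<lambda>n. deficit_tail (real n)) \<longlonglongrightarrow> 0"
proof -
  define I where "I w v = (\<integral>\<^sup>+s. ennreal (min 1 (max (- B w) 0 * exp (- s))) * indicator {v..} s \<partial>lborel)" for w v
  define g where "g w = ennreal (A w powr \<alpha> + A w powr (\<alpha> / 2))" for w
  have [measurable]: "(\<lambda>w. I w v) \<in> borel_measurable M" for v unfolding I_def by measurable
  have [measurable]: "g \<in> borel_measurable M" unfolding g_def by measurable
  have I_exp: "I w v \<le> ennreal (max (- B w) 0 * exp (- v))" for w v
  proof -
    have "I w v \<le> (\<integral>\<^sup>+s. ennreal (max (- B w) 0) * (ennreal (exp (- 1 * s)) * indicator {v..} s) \<partial>lborel)"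
      unfolding I_def
    proof (intro nn_integral_mono)
      fix s
      have "ennreal (min 1 (max (- B w) 0 * exp (- s))) \<le> ennreal (max (- B w) 0) * ennreal (exp (- 1 * s))"
        by (subst ennreal_mult[symmetric]) (auto intro!: ennreal_leI)
      then show "ennreal (min 1 (max (- B w) 0 * exp (- s))) * indicator {v..} s
          \<le> ennreal (max (- B w) 0) * (ennreal (exp (- 1 * s)) * indicator {v..} s)"
        by (auto split: split_indicator)
    qed
    also have "\<dots> = ennreal (max (- B w) 0 * exp (- v))"
      using nn_integral_exp_atLeast[of 1 v] by (simp add: nn_integral_cmult ennreal_mult)
    finally show ?thesis .
  qed
  have I_log: "I w v \<le> ennreal (1 + max 0 (ln (max (- B w) 0)))" if "v \<ge> 0" for w v
  proof -
    have "I w v \<le> (\<integral>\<^sup>+s. ennreal (min 1 (max (- B w) 0 * exp (- s))) * indicator {0..} s \<partial>lborel)"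
      unfolding I_def using that by (intro nn_integral_mono) (auto split: split_indicator)
    also have "\<dots> \<le> ennreal (1 + max 0 (ln (max (- B w) 0)))" by (intro nn_integral_min_exp) auto
    finally show ?thesis .
  qed
  have "(\<lambda>n. \<integral>\<^sup>+w. g w * I w (real n) \<partial>M) \<longlonglongrightarrow> (\<integral>\<^sup>+w. 0 \<partial>M)"
  proof (rule nn_integral_dominated_convergence)
    let ?h = "\<lambda>w. ennreal ((A w powr \<alpha> + A w powr (\<alpha> / 2)) * (1 + max 0 (ln (max (- B w) 0))))"
    show "(\<integral>\<^sup>+w. ?h w \<partial>M) < \<infinity>" by (rule deficit_bound_integrable)
    show "AE w in M. g w * I w (real n) \<le> ?h w" for n
      unfolding g_def
      by (intro AE_I2 order_trans[OF mult_left_mono[OF I_log]]) (auto simp: ennreal_mult)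
    show "AE w in M. (\<lambda>n. g w * I w (real n)) \<longlonglongrightarrow> 0"
    proof (intro AE_I2)
      fix w
      have "(\<lambda>n. max (- B w) 0 * exp (- real n)) \<longlonglongrightarrow> 0" by real_asymp
      then have "(\<lambda>n. ennreal (max (- B w) 0 * exp (- real n))) \<longlonglongrightarrow> ennreal 0"
        by (intro tendsto_ennrealI)
      then have lim: "(\<lambda>n. ennreal (max (- B w) 0 * exp (- real n))) \<longlonglongrightarrow> 0"
        by simp
      have "(\<lambda>n. I w (real n)) \<longlonglongrightarrow> 0"
        by (rule tendsto_sandwich[OF always_eventually always_eventually tendsto_const lim])
           (intro allI zero_le I_exp)+
      then have "(\<lambda>n. g w * I w (real n)) \<longlonglongrightarrow> g w * 0"
        by (intro ennreal_tendsto_cmult) (auto simp: g_def)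
      then show "(\<lambda>n. g w * I w (real n)) \<longlonglongrightarrow> 0" by simp
    qed
  qed measurable
  then show ?thesis by (simp add: deficit_tail_def g_def I_def)
qed

definition deficit_const :: real where
  "deficit_const = 2 + 4 * exp (\<alpha> / 2 * ln 2) * exp (\<alpha> / 2)"

text \<open>Going back by a positive \<open>x\<close> only lowers \<open>pot\<close>; a negative
  \<open>x\<close> costs \<open>exp (- (\<alpha> / 2) * x)\<close> by \<open>pot_shift\<close>. The
  added 1 absorbs the constant in the upper bound for the tail of \<open>R\<close>.\<close>

lemma pot_backward: "tilted.pot (s - x) + 1 \<le> ennreal (1 + exp (- (\<alpha> / 2) * x)) * (tilted.pot s + 1)"
proof (cases "x \<ge> 0")
  case True
  have "tilted.pot (s - x) + 1 \<le> 1 * (tilted.pot s + 1)"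
    using tilted.pot_mono[of "s - x" s] True by (simp add: add_mono)
  also have "\<dots> \<le> ennreal (1 + exp (- (\<alpha> / 2) * x)) * (tilted.pot s + 1)"
    by (intro mult_right_mono) auto
  finally show ?thesis .
next
  case False
  define E where "E = exp (- (\<alpha> / 2) * x)"
  have "E \<ge> 1" using False alpha by (simp add: E_def mult_nonneg_nonpos)
  have "\<alpha> / 2 * - x = - (\<alpha> / 2) * x" by simp
  then have "tilted.pot (s - x) \<le> ennreal E * tilted.pot s"
    using tilted.pot_shift[of "- x" s] False unfolding E_def by simp
  moreover have "1 \<le> ennreal E" using \<open>E \<ge> 1\<close> by simp
  ultimately have "tilted.pot (s - x) + 1 \<le> ennreal E * (tilted.pot s + 1)"
    by (simp add: distrib_left add_mono)
  also have "\<dots> \<le> ennreal (1 + E) * (tilted.pot s + 1)"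
    by (intro mult_right_mono ennreal_leI) auto
  finally show ?thesis by (simp add: E_def)
qed

text \<open>Right of \<open>u\<close> the potential grows at most as fast as
  \<open>barrier (u - s)\<close> decays, with the same rate \<open>\<alpha> / 2\<close>; left of
  \<open>u\<close> monotonicity suffices.\<close>

lemma barrier_pot: "tilted.barrier (u - s) * (tilted.pot s + 1) \<le> tilted.pot u + 1"
proof (cases "s \<le> u")
  case True
  have "tilted.barrier (u - s) * (tilted.pot s + 1) \<le> 1 * (tilted.pot u + 1)"
    using True tilted.pot_mono[of s u] by (intro mult_mono tilted.barrier_le_1 add_mono) auto
  then show ?thesis by simp
next
  case False
  define E where "E = exp (\<alpha> / 2 * (s - u))"
  have E: "E \<ge> 1" using False alpha by (simp add: E_def)
  have eq: "\<alpha> / 2 * (u - s) = - (\<alpha> / 2 * (s - u))" by (simp only: minus_mult_right minus_diff_eq)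
  have "u - s \<le> 0" using False by simp
  then have b: "tilted.barrier (u - s) = ennreal (1 / E)"
    by (simp only: tilted.barrier_nonpos_arg eq exp_minus E_def inverse_eq_divide)
  have "tilted.pot (u + (s - u)) \<le> ennreal E * tilted.pot u"
    unfolding E_def using False by (intro tilted.pot_shift) auto
  then have "tilted.pot s + 1 \<le> ennreal E * tilted.pot u + ennreal E * 1"
    using E by (intro add_mono) auto
  then have "tilted.pot s + 1 \<le> ennreal E * (tilted.pot u + 1)"
    unfolding distrib_left .
  then have "ennreal (1 / E) * (tilted.pot s + 1) \<le> ennreal (1 / E) * (ennreal E * (tilted.pot u + 1))"
    by (intro mult_left_mono) auto
  also have "\<dots> = ennreal (1 / E * E) * (tilted.pot u + 1)"
    using E by (subst ennreal_mult) (auto simp: mult.assoc)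
  finally show ?thesis using E b by simp
qed

text \<open>Levels below \<open>v\<close> are charged trivially. Above,
  \<open>log_integral_deficit\<close> leaves \<open>R\<close> only in the event
  \<open>exp s < A * R\<close>, so independence produces \<open>tail R (s - ln A)\<close>. Its bound
  is carried from \<open>s - ln A\<close> to \<open>s\<close> by \<open>pot_backward\<close> and
  from \<open>s\<close> to \<open>u\<close> by \<open>barrier_pot\<close>, so that
  \<open>pot u + 1\<close> factors out.\<close>

lemma AR_compensated_conv:
  assumes C: "C \<ge> 0" "\<And>u. ennreal (tail R u) \<le> ennreal C * (tilted.pot u + 1)"
  shows "conv AR_compensated tilted.barrier u
    \<le> ennreal (exp (\<alpha> * v) / \<alpha>) + ennreal (deficit_const * C) * deficit_tail (v - 1) * (tilted.pot u + 1)"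
proof -
  interpret pair_sigma_finite lborel M ..
  let ?b = "tilted.barrier"
  define m where "m w = max (- B w) 0" for w
  have [measurable]: "m \<in> borel_measurable M" unfolding m_def by measurable
  define P where "P s w \<longleftrightarrow> B w \<le> 0 \<and> A w * R w + B w \<le> exp s \<and> exp s < A w * R w" for s w
  have [measurable]: "Measurable.pred (borel \<Otimes>\<^sub>M M) (\<lambda>(s, w). P s w)" unfolding P_def by measurable
  define q where "q s w = ennreal (min 1 (m w * exp (- s)))" for s w
  have [measurable]: "(\<lambda>(s, w). q s w) \<in> borel_measurable (borel \<Otimes>\<^sub>M M)" unfolding q_def by measurable
  let ?J = "\<lambda>s w x. if v - 1 \<le> s \<and> exp s < A w * R x then q s w * ennreal (exp (\<alpha> * s)) * ?b (u - s) else 0"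
  let ?H = "\<lambda>s w. ennreal C * (ennreal (A w powr \<alpha> + A w powr (\<alpha> / 2)) * (q s w * indicator {v - 1..} s)) * (tilted.pot u + 1)"
  let ?K = "\<lambda>s w. if P s w then ennreal (exp (\<alpha> * s)) * ?b (u - s) else 0"
  let ?D = "\<lambda>s w. if v \<le> s \<and> A w * R w - m w \<le> exp s \<and> exp s < A w * R w then ennreal (exp (\<alpha> * s)) * ?b (u - s) else 0"
  have q_exp: "ennreal (min 1 (m w * exp (- s)) * exp (\<alpha> * s)) = q s w * ennreal (exp (\<alpha> * s))" for s w
    unfolding q_def by (intro ennreal_mult) (auto simp: m_def)
  have "conv AR_compensated ?b u
     = (\<integral>\<^sup>+s. (\<integral>\<^sup>+w. ?K s w \<partial>M) \<partial>lborel)"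
    unfolding conv_def AR_compensated_def P_def[symmetric]
    by (intro nn_integral_cong) (subst nn_integral_multc[symmetric], auto intro!: nn_integral_cong)
  also have "\<dots> = (\<integral>\<^sup>+w. (\<integral>\<^sup>+s. ?K s w \<partial>lborel) \<partial>M)"
    by (intro Fubini'[symmetric]) measurable
  also have "\<dots> \<le> (\<integral>\<^sup>+w. ennreal (exp (\<alpha> * v) / \<alpha>) + ennreal deficit_const *
      (\<integral>\<^sup>+s. ?J s w w \<partial>lborel) \<partial>M)"
  proof (intro nn_integral_mono)
    fix w assume w: "w \<in> space M"
    show "(\<integral>\<^sup>+s. ?K s w \<partial>lborel)
      \<le> ennreal (exp (\<alpha> * v) / \<alpha>) + ennreal deficit_const *
      (\<integral>\<^sup>+s. ?J s w w \<partial>lborel)"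
    proof (cases "A w * R w > 0")
      case False
      then have "\<not> P s w" for s unfolding P_def using exp_gt_zero[of s] by linarith
      then show ?thesis by simp
    next
      case True
      have "(\<integral>\<^sup>+s. ?K s w \<partial>lborel)
        \<le> (\<integral>\<^sup>+s. (if s < v then ennreal (exp (\<alpha> * s)) else 0)
           + ?D s w \<partial>lborel)"
      proof (intro nn_integral_mono)
        fix s
        have "ennreal (exp (\<alpha> * s)) * ?b (u - s) \<le> ennreal (exp (\<alpha> * s)) * 1"
          by (intro mult_left_mono tilted.barrier_le_1) auto
        then show "?K s w
          \<le> (if s < v then ennreal (exp (\<alpha> * s)) else 0)
           + ?D s w"
          by (auto simp: P_def m_def)
      qed
      also have "\<dots> = ennreal (exp (\<alpha> * v) / \<alpha>)
           + (\<integral>\<^sup>+s. ?D s w \<partial>lborel)"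
        using alpha by (subst nn_integral_add) (auto simp: nn_integral_exp_lessThan)
      also have "\<dots> \<le> ennreal (exp (\<alpha> * v) / \<alpha>) + ennreal deficit_const *
          (\<integral>\<^sup>+s. (if v - 1 \<le> s \<and> exp s < A w * R w then ennreal (min 1 (m w * exp (- s)) * exp (\<alpha> * s)) * ?b (u - s) else 0) \<partial>lborel)"
        unfolding deficit_const_def using True alpha
        by (intro add_left_mono tilted.log_integral_deficit) (auto simp: m_def)
      finally show ?thesis unfolding q_exp .
    qed
  qed
  also have "\<dots> = ennreal (exp (\<alpha> * v) / \<alpha>) + ennreal deficit_const *
      (\<integral>\<^sup>+w. (\<integral>\<^sup>+s. ?J s w w \<partial>lborel) \<partial>M)"
    by (subst nn_integral_add) (auto simp: nn_integral_cmult emeasure_space_1)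
  also have "(\<integral>\<^sup>+w. (\<integral>\<^sup>+s. ?J s w w \<partial>lborel) \<partial>M)
     \<le> ennreal C * deficit_tail (v - 1) * (tilted.pot u + 1)"
  proof -
    have "(\<integral>\<^sup>+w. (\<integral>\<^sup>+s. ?J s w w \<partial>lborel) \<partial>M)
      = (\<integral>\<^sup>+s. (\<integral>\<^sup>+w. ?J s w w \<partial>M) \<partial>lborel)"
      by (intro Fubini') measurable
    also have "\<dots> \<le> (\<integral>\<^sup>+s. (\<integral>\<^sup>+w. ?H s w \<partial>M) \<partial>lborel)"
    proof (rule nn_integral_mono)
      fix s
      have "(\<integral>\<^sup>+w. ?J s w w \<partial>M)
        = (\<integral>\<^sup>+w. (\<integral>\<^sup>+x. ?J s w x \<partial>M) \<partial>M)"
        unfolding q_def m_def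
        by (rule independent'[where f = "\<lambda>r a b. (if v - 1 \<le> s \<and> exp s < a * r then ennreal (min 1 (max (- b) 0 * exp (- s))) * ennreal (exp (\<alpha> * s)) * ?b (u - s) else 0)"]) measurable
      also have "\<dots> \<le> (\<integral>\<^sup>+w. ?H s w \<partial>M)"
      proof (intro nn_integral_mono)
        fix w
        show "(\<integral>\<^sup>+x. ?J s w x \<partial>M)
          \<le> ?H s w"
        proof (cases "A w > 0 \<and> v - 1 \<le> s")
          case False
          then have "(v - 1 \<le> s \<and> exp s < A w * R x) = False" for x
            using A_nonneg[of w] by (cases "A w = 0") auto
          then show ?thesis by (simp only: if_False nn_integral_const mult_zero_left zero_le)
        next
          case True
          then have a: "A w > 0" and s: "v - 1 \<le> s" by auto
          have "(\<integral>\<^sup>+x. ?J s w x \<partial>M)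
             = (\<integral>\<^sup>+x. (q s w * ?b (u - s)) * (if exp s < A w * R x then ennreal (exp (\<alpha> * s)) else 0) \<partial>M)"
            using s by (intro nn_integral_cong) (auto simp: ac_simps)
          also have "\<dots> = q s w * ?b (u - s) * (ennreal (A w powr \<alpha>) * ennreal (tail R (s - ln (A w))))"
            unfolding scaled_tail[OF a] by (intro nn_integral_cmult) measurable
          also have "\<dots> \<le> q s w * ?b (u - s) * (ennreal (A w powr \<alpha>) * (ennreal C * (ennreal (1 + exp (- (\<alpha> / 2) * ln (A w))) * (tilted.pot s + 1))))"
            by (intro mult_left_mono order_trans[OF C(2)] pot_backward) auto
          also have "\<dots> = ennreal C * (ennreal (A w powr \<alpha>) * ennreal (1 + exp (- (\<alpha> / 2) * ln (A w)))) * q s w * (?b (u - s) * (tilted.pot s + 1))"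
            by (simp only: ac_simps)
          also have "ennreal (A w powr \<alpha>) * ennreal (1 + exp (- (\<alpha> / 2) * ln (A w))) = ennreal (A w powr \<alpha> + A w powr (\<alpha> / 2))"
            using a by (subst ennreal_mult[symmetric]) (auto simp: powr_def distrib_left simp flip: exp_add)
          also have "ennreal C * ennreal (A w powr \<alpha> + A w powr (\<alpha> / 2)) * q s w * (?b (u - s) * (tilted.pot s + 1))
             \<le> ennreal C * ennreal (A w powr \<alpha> + A w powr (\<alpha> / 2)) * q s w * (tilted.pot u + 1)"
            by (intro mult_left_mono barrier_pot) auto
          also have "\<dots> = ?H s w"
            using s by (simp add: ac_simps)
          finally show ?thesis .
        qed
      qed
      finally show "(\<integral>\<^sup>+w. ?J s w w \<partial>M)
        \<le> (\<integral>\<^sup>+w. ?H s w \<partial>M)" .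
    qed
    also have "\<dots> = (\<integral>\<^sup>+w. (\<integral>\<^sup>+s. ?H s w \<partial>lborel) \<partial>M)"
      unfolding atLeast_def by (intro Fubini'[symmetric]) measurable
    also have "\<dots> = ennreal C * deficit_tail (v - 1) * (tilted.pot u + 1)"
      unfolding deficit_tail_def q_def m_def
      by (simp add: nn_integral_multc nn_integral_cmult)
    finally show ?thesis .
  qed
  then have "ennreal deficit_const *
      (\<integral>\<^sup>+w. (\<integral>\<^sup>+s. ?J s w w \<partial>lborel) \<partial>M)
      \<le> ennreal deficit_const * (ennreal C * deficit_tail (v - 1) * (tilted.pot u + 1))"
    by (intro mult_left_mono) auto
  also have "\<dots> = ennreal (deficit_const * C) * deficit_tail (v - 1) * (tilted.pot u + 1)"
    using C by (simp add: ennreal_mult mult.assoc deficit_const_def)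
  finally show ?thesis by (simp add: add_left_mono)
qed

lemma AR_compensated_small:
  assumes C: "C \<ge> 0" "\<And>u. ennreal (tail R u) \<le> ennreal C * (tilted.pot u + 1)" and "\<epsilon> > 0"
  shows "\<forall>\<^sub>F u in at_top. conv AR_compensated tilted.barrier u \<le> ennreal (\<epsilon> * cum u)"
proof -
  \<comment> \<open>The added 1 keeps \<open>D\<close> positive even for \<open>C = 0\<close>.
    Eventually \<open>pot u + 1 \<le> 3 * cum u\<close>, so the 6 below leaves
    \<open>\<epsilon> / 2 * cum u\<close> for this term.\<close>
  define D where "D = deficit_const * C + 1"
  have dc: "deficit_const > 0" unfolding deficit_const_def by (intro add_pos_nonneg) auto
  have D: "D > 0" using dc C(1) by (simp add: D_def add_nonneg_pos)
  have "\<forall>\<^sub>F n in sequentially. deficit_tail (real n) < ennreal (\<epsilon> / (6 * D))"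
    using deficit_tail_tendsto assms(3) D by (intro order_tendstoD) auto
  then obtain n where n: "deficit_tail (real n) < ennreal (\<epsilon> / (6 * D))"
    by (auto simp: eventually_sequentially)
  define v where "v = real n + 1"
  have e2: "\<epsilon> / 2 > 0" using assms(3) by simp
  from tilted.pot_le_cum[OF zero_less_one] const_le_cum[OF zero_less_one, of 1]
    const_le_cum[OF e2, of "exp (\<alpha> * v) / \<alpha>"]
  show ?thesis
  proof eventually_elim
    case (elim u)
    have "conv AR_compensated tilted.barrier u
      \<le> ennreal (exp (\<alpha> * v) / \<alpha>) + ennreal (deficit_const * C) * deficit_tail (v - 1) * (tilted.pot u + 1)"
      by (rule AR_compensated_conv[OF C])
    also have "\<dots> \<le> ennreal (\<epsilon> / 2 * cum u) + ennreal D * ennreal (\<epsilon> / (6 * D)) * (ennreal (2 * cum u) + ennreal (cum u))"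
    proof (intro add_mono mult_mono)
      show "ennreal (exp (\<alpha> * v) / \<alpha>) \<le> ennreal (\<epsilon> / 2 * cum u)" using elim by (intro ennreal_leI) auto
      show "ennreal (deficit_const * C) \<le> ennreal D" by (intro ennreal_leI) (simp add: D_def)
      show "deficit_tail (v - 1) \<le> ennreal (\<epsilon> / (6 * D))" using n by (simp add: v_def)
      show "tilted.pot u \<le> ennreal (2 * cum u)" using elim(1) by simp
      show "1 \<le> ennreal (cum u)" using elim(2) by simp
    qed auto
    also have "\<dots> = ennreal (\<epsilon> / 2 * cum u + D * (\<epsilon> / (6 * D)) * (2 * cum u + cum u))"
    proof -
      have "ennreal p + ennreal q * ennreal r * (ennreal x + ennreal y) = ennreal (p + q * r * (x + y))"
        if "p \<ge> 0" "q \<ge> 0" "r \<ge> 0" "x \<ge> 0" "y \<ge> 0" for p q r x y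
        using that by (simp add: ennreal_mult)
      note * = this
      show ?thesis by (rule *) (use D assms(3) cum_nonneg[of u] in auto)
    qed
    also have "\<epsilon> / 2 * cum u + D * (\<epsilon> / (6 * D)) * (2 * cum u + cum u) = \<epsilon> * cum u"
      using D by (simp add: field_simps)
    finally show ?case .
  qed
qed

section \<open>Smallness of the errors, and the limit\<close>

lemma conv_barrier_le: "conv f tilted.barrier u \<le> (\<integral>\<^sup>+s. f s \<partial>lborel)"
proof -
  have "conv f tilted.barrier u \<le> (\<integral>\<^sup>+s. f s * 1 \<partial>lborel)"
    unfolding conv_def by (intro nn_integral_mono mult_left_mono tilted.barrier_le_1) auto
  then show ?thesis by simp
qed

lemma conv_barrier_small:
  assumes "(\<integral>\<^sup>+s. f s \<partial>lborel) < \<infinity>" "\<epsilon> > 0"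
  shows "\<forall>\<^sub>F u in at_top. conv f tilted.barrier u \<le> ennreal (\<epsilon> * cum u)"
  using const_le_cum[OF assms(2), of "enn2real (\<integral>\<^sup>+s. f s \<partial>lborel)"]
proof eventually_elim
  case (elim u)
  have "conv f tilted.barrier u \<le> (\<integral>\<^sup>+s. f s \<partial>lborel)" by (rule conv_barrier_le)
  also have "\<dots> = ennreal (enn2real (\<integral>\<^sup>+s. f s \<partial>lborel))" using assms by simp
  also have "\<dots> \<le> ennreal (\<epsilon> * cum u)" using elim by (intro ennreal_leI)
  finally show ?case .
qed

lemma tail_R_exp_le: "\<exists>K. \<forall>u. tail R u \<le> K * exp (\<alpha> / 2 * u)"
proof -
  define K where "K = enn2real (abs_moment R (\<alpha> / 2))"
  have K: "abs_moment R (\<alpha> / 2) = ennreal K" "K \<ge> 0"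
    using R_moment[of "\<alpha> / 2"] alpha by (auto simp: K_def)
  have "tail R u \<le> K * exp (\<alpha> / 2 * u)" for u
  proof -
    have "ennreal (tail R u) \<le> (\<integral>\<^sup>+w. ennreal (exp (\<alpha> / 2 * u)) * ennreal (\<bar>R w\<bar> powr (\<alpha> / 2)) \<partial>M)"
      unfolding tail_eq_nn_integral[OF measurable_R]
    proof (intro nn_integral_mono)
      fix w
      have "exp (\<alpha> * u) \<le> exp (\<alpha> / 2 * u) * \<bar>R w\<bar> powr (\<alpha> / 2)" if "exp u < R w"
      proof -
        have "exp u powr (\<alpha> / 2) \<le> \<bar>R w\<bar> powr (\<alpha> / 2)" using that alpha by (intro powr_mono2) auto
        then have "exp (\<alpha> / 2 * u) * exp (\<alpha> / 2 * u) \<le> exp (\<alpha> / 2 * u) * \<bar>R w\<bar> powr (\<alpha> / 2)"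
          by (intro mult_left_mono) (auto simp: powr_def)
        moreover have "exp (\<alpha> / 2 * u) * exp (\<alpha> / 2 * u) = exp (\<alpha> * u)"
          unfolding exp_add[symmetric] by simp
        ultimately show ?thesis by (simp only:)
      qed
      then show "weight u (exp u < R w) \<le> ennreal (exp (\<alpha> / 2 * u)) * ennreal (\<bar>R w\<bar> powr (\<alpha> / 2))"
        by (auto intro!: ennreal_leI simp flip: ennreal_mult)
    qed
    also have "\<dots> = ennreal (K * exp (\<alpha> / 2 * u))"
      using K by (subst nn_integral_cmult) (auto simp: ennreal_mult mult.commute)
    finally show ?thesis using K by simp
  qed
  then show ?thesis by blast
qed

lemma conv_tail_R_finite: "conv (\<lambda>s. ennreal (tail R s)) tilted.barrier u < \<infinity>"
proof -
  have "conv (\<lambda>s. ennreal (tail R s)) tilted.barrier u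
     \<le> (\<integral>\<^sup>+s. ennreal (exp (\<alpha> / 2 * u)) * ennreal (tail R s * exp (- (\<alpha> / 2) * s)) \<partial>lborel)"
    unfolding conv_def
  proof (intro nn_integral_mono)
    fix s
    have "ennreal (tail R s) * tilted.barrier (u - s) \<le> ennreal (tail R s) * ennreal (exp (\<alpha> / 2 * (u - s)))"
      by (intro mult_left_mono tilted.barrier_le_exp) auto
    also have "\<dots> = ennreal (exp (\<alpha> / 2 * u)) * ennreal (tail R s * exp (- (\<alpha> / 2) * s))"
    proof -
      have "exp (\<alpha> / 2 * (u - s)) = exp (\<alpha> / 2 * u) * exp (- (\<alpha> / 2) * s)"
        by (simp only: right_diff_distrib exp_diff exp_minus minus_mult_left[symmetric] divide_inverse)
      then show ?thesis using tail_nonneg[of R s] by (simp only: ennreal_mult exp_ge_zero mult_nonneg_nonneg mult_ac)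
    qed
    finally show "ennreal (tail R s) * tilted.barrier (u - s) \<le> ennreal (exp (\<alpha> / 2 * u)) * ennreal (tail R s * exp (- (\<alpha> / 2) * s))" .
  qed
  also have "\<dots> = ennreal (exp (\<alpha> / 2 * u)) * (ennreal (1 / (\<alpha> / 2)) * (\<integral>\<^sup>+w. ennreal (max (R w) 0 powr (\<alpha> / 2)) \<partial>M))"
    using tail_laplace[OF measurable_R, of "\<alpha> / 2"] alpha
    by (subst nn_integral_cmult) auto
  also have "\<dots> < \<infinity>"
  proof -
    have "(\<integral>\<^sup>+w. ennreal (max (R w) 0 powr (\<alpha> / 2)) \<partial>M) \<le> abs_moment R (\<alpha> / 2)"
      using alpha by (intro nn_integral_mono ennreal_leI powr_mono2) auto
    also have "\<dots> < \<infinity>" using alpha by (intro R_moment) auto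
    finally show ?thesis by (simp add: ennreal_mult_less_top)
  qed
  finally show ?thesis .
qed

text \<open>The upper bound involves only the integrable error \<open>both_needed\<close>. The bound
  \<open>crude\<close> drawn from it feeds \<open>AR_compensated_small\<close>, after which all
  errors in \<open>tail_R_ge\<close> are small enough for the lower bound.\<close>

theorem tail_asymptotics: "((\<lambda>u. tail R u / cum u) \<longlongrightarrow> 1 / drift) at_top"
proof -
  obtain K where K: "\<And>u. tail R u \<le> K * exp (\<alpha> / 2 * u)" using tail_R_exp_le by blast
  have upper: "\<exists>C\<ge>0. \<forall>u. ennreal (tail R u) \<le> ennreal a * tilted.pot u + ennreal C" if "a > 1 / drift" for a
    using tilted.growth_upper[OF tail_growth[OF measurable_R] tail_nonneg K
        measurable_errors(1) nn_integral_both_needed tail_R_le that] by metis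
  define a where "a = 1 / drift + 1"
  have a: "a > 1 / drift" "a > 0" using tilted.drift_pos by (auto simp: a_def add_pos_pos)
  obtain C where C: "C \<ge> 0" "\<And>u. ennreal (tail R u) \<le> ennreal a * tilted.pot u + ennreal C"
    using upper[OF a(1)] by blast
  have crude: "ennreal (tail R u) \<le> ennreal (a + C) * (tilted.pot u + 1)" for u
  proof -
    have "ennreal (tail R u) \<le> ennreal a * tilted.pot u + ennreal C * 1" using C by simp
    also have "\<dots> \<le> ennreal (a + C) * tilted.pot u + ennreal (a + C) * 1"
      using a C by (intro add_mono mult_right_mono ennreal_leI) auto
    finally show ?thesis by (simp add: distrib_left)
  qed
  show ?thesis
  proof (rule tilted.renewal_asymptotics[OF tail_growth[OF measurable_R] tail_nonneg K conv_tail_R_finite _ _ tail_R_ge upper])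
    fix \<epsilon> :: real assume "\<epsilon> > 0"
    then have e: "\<epsilon> / 3 > 0" by simp
    have aC: "a + C \<ge> 0" using a C by simp
    from conv_barrier_small[OF nn_integral_both_large e] conv_barrier_small[OF nn_integral_B_compensated e]
      AR_compensated_small[OF aC crude e]
    show "\<forall>\<^sub>F u in at_top. conv (\<lambda>u. both_large u + B_compensated u + AR_compensated u) tilted.barrier u \<le> ennreal (\<epsilon> * cum u)"
    proof eventually_elim
      case (elim u)
      have "conv (\<lambda>u. both_large u + B_compensated u + AR_compensated u) tilted.barrier u
         \<le> ennreal (\<epsilon> / 3 * cum u) + ennreal (\<epsilon> / 3 * cum u) + ennreal (\<epsilon> / 3 * cum u)"
        using elim by (simp add: conv_add add_mono)
      also have "\<dots> = ennreal (\<epsilon> * cum u)" using e cum_nonneg[of u] by (simp flip: ennreal_plus)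
      finally show ?case .
    qed
  qed measurable
qed

end

section \<open>Return to the original scale\<close>

text \<open>The substitution is made on the compact intervals from \<open>x * exp (- n)\<close> to
  \<open>x\<close>, followed by monotone convergence towards the end point 0.\<close>

lemma nn_integral_log_substitution:
  fixes f :: "real \<Rightarrow> real"
  assumes [measurable]: "f \<in> borel_measurable borel" and "x > 0"
  shows "(\<integral>\<^sup>+t. ennreal (f t) * indicator {0<..x} t \<partial>lborel)
       = (\<integral>\<^sup>+s. ennreal (f (exp s) * exp s) * indicator {..ln x} s \<partial>lborel)"
proof -
  define a where "a n = ln x - real n" for n
  have a_le: "a n \<le> ln x" for n by (simp add: a_def)
  have "(\<integral>\<^sup>+t. ennreal (f t) * indicator {0<..x} t \<partial>lborel)
      = (\<integral>\<^sup>+t. (SUP n. ennreal (f t) * indicator {exp (a n)..x} t) \<partial>lborel)"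
  proof (intro nn_integral_cong antisym)
    fix t :: real
    show "(SUP n. ennreal (f t) * indicator {exp (a n)..x} t) \<le> ennreal (f t) * indicator {0<..x} t"
      by (intro SUP_least) (auto split: split_indicator intro: less_le_trans[OF exp_gt_zero])
    show "ennreal (f t) * indicator {0<..x} t \<le> (SUP n. ennreal (f t) * indicator {exp (a n)..x} t)"
    proof (cases "t \<in> {0<..x}")
      case True
      obtain n :: nat where "ln x - ln t \<le> real n" using real_arch_simple by blast
      then have "exp (a n) \<le> exp (ln t)" unfolding exp_le_cancel_iff by (simp add: a_def)
      also have "exp (ln t) = t" using True by simp
      finally show ?thesis using True by (intro SUP_upper2[where i = n]) auto
    qed simp
  qed
  also have "\<dots> = (SUP n. \<integral>\<^sup>+t. ennreal (f t) * indicator {exp (a n)..x} t \<partial>lborel)"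
  proof (intro nn_integral_monotone_convergence_SUP)
    show "incseq (\<lambda>n t. ennreal (f t) * indicator {exp (a n)..x} t)"
    proof (intro incseq_SucI le_funI)
      fix n t
      have "exp (a (Suc n)) \<le> exp (a n)" by (simp add: a_def)
      then show "ennreal (f t) * indicator {exp (a n)..x} t \<le> ennreal (f t) * indicator {exp (a (Suc n))..x} t"
        by (auto split: split_indicator simp del: exp_le_cancel_iff)
    qed
  qed measurable
  also have "\<dots> = (SUP n. \<integral>\<^sup>+s. ennreal (f (exp s) * exp s) * indicator {a n..ln x} s \<partial>lborel)"
  proof (intro SUP_cong refl)
    fix n
    have "(\<integral>\<^sup>+t. ennreal (f t * indicator {exp (a n)..exp (ln x)} t) \<partial>lborel)
        = (\<integral>\<^sup>+s. ennreal (f (exp s) * exp s * indicator {a n..ln x} s) \<partial>lborel)"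
      by (rule nn_integral_substitution)
         (use a_le in \<open>auto simp: set_borel_measurable_def intro!: derivative_eq_intros continuous_intros\<close>)
    moreover have "ennreal (c * indicator S t) = ennreal c * indicator S t" for c :: real and S and t :: real
      by (auto split: split_indicator)
    ultimately show "(\<integral>\<^sup>+t. ennreal (f t) * indicator {exp (a n)..x} t \<partial>lborel)
        = (\<integral>\<^sup>+s. ennreal (f (exp s) * exp s) * indicator {a n..ln x} s \<partial>lborel)"
      using assms by simp
  qed
  also have "\<dots> = (\<integral>\<^sup>+s. (SUP n. ennreal (f (exp s) * exp s) * indicator {a n..ln x} s) \<partial>lborel)"
    by (intro nn_integral_monotone_convergence_SUP[symmetric])
       (auto simp: incseq_def le_fun_def a_def split: split_indicator)
  also have "\<dots> = (\<integral>\<^sup>+s. ennreal (f (exp s) * exp s) * indicator {..ln x} s \<partial>lborel)"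
  proof (intro nn_integral_cong antisym)
    fix s :: real
    show "(SUP n. ennreal (f (exp s) * exp s) * indicator {a n..ln x} s) \<le> ennreal (f (exp s) * exp s) * indicator {..ln x} s"
      by (intro SUP_least) (auto split: split_indicator)
    obtain n :: nat where "ln x - s \<le> real n" using real_arch_simple by blast
    then show "ennreal (f (exp s) * exp s) * indicator {..ln x} s \<le> (SUP n. ennreal (f (exp s) * exp s) * indicator {a n..ln x} s)"
      by (intro SUP_upper2[where i = n]) (auto simp: a_def split: split_indicator)
  qed
  finally show ?thesis .
qed

context perpetuity
begin

lemma cum_eq_integral:
  assumes "x > 0"
  shows "(LBINT t:{0<..x}. t powr \<alpha> * prob {w \<in> space M. B w > t} / t) = cum (ln x)"
proof -
  let ?f = "\<lambda>t. t powr \<alpha> * prob {w \<in> space M. B w > t} / t"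
  have "mono (\<lambda>t. - prob {w \<in> space M. B w > t})"
    by (intro monoI le_imp_neg_le finite_measure_mono) auto
  then have "(\<lambda>t. - (- prob {w \<in> space M. B w > t})) \<in> borel_measurable borel"
    by (intro borel_measurable_uminus borel_measurable_mono)
  then have [measurable]: "(\<lambda>t. prob {w \<in> space M. B w > t}) \<in> borel_measurable borel" by simp
  have "(LBINT t:{0<..x}. ?f t) = enn2real (\<integral>\<^sup>+t. ennreal (indicator {0<..x} t *\<^sub>R ?f t) \<partial>lborel)"
    unfolding set_lebesgue_integral_def
    by (rule integral_eq_nn_integral) (auto split: split_indicator)
  also have "(\<integral>\<^sup>+t. ennreal (indicator {0<..x} t *\<^sub>R ?f t) \<partial>lborel)
      = (\<integral>\<^sup>+t. ennreal (?f t) * indicator {0<..x} t \<partial>lborel)"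
    by (intro nn_integral_cong) (auto split: split_indicator)
  also have "\<dots> = (\<integral>\<^sup>+s. ennreal (?f (exp s) * exp s) * indicator {..ln x} s \<partial>lborel)"
    using assms by (intro nn_integral_log_substitution) measurable
  also have "\<dots> = ennreal (cum (ln x))"
    unfolding ennreal_cum by (intro nn_integral_cong) (simp add: tail_def powr_def)
  finally show ?thesis by (simp add: cum_nonneg)
qed

theorem tail_asymp_equiv:
  "(\<lambda>x. x powr \<alpha> * prob {w \<in> space M. R w > x})
     \<sim>[at_top] (\<lambda>x. 1 / drift * (LBINT t:{0<..x}. t powr \<alpha> * prob {w \<in> space M. B w > t} / t))"
proof (rule asymp_equivI')
  have "((\<lambda>x. drift * (tail R (ln x) / cum (ln x))) \<longlongrightarrow> drift * (1 / drift)) at_top"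
    by (rule tendsto_mult[OF tendsto_const filterlim_compose[OF tail_asymptotics ln_at_top]])
  then have lim: "((\<lambda>x. drift * (tail R (ln x) / cum (ln x))) \<longlongrightarrow> 1) at_top"
    using tilted.drift_pos by simp
  have "\<forall>\<^sub>F x in at_top. drift * (tail R (ln x) / cum (ln x))
      = x powr \<alpha> * prob {w \<in> space M. R w > x}
        / (1 / drift * (LBINT t:{0<..x}. t powr \<alpha> * prob {w \<in> space M. B w > t} / t))"
    using eventually_gt_at_top[of 0]
  proof eventually_elim
    case (elim x)
    then have "tail R (ln x) = x powr \<alpha> * prob {w \<in> space M. R w > x}"
      by (simp add: tail_def powr_def)
    then show ?case using cum_eq_integral[OF elim] by simp
  qed
  with lim show "((\<lambda>x. x powr \<alpha> * prob {w \<in> space M. R w > x}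
        / (1 / drift * (LBINT t:{0<..x}. t powr \<alpha> * prob {w \<in> space M. B w > t} / t))) \<longlongrightarrow> 1) at_top"
    by (rule Lim_transform_eventually)
qed

end

section \<open>Independence as a product law, and transfer to the stated hypotheses\<close>

lemma indep_rv_distr:
  assumes "prob_space M" and ind: "indep_rv M N X N' Y"
  shows "distr M (N \<Otimes>\<^sub>M N') (\<lambda>w. (X w, Y w)) = distr M N X \<Otimes>\<^sub>M distr M N' Y"
proof -
  interpret prob_space M by fact
  have [measurable]: "X \<in> measurable M N" "Y \<in> measurable M N'"
    and set: "indep_set (sets (vimage_algebra (space M) X N)) (sets (vimage_algebra (space M) Y N'))"
    using ind by (auto simp: indep_rv_def)
  interpret X: prob_space "distr M N X" by (rule prob_space_distr) measurable
  interpret Y: prob_space "distr M N' Y" by (rule prob_space_distr) measurable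
  show ?thesis
  proof (rule pair_measure_eqI[symmetric])
    fix S T assume "S \<in> sets (distr M N X)" "T \<in> sets (distr M N' Y)"
    then have [measurable]: "S \<in> sets N" "T \<in> sets N'" by auto
    have "prob ((X -` S \<inter> space M) \<inter> (Y -` T \<inter> space M)) = prob (X -` S \<inter> space M) * prob (Y -` T \<inter> space M)"
      using set unfolding indep_set_def
      by (intro indep_setD[OF set]) (auto intro: in_vimage_algebra)
    moreover have "(\<lambda>w. (X w, Y w)) -` (S \<times> T) \<inter> space M = (X -` S \<inter> space M) \<inter> (Y -` T \<inter> space M)"
      by auto
    ultimately show "emeasure (distr M N X) S * emeasure (distr M N' Y) T
        = emeasure (distr M (N \<Otimes>\<^sub>M N') (\<lambda>w. (X w, Y w))) (S \<times> T)"
      by (simp add: emeasure_distr emeasure_eq_measure ennreal_mult)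
  qed (auto intro: X.sigma_finite_measure_axioms Y.sigma_finite_measure_axioms)
qed

theorem theorem1p1:
  fixes M :: "'a measure" and A B R :: "'a \<Rightarrow> real" and \<alpha> :: real
  defines "\<rho> \<equiv> prob_space.expectation M (\<lambda>w. A w powr \<alpha> * ln (A w))"
    and "L \<equiv> (\<lambda>x::real. x powr \<alpha> * Sigma_Algebra.measure M {w \<in> space M. B w > x})"
  assumes "prob_space M"
    and "A \<in> borel_measurable M" and "B \<in> borel_measurable M"
    and "\<alpha> > 0"
    and "AE w in M. A w \<ge> 0"
    and "\<not> arithmetic_law (cond_log_law M A)"
    and "prob_space.expectation M (\<lambda>w. A w powr \<alpha>) = 1"
    and "integrable M (\<lambda>w. A w powr \<alpha> * ln (A w))"
    and "slowly_varying L"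
    and "(\<integral>\<^sup>+ w. ennreal (max (B w) 0 powr \<alpha>) \<partial>M) = \<infinity>"
    and "\<forall>\<epsilon>\<in>{0<..<\<alpha>}. (\<integral>\<^sup>+ w. ennreal (max (- B w) 0 powr (\<alpha> - \<epsilon>)) \<partial>M) < \<infinity>"
    and "\<exists>\<eta>\<in>{0<..<\<alpha>} \<inter> {0<..1}.
           (\<integral>\<^sup>+ w. ennreal (A w powr \<eta> * max (B w) 0 powr (\<alpha> - \<eta>)) \<partial>M) < \<infinity>"
    and "perpetuity_solution M A B R"
  shows "(\<lambda>x. x powr \<alpha> * Sigma_Algebra.measure M {w \<in> space M. R w > x})
           \<sim>[at_top] (\<lambda>x. 1 / \<rho> * (LBINT t:{0<..x}. L t / t))"
proof -
  interpret prob_space M by fact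
  note [measurable] = assms(4,5)
  have ind: "indep_rv M borel R (borel \<Otimes>\<^sub>M borel) (\<lambda>w. (A w, B w))"
    and stat: "distr M borel R = distr M borel (\<lambda>w. A w * R w + B w)"
    using assms(15) by (auto simp: perpetuity_solution_def)
  have [measurable]: "R \<in> borel_measurable M" using ind by (simp add: indep_rv_def)
  obtain \<eta> where eta: "0 < \<eta>" "\<eta> < \<alpha>" "\<eta> \<le> 1"
    "(\<integral>\<^sup>+ w. ennreal (A w powr \<eta> * max (B w) 0 powr (\<alpha> - \<eta>)) \<partial>M) < \<infinity>"
    using assms(14) by auto
  \<comment> \<open>A version of \<open>A\<close> that is nonnegative everywhere, as the locale
    demands.\<close>
  define A' where "A' w = max (A w) 0" for w
  have [measurable]: "A' \<in> borel_measurable M" unfolding A'_def by measurable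
  have AE: "AE w in M. A' w = A w" using assms(7) by eventually_elim (simp add: A'_def)
  have drift_eq: "expectation (\<lambda>w. A' w powr \<alpha> * ln (A' w)) = \<rho>"
    unfolding \<rho>_def by (intro integral_cong_AE) (use AE in auto)
  have moment: "(\<integral>\<^sup>+w. ennreal (A' w powr \<alpha>) \<partial>M) = 1"
  proof -
    \<comment> \<open>A non-integrable function has expectation 0 by convention, so the value 1
      entails integrability.\<close>
    have int: "integrable M (\<lambda>w. A w powr \<alpha>)"
      using assms(9) not_integrable_integral_eq by fastforce
    have "(\<integral>\<^sup>+w. ennreal (A' w powr \<alpha>) \<partial>M) = (\<integral>\<^sup>+w. ennreal (A w powr \<alpha>) \<partial>M)"
      by (intro nn_integral_cong_AE) (use AE in auto)
    also have "\<dots> = ennreal (expectation (\<lambda>w. A w powr \<alpha>))"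
      by (intro nn_integral_eq_integral int) auto
    finally show ?thesis using assms(9) by simp
  qed
  \<comment> \<open>If \<open>A = 1\<close> almost surely, then \<open>ln A\<close> is concentrated
    at 0, a point of every lattice.\<close>
  have nontrivial: "\<not> (AE w in M. A' w = 1)"
  proof
    assume "AE w in M. A' w = 1"
    with AE have one: "AE w in M. A w = 1" by eventually_elim simp
    have "AE x in cond_log_law M A. \<exists>k::int. x = 1 * of_int k"
    proof -
      have "AE w in uniform_measure M {w \<in> space M. A w > 0}. ln (A w) = 0"
        unfolding uniform_measure_def by (subst AE_density) (use one in \<open>auto elim: eventually_mono\<close>)
      then have "AE x in cond_log_law M A. x = 0"
        unfolding cond_log_law_def by (subst AE_distr_iff) auto
      then show ?thesis by eventually_elim (auto intro: exI[of _ "0::int"])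
    qed
    then have "arithmetic_law (cond_log_law M A)"
      unfolding arithmetic_law_def by (intro exI[of _ 1]) auto
    then show False using assms(8) by simp
  qed
  have joint: "distr M (borel \<Otimes>\<^sub>M (borel \<Otimes>\<^sub>M borel)) (\<lambda>w. (R w, A w, B w))
      = distr M borel R \<Otimes>\<^sub>M distr M (borel \<Otimes>\<^sub>M borel) (\<lambda>w. (A w, B w))"
    using indep_rv_distr[OF assms(3) ind] by simp
  interpret perpetuity M A' B R \<alpha> \<eta>
  proof
    show "(\<integral>\<^sup>+ w. ennreal (A' w powr \<eta> * max (B w) 0 powr (\<alpha> - \<eta>)) \<partial>M) < \<infinity>"
    proof -
      have "(\<integral>\<^sup>+ w. ennreal (A' w powr \<eta> * max (B w) 0 powr (\<alpha> - \<eta>)) \<partial>M)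
          = (\<integral>\<^sup>+ w. ennreal (A w powr \<eta> * max (B w) 0 powr (\<alpha> - \<eta>)) \<partial>M)"
        by (intro nn_integral_cong_AE) (use AE in auto)
      then show ?thesis using eta by simp
    qed
    show "integrable M (\<lambda>w. A' w powr \<alpha> * ln (A' w))"
      using assms(10) by (rule integrable_cong_AE_imp) (use AE in auto)
    show "(\<integral>\<^sup>+w. ennreal (max (- B w) 0 powr s) \<partial>M) < \<infinity>" if "0 < s" "s < \<alpha>" for s
      using assms(13)[rule_format, of "\<alpha> - s"] that by simp
    show "distr M borel R = distr M borel (\<lambda>w. A' w * R w + B w)"
      unfolding stat by (intro distr_cong_AE) (use AE in auto)
    fix f :: "real \<times> real \<times> real \<Rightarrow> ennreal"
    assume [measurable]: "f \<in> borel_measurable (borel \<Otimes>\<^sub>M (borel \<Otimes>\<^sub>M borel))"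
    \<comment> \<open>Composing with \<open>max a 0\<close> reduces the identity for
      \<open>A'\<close> to the joint law of \<open>(R, A, B)\<close>.\<close>
    define g where "g = (\<lambda>(r, a, b). f (r, max a 0, b))"
    have [measurable]: "g \<in> borel_measurable (borel \<Otimes>\<^sub>M (borel \<Otimes>\<^sub>M borel))"
      unfolding g_def by measurable
    interpret AB: prob_space "distr M (borel \<Otimes>\<^sub>M borel) (\<lambda>w. (A w, B w))" by (rule prob_space_distr) measurable
    interpret Rd: prob_space "distr M borel R" by (rule prob_space_distr) measurable
    interpret P: pair_sigma_finite "distr M borel R" "distr M (borel \<Otimes>\<^sub>M borel) (\<lambda>w. (A w, B w))" ..
    have "(\<integral>\<^sup>+w. f (R w, A' w, B w) \<partial>M)
        = (\<integral>\<^sup>+z. g z \<partial>distr M (borel \<Otimes>\<^sub>M (borel \<Otimes>\<^sub>M borel)) (\<lambda>w. (R w, A w, B w)))"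
      by (subst nn_integral_distr) (auto simp: g_def A'_def)
    also have "\<dots> = (\<integral>\<^sup>+y. (\<integral>\<^sup>+r. g (r, y) \<partial>distr M borel R) \<partial>distr M (borel \<Otimes>\<^sub>M borel) (\<lambda>w. (A w, B w)))"
      unfolding joint by (intro P.nn_integral_snd[symmetric]) measurable
    also have "\<dots> = (\<integral>\<^sup>+w. (\<integral>\<^sup>+v. f (R v, A' w, B w) \<partial>M) \<partial>M)"
      by (subst nn_integral_distr, measurable, intro nn_integral_cong, subst nn_integral_distr)
         (auto simp: g_def A'_def)
    finally show "(\<integral>\<^sup>+w. f (R w, A' w, B w) \<partial>M) = (\<integral>\<^sup>+w. (\<integral>\<^sup>+v. f (R v, A' w, B w) \<partial>M) \<partial>M)" .
  qed (use assms eta moment nontrivial in \<open>auto simp: A'_def L_def\<close>)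
  show ?thesis
    using tail_asymp_equiv unfolding L_def drift_def drift_eq .
qed

end
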